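(* Let $I$ be a totally ordered set, let $\{\mathfrak{A}_i\}_{i\in I}$ and $\mathfrak{D}$ be unital C$^*$-algebras, and let $\mathfrak{B}$ be a common C$^*$-subalgebra of all of them containing their units. Suppose that $\psi_i:\mathfrak{A}_i\to\mathfrak{B}$ are positive conditional expectations and $\theta_i:\mathfrak{A}_i\to\mathfrak{D}$ are unital, completely positive $\mathfrak{B}$-bimodule maps ($i\in I$). Then the monotone product $\theta=\underset{i\in I}{\rhd}\theta_i:\mathfrak{A}\to\mathfrak{D}$ (defined in the context, on the free product $\ast$-algebra $\mathfrak{A}$ of the $\mathfrak{A}_i$) is also a completely positive $\mathfrak{B}$-bimodule map.
   Context: $\mathfrak{A}$ denotes the (non-unital) free product $\ast$-algebra of the $\mathfrak{A}_i$ without amalgamation over $\mathfrak{B}$, viewed as a $\mathfrak{B}$-ring: as a vector space $$\mathfrak{A}=\bigoplus_{n\ge1}\ \bigoplus_{i_1\ne i_2\ne\cdots\ne i_n}\mathfrak{A}_{i_1}\otimes_{\mathfrak{B}}\mathfrak{A}_{i_2}\otimes_{\mathfrak{B}}\cdots\otimes_{\mathfrak{B}}\mathfrak{A}_{i_n}$$ (consecutive indices distinct), with the multiplication given by concatenation of words, where neighbouring letters from the same $\mathfrak{A}_i$ are multiplied in $\mathfrak{A}_i$, and involution $(a_1\cdots a_n)^*=a_n^*\cdots a_1^*$. Equivalently, $\mathfrak{B}1\oplus\mathfrak{A}$ is the free product with amalgamation over $\mathfrak{B}1$ of the algebras $\widetilde{\mathfrak{A}_i}=\mathfrak{B}1\oplus\mathfrak{A}_i$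 (so the copies of $\mathfrak{B}$ inside different $\mathfrak{A}_i$ are not identified with one another in $\mathfrak{A}$). The monotone product $\theta=\underset{i\in I}{\rhd}\theta_i:\mathfrak{A}\to\mathfrak{D}$ (with respect to the expectations $\psi_i$) is the linear map with $\theta|_{\mathfrak{A}_i}=\theta_i$ determined by the following rules for $a_k\in\mathfrak{A}_{i_k}$, $i_s\ne i_{s+1}$: (1) $\theta(a_1\cdots a_n)=\theta_{i_1}(a_1)\theta(a_2\cdots a_n)$ if $i_1>i_2$; (2) $\theta(a_1\cdots a_n)=\theta(a_1\cdots a_{n-1})\theta_{i_n}(a_n)$ if $i_n>i_{n-1}$; (3) $\theta(a_1\cdots a_n)=\theta(a_1\cdots a_{k-1}\psi_{i_k}(a_k)a_{k+1}\cdots a_n)+\theta(a_1\cdots a_{k-1})[\theta_{i_k}(a_k)-\psi_{i_k}(a_k)]\theta(a_{k+1}\cdots a_n)$ if $1<k<n$ and $i_{k-1}<i_k>i_{k+1}$, where $\psi_{i_k}(a_k)\in\mathfrak{B}$ acts through the $\mathfrak{B}$-bimodule structure. Complete positivity of a linear map $\theta$ on the $\ast$-algebra $\mathfrak{A}$ means: for each $n\ge1$ and each positive $A=[a_{i,j}]\in M_n(\mathfrak{A})$ (i.e. a finite sum of elements $X^*X$ with $X\in M_n(\mathfrak{A})$), the matrix $[\theta(a_{i,j})]$ is positive in $M_n(\mathfrak{D})$. *)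

theory Defs
  imports
    Complex_Main
    "HOL-Library.FuncSet"
    "HOL-Library.Poly_Mapping"
    "HOL-Algebra.QuotRing"
    "HOL-Algebra.Module"
    "HOL-Algebra.Algebraic_Closure_Type"
begin

section \<open>C*-algebras\<close>

text \<open>
  The record of operations of a complex *-algebra.  It is also used for non-unital *-algebras;
  their field \<open>one\<close> is then meaningless and never used.
\<close>

record 'a star_algebra = "(complex, 'a) module" +
  adj :: "'a \<Rightarrow> 'a"

record 'a cstar_algebra = "'a star_algebra" +
  cnorm :: "'a \<Rightarrow> real"

text \<open>
  Unital C*-algebras.  The term \<open>ring_of_type_algebra :: complex ring\<close> is the field of complex
  numbers.
\<close>

locale cstar_algebra =
  ring A + module "ring_of_type_algebra :: complex ring" A
  for A :: "'a cstar_algebra" (structure) +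
  assumes smult_mult_left:
      "\<lbrakk>x \<in> carrier A; y \<in> carrier A\<rbrakk> \<Longrightarrow> (c \<odot> x) \<otimes> y = c \<odot> (x \<otimes> y)"
    and smult_mult_right:
      "\<lbrakk>x \<in> carrier A; y \<in> carrier A\<rbrakk> \<Longrightarrow> x \<otimes> (c \<odot> y) = c \<odot> (x \<otimes> y)"
    and adj_closed: "x \<in> carrier A \<Longrightarrow> adj A x \<in> carrier A"
    and adj_adj: "x \<in> carrier A \<Longrightarrow> adj A (adj A x) = x"
    and adj_add:
      "\<lbrakk>x \<in> carrier A; y \<in> carrier A\<rbrakk> \<Longrightarrow> adj A (x \<oplus> y) = adj A x \<oplus> adj A y"
    and adj_smult: "x \<in> carrier A \<Longrightarrow> adj A (c \<odot> x) = cnj c \<odot> adj A x"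
    and adj_mult:
      "\<lbrakk>x \<in> carrier A; y \<in> carrier A\<rbrakk> \<Longrightarrow> adj A (x \<otimes> y) = adj A y \<otimes> adj A x"
    and cnorm_nonneg: "x \<in> carrier A \<Longrightarrow> 0 \<le> cnorm A x"
    and cnorm_eq_0: "x \<in> carrier A \<Longrightarrow> cnorm A x = 0 \<longleftrightarrow> x = \<zero>"
    and cnorm_triangle:
      "\<lbrakk>x \<in> carrier A; y \<in> carrier A\<rbrakk> \<Longrightarrow> cnorm A (x \<oplus> y) \<le> cnorm A x + cnorm A y"
    and cnorm_smult: "x \<in> carrier A \<Longrightarrow> cnorm A (c \<odot> x) = cmod c * cnorm A x"
    and cnorm_mult:
      "\<lbrakk>x \<in> carrier A; y \<in> carrier A\<rbrakk> \<Longrightarrow> cnorm A (x \<otimes> y) \<le> cnorm A x * cnorm A y"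
    and cstar_identity: "x \<in> carrier A \<Longrightarrow> cnorm A (adj A x \<otimes> x) = (cnorm A x)\<^sup>2"
    and cnorm_complete:
      "\<lbrakk>\<And>n :: nat. s n \<in> carrier A;
        \<And>\<epsilon>. \<epsilon> > 0 \<Longrightarrow> \<exists>N. \<forall>m\<ge>N. \<forall>n\<ge>N. cnorm A (s m \<ominus> s n) < \<epsilon>\<rbrakk>
       \<Longrightarrow> \<exists>x\<in>carrier A. (\<lambda>n. cnorm A (s n \<ominus> x)) \<longlonglongrightarrow> 0"

text \<open>
  A C*-subalgebra containing the unit is given by its inclusion map.  As the subalgebra is complete
  and the inclusion isometric, the image is automatically closed.
\<close>

definition cstar_inclusion ::
    "'b cstar_algebra \<Rightarrow> 'a cstar_algebra \<Rightarrow> ('b \<Rightarrow> 'a) \<Rightarrow> bool" where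
  "cstar_inclusion B A j \<longleftrightarrow>
     j \<in> ring_hom B A \<and>
     (\<forall>c. \<forall>b\<in>carrier B. j (c \<odot>\<^bsub>B\<^esub> b) = c \<odot>\<^bsub>A\<^esub> j b) \<and>
     (\<forall>b\<in>carrier B. j (adj B b) = adj A (j b)) \<and>
     (\<forall>b\<in>carrier B. cnorm A (j b) = cnorm B b)"


section \<open>Positivity\<close>

text \<open>
  The positive elements of a C*-algebra.  For a matrix algebra over a C*-algebra, which has a
  unique C*-norm, the norm need not be mentioned.
\<close>

definition cstar_positive :: "('a, 'm) star_algebra_scheme \<Rightarrow> 'a set" where
  "cstar_positive R = {adj R x \<otimes>\<^bsub>R\<^esub> x | x. x \<in> carrier R}"

text \<open>The positive elements of a *-algebra: finite sums of hermitian squares.\<close>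

inductive_set star_positive :: "('a, 'm) star_algebra_scheme \<Rightarrow> 'a set"
  for R :: "('a, 'm) star_algebra_scheme" where
  square: "x \<in> carrier R \<Longrightarrow> adj R x \<otimes>\<^bsub>R\<^esub> x \<in> star_positive R"
| sum: "\<lbrakk>a \<in> star_positive R; b \<in> star_positive R\<rbrakk> \<Longrightarrow> a \<oplus>\<^bsub>R\<^esub> b \<in> star_positive R"

definition mat_indices :: "nat \<Rightarrow> (nat \<times> nat) set" where
  "mat_indices n = {..<n} \<times> {..<n}"

definition mat_algebra ::
    "nat \<Rightarrow> ('a, 'm) star_algebra_scheme \<Rightarrow> (nat \<times> nat \<Rightarrow> 'a) star_algebra" where
  "mat_algebra n R =
     \<lparr>carrier = mat_indices n \<rightarrow>\<^sub>E carrier R,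
      monoid.mult = (\<lambda>M N. \<lambda>(i, j)\<in>mat_indices n. \<Oplus>\<^bsub>R\<^esub>k\<in>{..<n}. M (i, k) \<otimes>\<^bsub>R\<^esub> N (k, j)),
      one = (\<lambda>(i, j)\<in>mat_indices n. if i = j then \<one>\<^bsub>R\<^esub> else \<zero>\<^bsub>R\<^esub>),
      zero = (\<lambda>p\<in>mat_indices n. \<zero>\<^bsub>R\<^esub>),
      add = (\<lambda>M N. \<lambda>p\<in>mat_indices n. M p \<oplus>\<^bsub>R\<^esub> N p),
      module.smult = (\<lambda>c M. \<lambda>p\<in>mat_indices n. c \<odot>\<^bsub>R\<^esub> M p),
      adj = (\<lambda>M. \<lambda>(i, j)\<in>mat_indices n. adj R (M (j, i)))\<rparr>"


section \<open>Linear, bimodule and completely positive maps\<close>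

definition linear_map ::
    "('a, 'm) star_algebra_scheme \<Rightarrow> ('d, 'n) star_algebra_scheme \<Rightarrow> ('a \<Rightarrow> 'd) \<Rightarrow> bool" where
  "linear_map R S f \<longleftrightarrow>
     f \<in> carrier R \<rightarrow> carrier S \<and>
     (\<forall>x\<in>carrier R. \<forall>y\<in>carrier R. f (x \<oplus>\<^bsub>R\<^esub> y) = f x \<oplus>\<^bsub>S\<^esub> f y) \<and>
     (\<forall>c. \<forall>x\<in>carrier R. f (c \<odot>\<^bsub>R\<^esub> x) = c \<odot>\<^bsub>S\<^esub> f x)"

text \<open>
  The left and right actions of \<open>B\<close> on \<open>R\<close> and on \<open>S\<close> are given explicitly, since the free product
  below is a \<open>B\<close>-bimodule without containing a distinguished copy of \<open>B\<close>.
\<close>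

definition bimodule_map ::
    "('b, 'k) star_algebra_scheme
      \<Rightarrow> ('a, 'm) star_algebra_scheme \<Rightarrow> ('b \<Rightarrow> 'a \<Rightarrow> 'a) \<Rightarrow> ('a \<Rightarrow> 'b \<Rightarrow> 'a)
      \<Rightarrow> ('d, 'n) star_algebra_scheme \<Rightarrow> ('b \<Rightarrow> 'd \<Rightarrow> 'd) \<Rightarrow> ('d \<Rightarrow> 'b \<Rightarrow> 'd)
      \<Rightarrow> ('a \<Rightarrow> 'd) \<Rightarrow> bool" where
  "bimodule_map B R lR rR S lS rS f \<longleftrightarrow>
     linear_map R S f \<and>
     (\<forall>b\<in>carrier B. \<forall>x\<in>carrier R. f (lR b x) = lS b (f x)) \<and>
     (\<forall>b\<in>carrier B. \<forall>x\<in>carrier R. f (rR x b) = rS (f x) b)"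

definition left_via ::
    "('a, 'm) star_algebra_scheme \<Rightarrow> ('b \<Rightarrow> 'a) \<Rightarrow> 'b \<Rightarrow> 'a \<Rightarrow> 'a" where
  "left_via R j b x = j b \<otimes>\<^bsub>R\<^esub> x"

definition right_via ::
    "('a, 'm) star_algebra_scheme \<Rightarrow> ('b \<Rightarrow> 'a) \<Rightarrow> 'a \<Rightarrow> 'b \<Rightarrow> 'a" where
  "right_via R j x b = x \<otimes>\<^bsub>R\<^esub> j b"

definition positive_conditional_expectation ::
    "'a cstar_algebra \<Rightarrow> 'b cstar_algebra \<Rightarrow> ('b \<Rightarrow> 'a) \<Rightarrow> ('a \<Rightarrow> 'b) \<Rightarrow> bool" where
  "positive_conditional_expectation A B j \<psi> \<longleftrightarrow>
     bimodule_map B A (left_via A j) (right_via A j) B (left_via B id) (right_via B id) \<psi> \<and>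
     (\<forall>b\<in>carrier B. \<psi> (j b) = b) \<and>
     (\<forall>a\<in>cstar_positive A. \<psi> a \<in> cstar_positive B)"

definition completely_positive ::
    "('a, 'm) star_algebra_scheme \<Rightarrow> 'd cstar_algebra \<Rightarrow> ('a \<Rightarrow> 'd) \<Rightarrow> bool" where
  "completely_positive R D f \<longleftrightarrow>
     linear_map R D f \<and>
     (\<forall>n\<ge>1. \<forall>M\<in>star_positive (mat_algebra n R).
        (\<lambda>p\<in>mat_indices n. f (M p)) \<in> cstar_positive (mat_algebra n D))"


section \<open>The free product *-algebra\<close>

text \<open>
  The word \<open>[(i\<^sub>1, a\<^sub>1), \<dots>, (i\<^sub>n, a\<^sub>n)]\<close> with \<open>n \<ge> 1\<close>, letters \<open>a\<^sub>k\<close> in \<open>A i\<^sub>k\<close> and distinct consecutive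
  indices stands for the elementary tensor of its letters.  Over these words we first form the free
  complex vector space, which is a *-algebra under concatenation (neighbouring letters from the same
  algebra being multiplied).  The direct sum of the tensor products over \<open>B\<close> is its quotient by the
  relations of multilinearity and \<open>B\<close>-balancedness.
\<close>

definition reduced_words ::
    "'i set \<Rightarrow> ('i \<Rightarrow> 'a cstar_algebra) \<Rightarrow> ('i \<times> 'a) list set" where
  "reduced_words I A =
     {w. w \<noteq> [] \<and> (\<forall>(i, a)\<in>set w. i \<in> I \<and> a \<in> carrier (A i)) \<and> distinct_adj (map fst w)}"

definition word_mult ::
    "('i \<Rightarrow> 'a cstar_algebra) \<Rightarrow> ('i \<times> 'a) list \<Rightarrow> ('i \<times> 'a) list \<Rightarrow> ('i \<times> 'a) list" where
  "word_mult A u v =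
     (if fst (last u) = fst (hd v)
      then butlast u @ (fst (hd v), snd (last u) \<otimes>\<^bsub>A (fst (hd v))\<^esub> snd (hd v)) # tl v
      else u @ v)"

definition word_adj ::
    "('i \<Rightarrow> 'a cstar_algebra) \<Rightarrow> ('i \<times> 'a) list \<Rightarrow> ('i \<times> 'a) list" where
  "word_adj A w = rev (map (\<lambda>(i, a). (i, adj (A i) a)) w)"

definition word_left ::
    "('i \<Rightarrow> 'a cstar_algebra) \<Rightarrow> ('i \<Rightarrow> 'b \<Rightarrow> 'a) \<Rightarrow> 'b \<Rightarrow> ('i \<times> 'a) list \<Rightarrow> ('i \<times> 'a) list" where
  "word_left A \<iota> b w =
     (fst (hd w), \<iota> (fst (hd w)) b \<otimes>\<^bsub>A (fst (hd w))\<^esub> snd (hd w)) # tl w"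

definition word_right ::
    "('i \<Rightarrow> 'a cstar_algebra) \<Rightarrow> ('i \<Rightarrow> 'b \<Rightarrow> 'a) \<Rightarrow> ('i \<times> 'a) list \<Rightarrow> 'b \<Rightarrow> ('i \<times> 'a) list" where
  "word_right A \<iota> w b =
     butlast w @ [(fst (last w), snd (last w) \<otimes>\<^bsub>A (fst (last w))\<^esub> \<iota> (fst (last w)) b)]"

definition linear_extension :: "('w \<Rightarrow> 'w) \<Rightarrow> ('w \<Rightarrow>\<^sub>0 complex) \<Rightarrow> ('w \<Rightarrow>\<^sub>0 complex)" where
  "linear_extension g x =
     (\<Sum>w\<in>Poly_Mapping.keys x. Poly_Mapping.single (g w) (Poly_Mapping.lookup x w))"

definition word_algebra ::
    "'i set \<Rightarrow> ('i \<Rightarrow> 'a cstar_algebra) \<Rightarrow> (('i \<times> 'a) list \<Rightarrow>\<^sub>0 complex) star_algebra" where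
  "word_algebra I A =
     \<lparr>carrier = {x. Poly_Mapping.keys x \<subseteq> reduced_words I A},
      monoid.mult = (\<lambda>x y. \<Sum>u\<in>Poly_Mapping.keys x. \<Sum>v\<in>Poly_Mapping.keys y.
        Poly_Mapping.single (word_mult A u v)
          (Poly_Mapping.lookup x u * Poly_Mapping.lookup y v)),
      one = undefined,
      zero = 0,
      add = (+),
      module.smult = (\<lambda>c. Poly_Mapping.map ((*) c)),
      adj = (\<lambda>x. \<Sum>w\<in>Poly_Mapping.keys x.
        Poly_Mapping.single (word_adj A w) (cnj (Poly_Mapping.lookup x w)))\<rparr>"

text \<open>The complex linear span of the tensor product relations.\<close>

inductive_set tensor_relations ::
    "'i set \<Rightarrow> ('i \<Rightarrow> 'a cstar_algebra) \<Rightarrow> 'b cstar_algebra \<Rightarrow> ('i \<Rightarrow> 'b \<Rightarrow> 'a)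
      \<Rightarrow> (('i \<times> 'a) list \<Rightarrow>\<^sub>0 complex) set"
  for I :: "'i set" and A :: "'i \<Rightarrow> 'a cstar_algebra" and B :: "'b cstar_algebra"
    and \<iota> :: "'i \<Rightarrow> 'b \<Rightarrow> 'a" where
  zero: "0 \<in> tensor_relations I A B \<iota>"
| add: "\<lbrakk>x \<in> tensor_relations I A B \<iota>; y \<in> tensor_relations I A B \<iota>\<rbrakk>
    \<Longrightarrow> x + y \<in> tensor_relations I A B \<iota>"
| scale: "x \<in> tensor_relations I A B \<iota>
    \<Longrightarrow> Poly_Mapping.map ((*) c) x \<in> tensor_relations I A B \<iota>"
| additive: "\<lbrakk>u @ (i, a) # v \<in> reduced_words I A; a' \<in> carrier (A i)\<rbrakk>
    \<Longrightarrow> Poly_Mapping.single (u @ (i, a \<oplus>\<^bsub>A i\<^esub> a') # v) 1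
        - Poly_Mapping.single (u @ (i, a) # v) 1
        - Poly_Mapping.single (u @ (i, a') # v) 1 \<in> tensor_relations I A B \<iota>"
| homogeneous: "u @ (i, a) # v \<in> reduced_words I A
    \<Longrightarrow> Poly_Mapping.single (u @ (i, c \<odot>\<^bsub>A i\<^esub> a) # v) 1
        - Poly_Mapping.single (u @ (i, a) # v) c \<in> tensor_relations I A B \<iota>"
| balanced: "\<lbrakk>u @ (i, a) # (j, a') # v \<in> reduced_words I A; b \<in> carrier B\<rbrakk>
    \<Longrightarrow> Poly_Mapping.single (u @ (i, a \<otimes>\<^bsub>A i\<^esub> \<iota> i b) # (j, a') # v) 1
        - Poly_Mapping.single (u @ (i, a) # (j, \<iota> j b \<otimes>\<^bsub>A j\<^esub> a') # v) 1
        \<in> tensor_relations I A B \<iota>"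

definition quotient_class ::
    "'i set \<Rightarrow> ('i \<Rightarrow> 'a cstar_algebra) \<Rightarrow> 'b cstar_algebra \<Rightarrow> ('i \<Rightarrow> 'b \<Rightarrow> 'a)
      \<Rightarrow> (('i \<times> 'a) list \<Rightarrow>\<^sub>0 complex) \<Rightarrow> (('i \<times> 'a) list \<Rightarrow>\<^sub>0 complex) set" where
  "quotient_class I A B \<iota> x = tensor_relations I A B \<iota> +>\<^bsub>word_algebra I A\<^esub> x"

definition free_product ::
    "'i set \<Rightarrow> ('i \<Rightarrow> 'a cstar_algebra) \<Rightarrow> 'b cstar_algebra \<Rightarrow> ('i \<Rightarrow> 'b \<Rightarrow> 'a)
      \<Rightarrow> (('i \<times> 'a) list \<Rightarrow>\<^sub>0 complex) set star_algebra" where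
  "free_product I A B \<iota> =
     \<lparr>carrier = a_rcosets\<^bsub>word_algebra I A\<^esub> (tensor_relations I A B \<iota>),
      monoid.mult = rcoset_mult (word_algebra I A) (tensor_relations I A B \<iota>),
      one = undefined,
      zero = tensor_relations I A B \<iota>,
      add = set_add (word_algebra I A),
      module.smult = (\<lambda>c S. \<Union>x\<in>S. quotient_class I A B \<iota> (c \<odot>\<^bsub>word_algebra I A\<^esub> x)),
      adj = (\<lambda>S. \<Union>x\<in>S. quotient_class I A B \<iota> (adj (word_algebra I A) x))\<rparr>"

definition free_left ::
    "'i set \<Rightarrow> ('i \<Rightarrow> 'a cstar_algebra) \<Rightarrow> 'b cstar_algebra \<Rightarrow> ('i \<Rightarrow> 'b \<Rightarrow> 'a)
      \<Rightarrow> 'b \<Rightarrow> (('i \<times> 'a) list \<Rightarrow>\<^sub>0 complex) set \<Rightarrow> (('i \<times> 'a) list \<Rightarrow>\<^sub>0 complex) set" where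
  "free_left I A B \<iota> b S =
     (\<Union>x\<in>S. quotient_class I A B \<iota> (linear_extension (word_left A \<iota> b) x))"

definition free_right ::
    "'i set \<Rightarrow> ('i \<Rightarrow> 'a cstar_algebra) \<Rightarrow> 'b cstar_algebra \<Rightarrow> ('i \<Rightarrow> 'b \<Rightarrow> 'a)
      \<Rightarrow> (('i \<times> 'a) list \<Rightarrow>\<^sub>0 complex) set \<Rightarrow> 'b \<Rightarrow> (('i \<times> 'a) list \<Rightarrow>\<^sub>0 complex) set" where
  "free_right I A B \<iota> S b =
     (\<Union>x\<in>S. quotient_class I A B \<iota> (linear_extension (\<lambda>w. word_right A \<iota> w b) x))"

text \<open>The element \<open>a\<^sub>1 \<cdots> a\<^sub>n\<close> of the free product.\<close>

definition free_word ::
    "'i set \<Rightarrow> ('i \<Rightarrow> 'a cstar_algebra) \<Rightarrow> 'b cstar_algebra \<Rightarrow> ('i \<Rightarrow> 'b \<Rightarrow> 'a)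
      \<Rightarrow> ('i \<times> 'a) list \<Rightarrow> (('i \<times> 'a) list \<Rightarrow>\<^sub>0 complex) set" where
  "free_word I A B \<iota> w = quotient_class I A B \<iota> (Poly_Mapping.single w 1)"


section \<open>The monotone product\<close>

text \<open>
  \<open>\<iota> i\<close> and \<open>\<kappa>\<close> are the inclusions of \<open>B\<close> into \<open>A i\<close> and into \<open>D\<close>.  In the third rule, the word
  with the letter \<open>a\<^sub>k\<close> replaced by \<open>\<psi>(a\<^sub>k)\<close> is the product of \<open>a\<^sub>1 \<cdots> a\<^sub>k\<^sub>-\<^sub>1\<close> and
  \<open>\<psi>(a\<^sub>k) a\<^sub>k\<^sub>+\<^sub>1 \<cdots> a\<^sub>n\<close>, because the letters next to \<open>a\<^sub>k\<close> may come from the same algebra.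
\<close>

definition satisfies_monotone_rules ::
    "('i::linorder) set \<Rightarrow> ('i \<Rightarrow> 'a cstar_algebra) \<Rightarrow> 'b cstar_algebra \<Rightarrow> ('i \<Rightarrow> 'b \<Rightarrow> 'a)
      \<Rightarrow> 'd cstar_algebra \<Rightarrow> ('b \<Rightarrow> 'd) \<Rightarrow> ('i \<Rightarrow> 'a \<Rightarrow> 'b) \<Rightarrow> ('i \<Rightarrow> 'a \<Rightarrow> 'd)
      \<Rightarrow> ((('i \<times> 'a) list \<Rightarrow>\<^sub>0 complex) set \<Rightarrow> 'd) \<Rightarrow> bool" where
  "satisfies_monotone_rules I A B \<iota> D \<kappa> \<psi> \<theta> \<Theta> \<longleftrightarrow>
     (let W = free_word I A B \<iota>; RW = reduced_words I A in
     (\<forall>i\<in>I. \<forall>a\<in>carrier (A i). \<Theta> (W [(i, a)]) = \<theta> i a) \<and>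
     (\<forall>i a j a' w. (i, a) # (j, a') # w \<in> RW \<and> i > j \<longrightarrow>
        \<Theta> (W ((i, a) # (j, a') # w)) = \<theta> i a \<otimes>\<^bsub>D\<^esub> \<Theta> (W ((j, a') # w))) \<and>
     (\<forall>w j a' i a. w @ [(j, a'), (i, a)] \<in> RW \<and> i > j \<longrightarrow>
        \<Theta> (W (w @ [(j, a'), (i, a)])) = \<Theta> (W (w @ [(j, a')])) \<otimes>\<^bsub>D\<^esub> \<theta> i a) \<and>
     (\<forall>u i a k a' j a'' v.
        u @ [(i, a), (k, a'), (j, a'')] @ v \<in> RW \<and> i < k \<and> k > j \<longrightarrow>
        \<Theta> (W (u @ [(i, a), (k, a'), (j, a'')] @ v)) =
          \<Theta> (W (u @ [(i, a)]) \<otimes>\<^bsub>free_product I A B \<iota>\<^esub>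
             free_left I A B \<iota> (\<psi> k a') (W ((j, a'') # v)))
          \<oplus>\<^bsub>D\<^esub> \<Theta> (W (u @ [(i, a)])) \<otimes>\<^bsub>D\<^esub> (\<theta> k a' \<ominus>\<^bsub>D\<^esub> \<kappa> (\<psi> k a')) \<otimes>\<^bsub>D\<^esub> \<Theta> (W ((j, a'') # v))))"

text \<open>
  The unique linear map satisfying the rules; extensionality only fixes its values outside the
  carrier.
\<close>

definition monotone_product ::
    "('i::linorder) set \<Rightarrow> ('i \<Rightarrow> 'a cstar_algebra) \<Rightarrow> 'b cstar_algebra \<Rightarrow> ('i \<Rightarrow> 'b \<Rightarrow> 'a)
      \<Rightarrow> 'd cstar_algebra \<Rightarrow> ('b \<Rightarrow> 'd) \<Rightarrow> ('i \<Rightarrow> 'a \<Rightarrow> 'b) \<Rightarrow> ('i \<Rightarrow> 'a \<Rightarrow> 'd)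
      \<Rightarrow> (('i \<times> 'a) list \<Rightarrow>\<^sub>0 complex) set \<Rightarrow> 'd" where
  "monotone_product I A B \<iota> D \<kappa> \<psi> \<theta> =
     (THE \<Theta>. \<Theta> \<in> extensional (carrier (free_product I A B \<iota>)) \<and>
        linear_map (free_product I A B \<iota>) D \<Theta> \<and>
        satisfies_monotone_rules I A B \<iota> D \<kappa> \<psi> \<theta> \<Theta>)"

end

theory Submission
  imports Defs
begin

text \<open>
  All C*-algebras carried by subsets of one type are coordinates of a single \<open>\<ell>\<^sup>\<infinity>\<close>-product, so the
  C*-theory is developed for a type class.  Positive elements are squares of self-adjoint ones; they
  form a cone containing every \<open>x\<^sup>* x\<close>, and a matrix \<open>T\<close> with \<open>\<Sum> \<xi>\<^sub>i\<^sup>* T\<^sub>i\<^sub>j \<xi>\<^sub>j \<ge> 0\<close> for all \<open>\<xi>\<close>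
  factors as \<open>Y\<^sup>* Y\<close>.

  Complete positivity of \<open>\<theta>\<close> amounts to positivity of the kernel \<open>\<theta>(w\<^sup>* w')\<close> on words.  Applying
  rule (3) to peaks, every word is equivalent, within the right \<open>\<DD>\<close>-module of the kernel, to a
  combination of words with strictly decreasing indices.  On these one argues by induction on the
  largest index \<open>p\<close>.  For \<open>w = a x\<close> and \<open>w' = a' x'\<close> with \<open>a\<close>, \<open>a'\<close> of index \<open>p\<close>
  (or \<open>1\<close>, if \<open>p\<close> does not occur),
  \<open>\<theta>(w\<^sup>* w') = [\<theta>(x\<^sup>* \<psi>\<^sub>p(a\<^sup>* a') x') - \<theta>(x)\<^sup>* \<psi>\<^sub>p(a\<^sup>* a') \<theta>(x')] + \<theta>(x)\<^sup>* \<theta>\<^sub>p(a\<^sup>* a') \<theta>(x')\<close>.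
  The last term is positive because \<open>\<theta>\<^sub>p\<close> is completely positive.  Factoring \<open>[\<psi>\<^sub>p(a\<^sup>* a')]\<close> as
  \<open>Y\<^sup>* Y\<close>, the bracket is a Schur complement of the entry of the empty word in the kernel on words
  with indices below \<open>p\<close>.
\<close>

section \<open>C*-algebras as a type class\<close>

text \<open>Three obstacles shape the proof. The rules overlap, so it is not clear beforehand that
  some linear map on the quotient obeys them all. A recursion \<open>G\<close> fixes one order of
  evaluation, on all words including unreduced ones; each rule, the balancing over B and the merging
  of neighbouring letters are then proved for its value. On unreduced words multiplication is mere
  concatenation, and the empty word with value 1 serves as a formal unit. Next, \<psi> is only
  assumed positive, while a whole matrix has to be factored. The bimodule property turns \<Sum>
  \<xi>_m^* \<psi>(z_m^* z_k) \<xi>_k into \<psi>(g^* g) with g = \<Sum> z_m \<iota>(\<xi>_m), so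
  positivity suffices. Finally, roots are built without spectral theory and without a norm on
  matrices. They are limits of the iteration y := (x + y^2)/2, which is dominated termwise by the
  same iteration for the real number 1; for matrices the bounds are carried entrywise through
  nonnegative combinations of powers.\<close>

text \<open>Complex scalars are encoded by a central element \<open>im\<close> with \<open>im\<^sup>2 = -1\<close>.\<close>

class cstar = real_normed_algebra_1 + banach +
  fixes star :: "'a \<Rightarrow> 'a" and im :: 'a
  assumes star_star [simp]: "star (star x) = x"
    and star_add: "star (x + y) = star x + star y"
    and star_mult: "star (x * y) = star y * star x"
    and star_scaleR: "star (r *\<^sub>R x) = r *\<^sub>R star x"
    and im_im: "im * im = - 1"
    and im_comm: "im * x = x * im"
    and star_im: "star im = - im"
    and norm_star_mult: "norm (star x * x) = (norm x)\<^sup>2"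

context cstar
begin

lemma star_0 [simp]: "star 0 = 0"
  using star_add[of 0 0] by simp

lemma star_minus: "star (- x) = - star x"
  using star_add[of x "- x"] by (simp add: eq_neg_iff_add_eq_0 add.commute)

lemma star_diff: "star (x - y) = star x - star y"
  using star_add[of x "- y"] by (simp add: star_minus)

lemma star_1 [simp]: "star 1 = 1"
  using star_mult[of "star 1" 1] by simp

lemma star_sum: "star (sum f S) = (\<Sum>i\<in>S. star (f i))"
  by (induction S rule: infinite_finite_induct) (auto simp: star_add)

lemma im_im_left: "im * (im * x) = - x"
  by (metis im_im mult.assoc mult_minus1)

lemma im_left_commute: "x * (im * y) = im * (x * y)"
  by (metis im_comm mult.assoc)

end

lemma norm_star [simp]: "norm (star x) = norm (x :: 'a::cstar)"
proof -
  have *: "norm x \<le> norm (star x)" for x :: 'a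
  proof (cases "x = 0")
    case False
    have "norm x * norm x \<le> norm (star x) * norm x"
      using norm_star_mult[of x] norm_mult_ineq[of "star x" x] by (simp only: power2_eq_square)
    then show ?thesis using False by simp
  qed simp
  show ?thesis using *[of x] *[of "star x"] by simp
qed

lemma norm_selfadjoint_square: "star x = x \<Longrightarrow> norm (x * x :: 'a::cstar) = (norm x)\<^sup>2"
  using norm_star_mult[of x] by simp

lemma bounded_linear_star: "bounded_linear (star :: 'a::cstar \<Rightarrow> 'a)"
  by (rule bounded_linear_intro[where K = 1]) (auto simp: star_add star_scaleR)

lemmas tendsto_star = bounded_linear.tendsto[OF bounded_linear_star]

section \<open>Square roots by a monotone iteration\<close>

fun sqrt_iter :: "'a::real_algebra_1 \<Rightarrow> nat \<Rightarrow> 'a" where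
  "sqrt_iter x 0 = 0"
| "sqrt_iter x (Suc n) = (1/2) *\<^sub>R (x + sqrt_iter x n * sqrt_iter x n)"

lemma sqrt_iter_bounds: "0 \<le> sqrt_iter (1::real) n" "sqrt_iter (1::real) n \<le> 1"
proof (induction n)
  case (Suc n)
  { case 1 show ?case using Suc by simp }
  { case 2 have "sqrt_iter (1::real) n * sqrt_iter 1 n \<le> 1 * 1" using Suc by (intro mult_mono) auto
    then show ?case by simp }
qed auto

lemma sqrt_iter_mono: "sqrt_iter (1::real) n \<le> sqrt_iter 1 (Suc n)"
proof (induction n)
  case (Suc n)
  have "sqrt_iter (1::real) n * sqrt_iter 1 n \<le> sqrt_iter 1 (Suc n) * sqrt_iter 1 (Suc n)"
    using Suc sqrt_iter_bounds[of n] sqrt_iter_bounds[of "Suc n"] by (intro mult_mono) auto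
  then show ?case by simp
qed simp

text \<open>Holds without commutativity. Its coefficients are nonnegative, so for
  \<open>norm x \<le> 1\<close> each increment is bounded in norm by the corresponding increment of
  the real iteration for 1.\<close>

lemma sqrt_iter_Suc_diff:
  "sqrt_iter x (Suc (Suc n)) - sqrt_iter x (Suc n)
     = (1/2) *\<^sub>R ((sqrt_iter x (Suc n) - sqrt_iter x n) * sqrt_iter x (Suc n)
                + sqrt_iter x n * (sqrt_iter x (Suc n) - sqrt_iter x n))"
proof -
  define p q where "p = sqrt_iter x n" and "q = sqrt_iter x (Suc n)"
  have "(1/2) *\<^sub>R (x + q * q) - (1/2) *\<^sub>R (x + p * p) = (1/2) *\<^sub>R ((q - p) * q + p * (q - p))"
    unfolding scaleR_diff_right[symmetric] by (simp add: algebra_simps)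
  then show ?thesis using p_def q_def by simp
qed

lemma sqrt_iter_1_Cauchy: "Cauchy (sqrt_iter (1::real))"
  by (intro convergent_Cauchy Bseq_mono_convergent BseqI'[where K = 1])
     (use sqrt_iter_mono sqrt_iter_bounds in \<open>auto simp: abs_le_iff incseq_Suc_iff intro: order_trans[of _ 0] lift_Suc_mono_le\<close>)

lemma Cauchy_of_real_majorant:
  fixes f :: "nat \<Rightarrow> 'a::real_normed_vector" and g :: "nat \<Rightarrow> real"
  assumes "Cauchy g" and "\<And>n. norm (f (Suc n) - f n) \<le> C * (g (Suc n) - g n)" and "C \<ge> 0"
  shows "Cauchy f"
proof (rule metric_CauchyI)
  have le: "norm (f (n + k) - f n) \<le> C * (g (n + k) - g n)" for n k
  proof (induction k)
    case (Suc k)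
    have "norm (f (n + Suc k) - f n) \<le> norm (f (n + Suc k) - f (n + k)) + norm (f (n + k) - f n)"
      using norm_triangle_ineq[of "f (n + Suc k) - f (n + k)" "f (n + k) - f n"] by simp
    also have "\<dots> \<le> C * (g (n + Suc k) - g (n + k)) + C * (g (n + k) - g n)"
      using assms(2)[of "n + k"] Suc by simp
    finally show ?case by (simp add: algebra_simps)
  qed simp
  fix e :: real assume "e > 0"
  \<comment> \<open>The divisor is C + 1 because C may be 0.\<close>
  then have "e / (C + 1) > 0" using assms(3) by simp
  then obtain M where M: "\<And>m n. m \<ge> M \<Longrightarrow> n \<ge> M \<Longrightarrow> dist (g m) (g n) < e / (C + 1)"
    using assms(1) metric_CauchyD by blast
  have lt: "norm (f m - f n) < e" if "m \<ge> n" "n \<ge> M" for m n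
  proof -
    have "norm (f m - f n) \<le> C * (g m - g n)" using le[of n "m - n"] that by simp
    also have "\<dots> \<le> C * \<bar>g m - g n\<bar>" using assms(3) by (intro mult_left_mono) auto
    also have "\<dots> \<le> (C + 1) * \<bar>g m - g n\<bar>" by (intro mult_right_mono) auto
    also have "\<dots> < e" using M[of m n] that assms(3) by (simp add: dist_real_def field_simps)
    finally show ?thesis .
  qed
  show "\<exists>M. \<forall>m\<ge>M. \<forall>n\<ge>M. dist (f m) (f n) < e"
  proof (intro exI allI impI)
    fix m n assume "m \<ge> M" "n \<ge> M"
    then show "dist (f m) (f n) < e"
      using lt[of m n] lt[of n m] by (cases "m \<ge> n") (auto simp: dist_norm norm_minus_commute)
  qed
qed

text \<open>The equation y = (x + y^2)/2 says that (1 - y)^2 = 1 - x. The iterates and their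
  increments are dominated by those of the real number 1, which increase and stay below 1. As real
  polynomials in x, the iterates are self-adjoint if x is and commute with whatever commutes with x;
  both pass to the limit.\<close>

lemma sqrt_one_minus:
  fixes x :: "'a::cstar"
  assumes "norm x \<le> 1"
  obtains y where "norm y \<le> 1" "(1 - y) * (1 - y) = 1 - x" "star x = x \<Longrightarrow> star y = y"
    "\<And>z. z * x = x * z \<Longrightarrow> z * y = y * z"
proof -
  let ?f = "sqrt_iter x" and ?g = "sqrt_iter (1::real)"
  have n: "norm (?f n) \<le> ?g n" for n
  proof (induction n)
    case (Suc n)
    have "norm (?f (Suc n)) \<le> (1/2) * (norm x + norm (?f n * ?f n))"
      by (simp add: norm_triangle_ineq)
    also have "norm (?f n * ?f n) \<le> norm (?f n) * norm (?f n)" by (rule norm_mult_ineq)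
    also have "\<dots> \<le> ?g n * ?g n" using Suc sqrt_iter_bounds by (intro mult_mono) auto
    finally show ?case using assms by simp
  qed simp
  have d: "norm (?f (Suc n) - ?f n) \<le> ?g (Suc n) - ?g n" for n
  proof (induction n)
    case 0
    then show ?case using assms by simp
  next
    case (Suc n)
    have "norm ((?f (Suc n) - ?f n) * ?f (Suc n)) \<le> (?g (Suc n) - ?g n) * ?g (Suc n)"
      by (rule order_trans[OF norm_mult_ineq]) (intro mult_mono n Suc; use sqrt_iter_mono sqrt_iter_bounds in auto)
    moreover have "norm (?f n * (?f (Suc n) - ?f n)) \<le> ?g n * (?g (Suc n) - ?g n)"
      by (rule order_trans[OF norm_mult_ineq]) (intro mult_mono n Suc; use sqrt_iter_mono sqrt_iter_bounds in auto)
    ultimately show ?case unfolding sqrt_iter_Suc_diff norm_scaleR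
      by (simp del: sqrt_iter.simps) (meson add_mono norm_triangle_le)
  qed
  have "Cauchy ?f" by (rule Cauchy_of_real_majorant[OF sqrt_iter_1_Cauchy, where C = 1]) (use d in auto)
  then obtain y where y: "?f \<longlonglongrightarrow> y" using Cauchy_convergent convergent_def by blast
  have "norm y \<le> 1"
    by (rule LIMSEQ_le_const2[OF tendsto_norm[OF y]]) (use n sqrt_iter_bounds order_trans in blast)
  have "(\<lambda>n. ?f (Suc n)) \<longlonglongrightarrow> (1/2) *\<^sub>R (x + y * y)" by (auto intro!: tendsto_intros y)
  then have yy: "(1/2) *\<^sub>R (x + y * y) = y" using LIMSEQ_Suc[OF y] LIMSEQ_unique by blast
  have "2 *\<^sub>R y = x + y * y" by (subst yy[symmetric]) simp
  then have sq: "(1 - y) * (1 - y) = 1 - x" by (simp add: algebra_simps scaleR_2)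
  have st: "star y = y" if "star x = x"
  proof -
    have "star (?f n) = ?f n" for n by (induction n) (auto simp: that star_add star_mult star_scaleR)
    then show ?thesis using tendsto_star[OF y] y LIMSEQ_unique by auto
  qed
  have co: "z * y = y * z" if "z * x = x * z" for z
  proof -
    have "z * ?f n = ?f n * z" for n
    proof (induction n)
      case (Suc n)
      then have "z * (?f n * ?f n) = ?f n * ?f n * z" by (metis mult.assoc)
      then show ?case by (simp add: distrib_left distrib_right that)
    qed simp
    then show ?thesis using tendsto_mult_left[OF y, of z] tendsto_mult_right[OF y, of z] LIMSEQ_unique by auto
  qed
  show ?thesis by (rule that[OF \<open>norm y \<le> 1\<close> sq st co])
qed

section \<open>Nonnegative elements\<close>

definition nonneg :: "'a::cstar \<Rightarrow> bool" where
  "nonneg h \<longleftrightarrow> (\<exists>k. star k = k \<and> h = k * k)"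

lemma nonneg_star: "nonneg h \<Longrightarrow> star h = h"
  unfolding nonneg_def by (auto simp: star_mult)

lemma nonneg_square: "star k = k \<Longrightarrow> nonneg (k * k)"
  unfolding nonneg_def by auto

lemma nonneg_0 [simp]: "nonneg 0" using nonneg_square[of 0] by simp
lemma nonneg_scaleR:
  assumes "nonneg h" "r \<ge> 0"
  shows "nonneg (r *\<^sub>R h)"
proof -
  obtain k where k: "star k = k" "h = k * k" using assms nonneg_def by blast
  have "r *\<^sub>R h = (sqrt r *\<^sub>R k) * (sqrt r *\<^sub>R k)" using assms(2) k by (simp add: real_sqrt_mult_self)
  then show ?thesis using k by (metis nonneg_square star_scaleR)
qed

text \<open>Apply the root of 1 - x to x = 1 - h/t, which has norm at most 1. The last conclusion is
  the hypothesis again, for k and sqrt t, so the root found is itself nonnegative.\<close>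

lemma nonneg_sqrt_of_norm_le:
  fixes h :: "'a::cstar"
  assumes "star h = h" "norm (t *\<^sub>R 1 - h) \<le> t"
  obtains k where "star k = k" "h = k * k" "\<And>z. z * h = h * z \<Longrightarrow> z * k = k * z"
    "norm (sqrt t *\<^sub>R 1 - k) \<le> sqrt t"
proof (cases "t = 0")
  case True
  then have "h = 0" using assms by simp
  then show ?thesis by (intro that[of 0]) (use True in simp_all)
next
  case False
  then have t: "t > 0" using assms(2) norm_ge_zero[of "t *\<^sub>R 1 - h"] by linarith
  define x where "x = 1 - (1/t) *\<^sub>R h"
  have "x = (1/t) *\<^sub>R (t *\<^sub>R 1 - h)" using t by (simp add: x_def scaleR_diff_right)
  then have "norm x = (1/t) * norm (t *\<^sub>R 1 - h)" using t by simp
  then have "norm x \<le> 1" using assms(2) t by (simp only: divide_le_eq_1_pos mult_1 times_divide_eq_left)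
  then obtain y where y: "norm y \<le> 1" "(1 - y) * (1 - y) = 1 - x" "star x = x \<Longrightarrow> star y = y"
    "\<And>z. z * x = x * z \<Longrightarrow> z * y = y * z" using sqrt_one_minus by metis
  have sx: "star x = x" using assms(1) by (simp add: x_def star_diff star_scaleR)
  show ?thesis
  proof (rule that[of "sqrt t *\<^sub>R (1 - y)"])
    show "star (sqrt t *\<^sub>R (1 - y)) = sqrt t *\<^sub>R (1 - y)" using y(3)[OF sx] by (simp add: star_scaleR star_diff)
    show "h = sqrt t *\<^sub>R (1 - y) * (sqrt t *\<^sub>R (1 - y))" using t y(2) by (simp add: x_def)
    show "norm (sqrt t *\<^sub>R 1 - sqrt t *\<^sub>R (1 - y)) \<le> sqrt t"
      using y(1) t by (simp add: scaleR_diff_right mult_left_le)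
    fix z assume "z * h = h * z"
    then have "z * x = x * z" by (simp add: x_def algebra_simps)
    then show "z * (sqrt t *\<^sub>R (1 - y)) = sqrt t *\<^sub>R (1 - y) * z" using y(4) by (simp add: algebra_simps)
  qed
qed

lemma nonnegI_norm: "star h = h \<Longrightarrow> norm (t *\<^sub>R 1 - h) \<le> t \<Longrightarrow> nonneg (h::'a::cstar)"
  unfolding nonneg_def by (metis nonneg_sqrt_of_norm_le)

lemma norm_im [simp]: "norm (im :: 'a::cstar) = 1"
proof -
  have "(norm (im :: 'a))\<^sup>2 = 1"
    using norm_star_mult[of "im :: 'a"] by (simp add: star_im im_im)
  then show ?thesis by (simp add: power2_eq_1_iff) (use norm_ge_zero[of "im :: 'a"] in linarith)
qed

text \<open>The element u = a + i b is normal with u^* u = t, so its norm is sqrt t by the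
  C*-identity, and b is its imaginary part. This replaces the spectral bound for commuting
  squares.\<close>

lemma norm_cartesian_le:
  fixes a b :: "'a::cstar"
  assumes "star a = a" "star b = b" "a * b = b * a" "a * a + b * b = t *\<^sub>R 1" "t \<ge> 0"
  shows "norm b \<le> sqrt t"
proof -
  define u where "u = a + im * b"
  have su: "star u = a - im * b" using assms by (simp add: u_def star_add star_mult star_im im_comm)
  have "star u * u = t *\<^sub>R 1"
    unfolding su unfolding u_def using assms(3,4)
    by (simp add: algebra_simps im_left_commute[of a b] im_left_commute[of b b] im_im_left)
  then have "(norm u)\<^sup>2 = t" using norm_star_mult[of u] assms(5) by simp
  then have n: "norm u = sqrt t" by (metis norm_ge_zero real_sqrt_unique)
  have "u - star u = 2 *\<^sub>R (im * b)" unfolding su by (simp add: u_def scaleR_2)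
  then have "im * (u - star u) = - (2 *\<^sub>R b)" by (simp add: im_im_left)
  then have "2 * norm b = norm (im * (u - star u))" by simp
  also have "\<dots> \<le> norm u + norm (star u)"
    using norm_mult_ineq[of im "u - star u"] norm_triangle_ineq4[of u "star u"] by simp
  finally show ?thesis using n by simp
qed

text \<open>Take the root c of 1 - a^2 that commutes with a; then a^2 + c^2 = 1, and the Cartesian
  estimate bounds c.\<close>

lemma norm_one_minus_square:
  fixes a :: "'a::cstar"
  assumes "star a = a" "norm a \<le> 1"
  shows "norm (1 - a * a) \<le> 1"
proof -
  have "norm (a * a) \<le> 1" using norm_mult_ineq[of a a] assms(2) mult_mono[OF assms(2) assms(2)] by simp
  then obtain y where y: "(1 - y) * (1 - y) = 1 - a * a" "star (a * a) = a * a \<Longrightarrow> star y = y"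
    "\<And>z. z * (a * a) = (a * a) * z \<Longrightarrow> z * y = y * z" using sqrt_one_minus by metis
  define c where "c = 1 - y"
  have c: "star c = c" using y(2) assms(1) by (simp add: c_def star_diff star_mult)
  have ac: "a * c = c * a" using y(3)[of a] by (simp add: c_def algebra_simps mult.assoc)
  have "a * a + c * c = 1 *\<^sub>R 1" using y(1) by (simp add: c_def)
  then have "norm c \<le> 1" using norm_cartesian_le[OF assms(1) c ac] by fastforce
  then have "norm c * norm c \<le> 1" by (simp add: mult_le_one)
  then show ?thesis using norm_mult_ineq[of c c] y(1) by (simp add: c_def)
qed

text \<open>Converse of \<open>nonnegI_norm\<close>, by scaling to norm at most 1. Membership in the
  cone thereby becomes a norm inequality, and such inequalities can be added by the triangle
  inequality.\<close>

lemma nonneg_norm_le: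
  fixes h :: "'a::cstar"
  assumes "nonneg h" "norm h \<le> t"
  shows "norm (t *\<^sub>R 1 - h) \<le> t"
proof (cases "t = 0")
  case False
  then have t: "t > 0" using assms(2) norm_ge_zero[of h] by linarith
  obtain k where k: "star k = k" "h = k * k" using assms nonneg_def by blast
  define a where "a = (1 / sqrt t) *\<^sub>R k"
  have sa: "star a = a" by (simp add: a_def star_scaleR k)
  have aa: "t *\<^sub>R (a * a) = h" using t by (simp add: a_def k)
  then have "t * (norm a)\<^sup>2 = norm h" using norm_selfadjoint_square[OF sa] t by (metis abs_of_pos norm_scaleR)
  then have "t * (norm a)\<^sup>2 \<le> t * 1" using assms by simp
  then have "(norm a)\<^sup>2 \<le> 1\<^sup>2" using t by (simp only: mult_le_cancel_left_pos power_one)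
  then have "norm a \<le> 1" by (rule power2_le_imp_le) simp
  then have "norm (1 - a * a) \<le> 1" using norm_one_minus_square sa by blast
  then have "t * norm (1 - a * a) \<le> t" using t by (simp add: mult_left_le)
  moreover have "t *\<^sub>R 1 - h = t *\<^sub>R (1 - a * a)" using aa by (simp add: scaleR_diff_right)
  ultimately show ?thesis using t by simp
qed (use assms in simp)

lemma nonneg_add: "nonneg g \<Longrightarrow> nonneg h \<Longrightarrow> nonneg (g + h)"
proof (rule nonnegI_norm[where t = "norm g + norm h"])
  assume *: "nonneg g" "nonneg h"
  then show "star (g + h) = g + h" by (simp add: star_add nonneg_star)
  have "norm ((norm g *\<^sub>R 1 - g) + (norm h *\<^sub>R 1 - h)) \<le> norm g + norm h"
    by (rule norm_triangle_le) (intro add_mono nonneg_norm_le * order_refl)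
  then show "norm ((norm g + norm h) *\<^sub>R 1 - (g + h)) \<le> norm g + norm h"
    by (simp add: algebra_simps)
qed

lemma nonneg_sum: "(\<And>i. i \<in> S \<Longrightarrow> nonneg (f i)) \<Longrightarrow> nonneg (sum f S)"
  by (induction S rule: infinite_finite_induct) (auto intro: nonneg_add)

lemma nonneg_sqrt:
  assumes "nonneg h"
  obtains k where "nonneg k" "h = k * k" "\<And>z. z * h = h * z \<Longrightarrow> z * k = k * z"
proof -
  obtain k where "star k = k" "h = k * k" "\<And>z. z * h = h * z \<Longrightarrow> z * k = k * z"
    "norm (sqrt (norm h) *\<^sub>R 1 - k) \<le> sqrt (norm h)"
    using nonneg_sqrt_of_norm_le[OF nonneg_star[OF assms] nonneg_norm_le[OF assms order_refl]] by metis
  then show ?thesis using that nonnegI_norm by blast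
qed

lemma nonneg_mult_commuting:
  assumes "nonneg a" "nonneg b" "a * b = b * a"
  shows "nonneg (a * b)"
proof -
  obtain k where k: "nonneg k" "a = k * k" "\<And>z. z * a = a * z \<Longrightarrow> z * k = k * z" using assms(1) nonneg_sqrt by blast
  obtain l where l: "nonneg l" "b = l * l" "\<And>z. z * b = b * z \<Longrightarrow> z * l = l * z" using assms(2) nonneg_sqrt by blast
  have kl: "k * l = l * k" using k(3)[of b] l(3)[of k] assms(3) by metis
  then have "star (k * l) = k * l" by (simp add: star_mult nonneg_star k(1) l(1))
  moreover have "a * b = (k * l) * (k * l)" using kl k(2) l(2) by (metis mult.assoc)
  ultimately show ?thesis using nonneg_square by metis
qed

section \<open>Order bounds versus norm bounds, and positivity of hermitian squares\<close>

lemma nonneg_norm_minus: "star h = h \<Longrightarrow> norm h \<le> t \<Longrightarrow> nonneg (t *\<^sub>R 1 - h)"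
  by (rule nonnegI_norm[where t = t]) (simp_all add: star_diff star_scaleR)

text \<open>The roots of a and t - a commute and their squares add up to t, so the Cartesian
  estimate applies to the root of a.\<close>

lemma norm_le_of_nn:
  fixes a :: "'a::cstar"
  assumes "nonneg a" "nonneg (t *\<^sub>R 1 - a)" "t \<ge> 0"
  shows "norm a \<le> t"
proof -
  obtain k where k: "nonneg k" "a = k * k" "\<And>z. z * a = a * z \<Longrightarrow> z * k = k * z" using assms(1) nonneg_sqrt by blast
  obtain l where l: "nonneg l" "t *\<^sub>R 1 - a = l * l" "\<And>z. z * (t *\<^sub>R 1 - a) = (t *\<^sub>R 1 - a) * z \<Longrightarrow> z * l = l * z"
    using assms(2) nonneg_sqrt by blast
  have "l * k = k * l" using l(3)[of a] k(3)[of l] by (simp add: algebra_simps)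
  moreover have "l * l + k * k = t *\<^sub>R 1" using k(2) l(2) by (metis diff_add_cancel)
  ultimately have "norm k \<le> sqrt t" using norm_cartesian_le[of l k t] nonneg_star k(1) l(1) assms(3) by blast
  then have "norm k * norm k \<le> sqrt t * sqrt t" by (intro mult_mono) (use assms(3) in auto)
  then show ?thesis using k(2) norm_mult_ineq[of k k] assms(3) by simp
qed

lemma norm_mono_nn:
  fixes a b :: "'a::cstar"
  assumes "nonneg a" "nonneg (b - a)" "norm b \<le> t"
  shows "norm a \<le> t"
proof (rule norm_le_of_nn[OF assms(1)])
  show "t \<ge> 0" using assms(3) norm_ge_zero order_trans by blast
  have "nonneg b" using nonneg_add[OF assms(2,1)] by simp
  then have "nonneg (t *\<^sub>R 1 - b)" using nonneg_norm_minus[OF nonneg_star assms(3)] by simp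
  from nonneg_add[OF this assms(2)] show "nonneg (t *\<^sub>R 1 - a)" by simp
qed

text \<open>Norms take the place of comparing the spectra of y^* y and y y^*. The Cartesian
  decomposition y = a + i b shows that g = y y^* = 2(a^2 + b^2) + p is nonnegative, of norm m =
  \<open>norm p\<close>. Estimating y (m + p) in two ways then gives 2 m^3 \<le> m^3.\<close>

lemma star_mult_eq_minus_nn:
  fixes y p :: "'a::cstar"
  assumes "star y * y = - p" "nonneg p"
  shows "p = 0"
proof -
  define a where "a = (1/2) *\<^sub>R (y + star y)"
  define b where "b = (1/2) *\<^sub>R (im * (star y - y))"
  define g where "g = y * star y"
  have sa: "star a = a" by (simp add: a_def star_add star_scaleR add.commute)
  have sb: "star b = b" by (simp add: b_def star_diff star_scaleR star_mult star_im algebra_simps im_comm)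
  have "4 *\<^sub>R (a * a) = (y + star y) * (y + star y)" by (simp add: a_def)
  moreover have "4 *\<^sub>R (b * b) = - ((star y - y) * (star y - y))"
    by (simp add: b_def mult.assoc im_left_commute[of "star y - y" "star y - y"] im_im_left)
  ultimately have "4 *\<^sub>R (a * a + b * b) = 2 *\<^sub>R (g + star y * y)"
    by (simp add: g_def algebra_simps scaleR_2)
  then have "2 *\<^sub>R (2 *\<^sub>R (a * a + b * b)) = 2 *\<^sub>R (g - p)" by (simp add: assms(1))
  then have "2 *\<^sub>R (a * a + b * b) = g - p" by (metis scaleR_cancel_left zero_neq_numeral)
  then have g: "g = 2 *\<^sub>R (a * a + b * b) + p" by simp
  have "nonneg g" unfolding g by (intro nonneg_add nonneg_scaleR nonneg_square sa sb assms(2)) simp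
  define m where "m = norm p"
  have m: "m = (norm y)\<^sup>2" using norm_star_mult[of y] assms(1) by (simp add: m_def)
  have mg: "norm g = m" using norm_star_mult[of "star y"] m by (simp add: g_def)
  let ?q = "m *\<^sub>R 1 + p"
  \<comment> \<open>From g y = - y p. Since g is nonnegative of norm m, the factor m - g has norm at
    most m, which bounds y (m + p) by m times the norm of y.\<close>
  have gy: "(m *\<^sub>R 1 - g) * y = y * ?q"
    using arg_cong[OF assms(1), of "\<lambda>z. y * z"] by (simp add: g_def algebra_simps)
  have "norm (m *\<^sub>R 1 - g) \<le> m" by (rule nonneg_norm_le) (use \<open>nonneg g\<close> mg in auto)
  then have "norm (y * ?q) \<le> m * norm y"
    unfolding gy[symmetric] by (rule order_trans[OF norm_mult_ineq mult_right_mono]) simp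
  then have "(norm (y * ?q))\<^sup>2 \<le> (m * norm y)\<^sup>2" by (rule power_mono) simp
  also have "\<dots> = m * m * m" by (simp add: m power2_eq_square)
  also have "(norm (y * ?q))\<^sup>2 = norm (?q * p * ?q)"
  proof -
    have "star ?q = ?q" by (simp add: star_add star_scaleR nonneg_star[OF assms(2)])
    then have "star (y * ?q) * (y * ?q) = ?q * (star y * y) * ?q" by (simp only: star_mult mult.assoc)
    then have "star (y * ?q) * (y * ?q) = - (?q * p * ?q)" using assms(1) by simp
    then show ?thesis using norm_star_mult[of "y * ?q"] by simp
  qed
  also have e: "?q * p * ?q = (m * m) *\<^sub>R p + (2 * m) *\<^sub>R (p * p) + p * (p * p)"
    unfolding mult_2 scaleR_left_distrib by (simp add: algebra_simps)
  finally have le: "norm ((m * m) *\<^sub>R p + (2 * m) *\<^sub>R (p * p) + p * (p * p)) \<le> m * m * m" .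
  have m0: "m \<ge> 0" by (simp add: m_def)
  have pp: "nonneg (p * p)" "nonneg (p * (p * p))"
    using assms(2) by (auto intro!: nonneg_mult_commuting simp: mult.assoc)
  \<comment> \<open>All three summands are nonnegative, so the middle one, of norm 2 m^3, is bounded
    by the norm of the sum.\<close>
  have "norm ((2 * m) *\<^sub>R (p * p)) \<le> m * m * m"
  proof (rule norm_mono_nn[OF _ _ le])
    show "nonneg ((2 * m) *\<^sub>R (p * p))" using pp m0 by (intro nonneg_scaleR) auto
    have "nonneg ((m * m) *\<^sub>R p + p * (p * p))" using pp m0 assms(2) by (intro nonneg_add nonneg_scaleR) auto
    then show "nonneg ((m * m) *\<^sub>R p + (2 * m) *\<^sub>R (p * p) + p * (p * p) - (2 * m) *\<^sub>R (p * p))"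
      by (simp add: algebra_simps)
  qed
  then have "2 * m * (m * m) \<le> m * m * m"
    using norm_selfadjoint_square[OF nonneg_star[OF assms(2)]] m0 by (simp add: m_def power2_eq_square)
  then have "m * m * m \<le> 0" by (simp add: mult.assoc)
  then have "m = 0" using m0 by (smt (verit) mult_pos_pos)
  then show ?thesis by (simp add: m_def)
qed

text \<open>Let r be the root of h^2, the absolute value of h, and s = r - h, twice the negative
  part. Then x s has the hermitian square - r s^2, which the preceding lemma forces to vanish; hence
  s^4 = 0 and h = r.\<close>

theorem nonneg_star_mult: "nonneg (star x * (x :: 'a::cstar))"
proof -
  define h where "h = star x * x"
  have sh: "star h = h" by (simp add: h_def star_mult)
  obtain r where r: "nonneg r" "h * h = r * r" "\<And>z. z * (h * h) = (h * h) * z \<Longrightarrow> z * r = r * z"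
    using nonneg_sqrt[OF nonneg_square[OF sh]] by blast
  have hr: "h * r = r * h" using r(3)[of h] by (simp add: mult.assoc)
  define s where "s = r - h"
  have ss: "star s = s" using nonneg_star[OF r(1)] sh by (simp add: s_def star_diff)
  have sr: "s * r = r * s" by (simp add: s_def algebra_simps hr)
  have hs: "h * s = - (r * s)" by (simp add: s_def algebra_simps hr r(2))
  have s2: "s * s = 2 *\<^sub>R (r * s)" by (simp add: s_def algebra_simps hr r(2) scaleR_2)
  have "star (x * s) * (x * s) = s * (h * s)" by (simp add: h_def star_mult ss mult.assoc)
  also have "\<dots> = - (r * (s * s))" unfolding hs by (simp add: sr flip: mult.assoc)
  finally have "star (x * s) * (x * s) = - (r * (s * s))" .
  moreover have "nonneg (r * (s * s))"
    by (rule nonneg_mult_commuting[OF r(1) nonneg_square[OF ss]]) (metis mult.assoc sr)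
  ultimately have "r * (s * s) = 0" by (rule star_mult_eq_minus_nn)
  then have "r * (s * (s * s)) = 0"
    by (metis mult.assoc mult_zero_left)
  then have "(s * s) * (s * s) = 0"
    using arg_cong[OF s2, of "\<lambda>z. z * (s * s)"] by (simp add: mult.assoc)
  then have "norm (s * s) = 0"
    using norm_selfadjoint_square[of "s * s"] by (simp add: star_mult ss)
  then have "s = 0" using norm_selfadjoint_square[OF ss] by simp
  then show ?thesis using r(1) by (simp add: s_def h_def)
qed

lemma nonneg_conj: "nonneg h \<Longrightarrow> nonneg (star x * h * x)"
proof -
  assume "nonneg h"
  then obtain k where "star k = k" "h = k * k" using nonneg_def by blast
  then have "star x * h * x = star (k * x) * (k * x)" by (simp add: star_mult mult.assoc)
  then show ?thesis by (simp add: nonneg_star_mult)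
qed

section \<open>Positive matrices over a C*-algebra\<close>

text \<open>Products and units vanish outside i, j < n, so that matrix identities are equalities of
  functions.\<close>

definition mat_mult :: "nat \<Rightarrow> (nat \<Rightarrow> nat \<Rightarrow> 'a) \<Rightarrow> (nat \<Rightarrow> nat \<Rightarrow> 'a) \<Rightarrow> nat \<Rightarrow> nat \<Rightarrow> 'a::cstar" where
  "mat_mult n M N = (\<lambda>i j. if i < n \<and> j < n then (\<Sum>k<n. M i k * N k j) else 0)"

definition mat_one :: "nat \<Rightarrow> nat \<Rightarrow> nat \<Rightarrow> 'a::cstar" where
  "mat_one n = (\<lambda>i j. if i < n \<and> i = j then 1 else 0)"

definition mat_herm :: "(nat \<Rightarrow> nat \<Rightarrow> 'a::cstar) \<Rightarrow> bool" where
  "mat_herm M \<longleftrightarrow> (\<forall>i j. star (M i j) = M j i)"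

definition mat_supp :: "nat \<Rightarrow> (nat \<Rightarrow> nat \<Rightarrow> 'a::cstar) \<Rightarrow> bool" where
  "mat_supp n M \<longleftrightarrow> (\<forall>i j. \<not> (i < n \<and> j < n) \<longrightarrow> M i j = 0)"

definition qform :: "nat \<Rightarrow> (nat \<Rightarrow> nat \<Rightarrow> 'a) \<Rightarrow> (nat \<Rightarrow> 'a) \<Rightarrow> 'a::cstar" where
  "qform n M \<xi> = (\<Sum>i<n. \<Sum>j<n. star (\<xi> i) * M i j * \<xi> j)"

text \<open>Positivity as seen by columns over the algebra. It requires no norm on matrices and is
  preserved by sums and by conjugation with hermitian matrices.\<close>

definition wpos :: "nat \<Rightarrow> (nat \<Rightarrow> nat \<Rightarrow> 'a::cstar) \<Rightarrow> bool" where
  "wpos n M \<longleftrightarrow> (\<forall>\<xi>. nonneg (qform n M \<xi>))"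

fun mat_pow :: "nat \<Rightarrow> (nat \<Rightarrow> nat \<Rightarrow> 'a::cstar) \<Rightarrow> nat \<Rightarrow> nat \<Rightarrow> nat \<Rightarrow> 'a" where
  "mat_pow n T 0 = mat_one n"
| "mat_pow n T (Suc k) = mat_mult n T (mat_pow n T k)"

lemma mat_mult_assoc: "mat_mult n (mat_mult n A B) C = mat_mult n A (mat_mult n B C)"
proof -
  have "(\<Sum>k<n. (\<Sum>l<n. A i l * B l k) * C k j) = (\<Sum>l<n. A i l * (\<Sum>k<n. B l k * C k j))" for i j
    unfolding sum_distrib_left sum_distrib_right mult.assoc by (rule sum.swap)
  then show ?thesis by (auto simp: mat_mult_def fun_eq_iff)
qed

lemma mat_mult_one_left: "mat_supp n A \<Longrightarrow> mat_mult n (mat_one n) A = A"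
  by (auto simp: mat_mult_def mat_one_def mat_supp_def fun_eq_iff if_distribR if_distrib[of "\<lambda>x. x * _"] cong: if_cong)

lemma mat_supp_pow [simp]: "mat_supp n (mat_pow n T k)"
  by (cases k) (auto simp: mat_supp_def mat_one_def mat_mult_def)

lemma mat_pow_add: "mat_mult n (mat_pow n T k) (mat_pow n T l) = mat_pow n T (k + l)"
  by (induction k) (simp_all add: mat_mult_one_left mat_mult_assoc)

lemma mat_herm_pow:
  assumes "mat_herm T" "mat_supp n T"
  shows "mat_herm (mat_pow n T k)"
proof (induction k)
  case 0
  show ?case by (auto simp: mat_herm_def mat_one_def)
next
  case (Suc k)
  have "mat_pow n T (Suc 0) = T" using assms(2)
    by (auto simp: mat_mult_def mat_one_def mat_supp_def fun_eq_iff if_distrib[of "\<lambda>x. _ * x"] cong: if_cong)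
  then have T: "mat_mult n (mat_pow n T k) T = mat_pow n T (Suc k)"
    using mat_pow_add[of n T k "Suc 0"] by simp
  have "star (mat_mult n T (mat_pow n T k) i j) = mat_mult n (mat_pow n T k) T j i" for i j
    using assms(1) Suc by (auto simp: mat_mult_def mat_herm_def star_sum star_mult)
  then show ?case unfolding T by (simp add: mat_herm_def)
qed

lemma qform_add: "qform n (\<lambda>i j. A i j + B i j) \<xi> = qform n A \<xi> + qform n B \<xi>"
  by (simp add: qform_def algebra_simps sum.distrib)

lemma qform_diff: "qform n (\<lambda>i j. A i j - B i j) \<xi> = qform n A \<xi> - qform n B \<xi>"
  by (simp add: qform_def algebra_simps sum_subtractf)

lemma qform_one: "qform n (mat_one n) \<xi> = (\<Sum>i<n. star (\<xi> i) * \<xi> i)"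
  unfolding qform_def mat_one_def
  by (rule sum.cong) (auto simp: if_distrib[of "\<lambda>x. _ * x"] if_distrib[of "\<lambda>x. x * _"] cong: if_cong)

lemma qform_conj:
  assumes S: "mat_herm S"
  shows "qform n (mat_mult n S (mat_mult n W S)) \<xi> = qform n W (\<lambda>i. \<Sum>j<n. S i j * \<xi> j)"
proof -
  \<comment> \<open>\<open>ap\<close> is the matrix acting on a column, \<open>ip\<close> the inner
    product with values in the algebra.\<close>
  define ap where "ap A \<eta> = (\<lambda>i. \<Sum>j<n. A i j * \<eta> j)" for A :: "nat \<Rightarrow> nat \<Rightarrow> 'a" and \<eta>
  define ip where "ip \<eta> \<zeta> = (\<Sum>i<n. star (\<eta> i) * \<zeta> i)" for \<eta> \<zeta> :: "nat \<Rightarrow> 'a"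
  have q: "qform n A \<eta> = ip \<eta> (ap A \<eta>)" for A \<eta>
    by (simp add: qform_def ip_def ap_def sum_distrib_left mult.assoc)
  have ap: "ap (mat_mult n A C) \<eta> i = ap A (ap C \<eta>) i" if "i < n" for A C \<eta> i
  proof -
    have "(\<Sum>j<n. (\<Sum>k<n. A i k * C k j) * \<eta> j) = (\<Sum>k<n. A i k * (\<Sum>j<n. C k j * \<eta> j))"
      unfolding sum_distrib_left sum_distrib_right mult.assoc by (rule sum.swap)
    then show ?thesis using that by (simp add: ap_def mat_mult_def)
  qed
  have ip: "ip \<eta> (ap S \<zeta>) = ip (ap S \<eta>) \<zeta>" for \<eta> \<zeta>
  proof -
    have "ip \<eta> (ap S \<zeta>) = (\<Sum>i<n. \<Sum>j<n. star (\<eta> i) * (S i j * \<zeta> j))"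
      by (simp add: ip_def ap_def sum_distrib_left)
    also have "\<dots> = (\<Sum>j<n. \<Sum>i<n. star (\<eta> i) * (S i j * \<zeta> j))" by (rule sum.swap)
    also have "\<dots> = ip (ap S \<eta>) \<zeta>"
      using S by (simp add: ip_def ap_def star_sum star_mult mat_herm_def sum_distrib_right mult.assoc)
    finally show ?thesis .
  qed
  have cong: "ip \<eta> \<zeta> = ip \<eta> \<zeta>'" if "\<And>i. i < n \<Longrightarrow> \<zeta> i = \<zeta>' i" for \<eta> \<zeta> \<zeta>'
    using that by (simp add: ip_def)
  have ap_cong: "ap A \<zeta> = ap A \<zeta>'" if "\<And>i. i < n \<Longrightarrow> \<zeta> i = \<zeta>' i" for A \<zeta> \<zeta>'
    using that by (simp add: ap_def)
  have "ip \<xi> (ap (mat_mult n S (mat_mult n W S)) \<xi>) = ip \<xi> (ap S (ap (mat_mult n W S) \<xi>))"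
    by (rule cong) (rule ap)
  also have "\<dots> = ip (ap S \<xi>) (ap (mat_mult n W S) \<xi>)" by (rule ip)
  also have "\<dots> = ip (ap S \<xi>) (ap W (ap S \<xi>))" by (rule cong) (rule ap)
  finally show ?thesis unfolding q by (simp add: ap_def)
qed

lemma wpos_one [simp]: "wpos n (mat_one n)"
  by (auto simp: wpos_def qform_one intro: nonneg_sum nonneg_star_mult)

lemma wpos_add: "wpos n A \<Longrightarrow> wpos n B \<Longrightarrow> wpos n (\<lambda>i j. A i j + B i j)"
  by (simp add: wpos_def qform_add nonneg_add)

lemma wpos_conj: "mat_herm S \<Longrightarrow> wpos n W \<Longrightarrow> wpos n (mat_mult n S (mat_mult n W S))"
  by (simp add: wpos_def qform_conj)

text \<open>A substitute for the norm of a matrix between 0 and 1. For i \<noteq> j and x = W_ij,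
  the form of W at the column with - x at i and 1 at j gives x^* W_ii x - 2 x^* x + W_jj \<ge> 0;
  with W_ii \<le> 1 and W_jj \<le> 1 this yields x^* x \<le> 1.\<close>

lemma wpos_entry_norm_le_one:
  fixes W :: "nat \<Rightarrow> nat \<Rightarrow> 'a::cstar"
  assumes W: "wpos n W" "mat_herm W" "wpos n (\<lambda>i j. mat_one n i j - W i j)" and ij: "i < n" "j < n"
  shows "norm (W i j) \<le> 1"
proof -
  \<comment> \<open>The form of A at a column supported at i and j; for i = j only the value a
    counts.\<close>
  have pt: "qform n A (\<lambda>k. if k = i then a else if k = j then b else 0)
     = star a * A i i * a + (if i = j then 0 else star a * A i j * b + star b * A j i * a + star b * A j j * b)"
    if "i < n" "j < n" for A :: "nat \<Rightarrow> nat \<Rightarrow> 'a" and i j a b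
  proof -
    have *: "(\<Sum>k<n. f k * (if k = i then a else if k = j then b else 0))
        = f i * a + (if i = j then 0 else f j * b)" for f :: "nat \<Rightarrow> 'a"
    proof -
      have "f k * (if k = i then a else if k = j then b else 0)
          = (if k = i then f i * a else 0) + (if k = j then (if i = j then 0 else f j * b) else 0)" for k
        by auto
      then show ?thesis using \<open>i < n\<close> \<open>j < n\<close> by (simp add: sum.distrib)
    qed
    have **: "(\<Sum>k<n. star (if k = i then a else if k = j then b else 0) * f k)
        = star a * f i + (if i = j then 0 else star b * f j)" for f :: "nat \<Rightarrow> 'a"
    proof -
      have "star (if k = i then a else if k = j then b else 0) * f k
          = (if k = i then star a * f i else 0) + (if k = j then (if i = j then 0 else star b * f j) else 0)" for k
        by auto
      then show ?thesis using \<open>i < n\<close> \<open>j < n\<close> by (simp add: sum.distrib)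
    qed
    show ?thesis unfolding qform_def mult.assoc sum_distrib_left[symmetric] * ** by (simp add: algebra_simps)
  qed
  have diag: "nonneg (W k k)" "nonneg (1 - W k k)" if "k < n" for k
  proof -
    have "nonneg (qform n W (\<lambda>l. if l = k then 1 else if l = k then 0 else 0))"
      using W(1) unfolding wpos_def by blast
    then show "nonneg (W k k)" unfolding pt[OF that that] by simp
    have "nonneg (qform n (\<lambda>i j. mat_one n i j - W i j) (\<lambda>l. if l = k then 1 else if l = k then 0 else 0))"
      using W(3) unfolding wpos_def by blast
    then show "nonneg (1 - W k k)" unfolding pt[OF that that] using that by (simp add: mat_one_def)
  qed
  show ?thesis
  proof (cases "i = j")
    case True
    then show ?thesis using norm_le_of_nn[of "W i i" 1] diag[OF ij(1)] by simp
  next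
    case False
    define x where "x = W i j"
    have 1: "nonneg (star x * W i i * x + (star (- x) * x + star x * (- x) + W j j))"
    proof -
      have "nonneg (qform n W (\<lambda>l. if l = i then - x else if l = j then 1 else 0))"
        using W(1) unfolding wpos_def by blast
      moreover have "W j i = star x" using W(2) by (simp add: x_def mat_herm_def)
      ultimately show ?thesis unfolding pt[OF ij] using False by (simp add: star_minus x_def algebra_simps)
    qed
    have 2: "nonneg (star x * (1 - W i i) * x)" by (rule nonneg_conj) (rule diag[OF ij(1)])
    have "nonneg (star x * W i i * x + (star (- x) * x + star x * (- x) + W j j) + star x * (1 - W i i) * x + (1 - W j j))"
      by (rule nonneg_add[OF nonneg_add[OF 1 2] diag(2)[OF ij(2)]])
    then have "nonneg (1 *\<^sub>R 1 - star x * x)" by (simp add: star_minus algebra_simps)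
    then have "norm (star x * x) \<le> 1" using norm_le_of_nn nonneg_star_mult by (metis zero_le_one)
    then have "(norm x)\<^sup>2 \<le> 1" by (simp add: norm_star_mult)
    then show ?thesis by (simp add: abs_square_le_1 x_def)
  qed
qed

text \<open>T^k is T^m T^m or T^m T T^m, hence a conjugate of 1 or of T. In the same way T^k -
  T^(k+1) is a conjugate of 1 - T or of T - T^2, and 1 - T^k is a telescoping sum of such
  differences.\<close>

lemma wpos_pow:
  assumes T: "mat_herm T" "mat_supp n T" "wpos n T" "wpos n (\<lambda>i j. mat_one n i j - T i j)"
  shows "wpos n (mat_pow n T k)" "wpos n (\<lambda>i j. mat_one n i j - mat_pow n T k i j)"
proof -
  have conj: "wpos n (mat_mult n (mat_pow n T m) (mat_mult n W (mat_pow n T m)))" if "wpos n W" for W m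
    using wpos_conj[OF mat_herm_pow[OF T(1,2)] that] .
  have T1': "mat_pow n T 1 = T" using T(2)
    by (auto simp: mat_mult_def mat_one_def mat_supp_def fun_eq_iff if_distrib[of "\<lambda>x. _ * x"] cong: if_cong)
  have diff_l: "mat_mult n (\<lambda>i j. A i j - C i j) W = (\<lambda>i j. mat_mult n A W i j - mat_mult n C W i j)" for A C W
    by (auto simp: mat_mult_def fun_eq_iff algebra_simps sum_subtractf)
  have diff_r: "mat_mult n W (\<lambda>i j. A i j - C i j) = (\<lambda>i j. mat_mult n W A i j - mat_mult n W C i j)" for A C W
    by (auto simp: mat_mult_def fun_eq_iff algebra_simps sum_subtractf)
  have one: "mat_mult n (mat_one n) (mat_pow n T m) = mat_pow n T m" for m
    by (simp add: mat_mult_one_left)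
  have one': "mat_mult n (mat_pow n T m) (mat_one n) = mat_pow n T m" for m
    using mat_pow_add[of n T m 0] by simp
  have TT: "mat_mult n T (mat_pow n T m) = mat_pow n T (Suc m)" for m by simp
  have p: "wpos n (mat_pow n T k)" for k
  proof -
    obtain m where "k = m + m \<or> k = m + (1 + m)" by (metis add.commute add_Suc_right evenE mult_2 oddE plus_1_eq_Suc)
    then show ?thesis
      using conj[OF wpos_one, of m] conj[OF T(3), of m] by (auto simp: one mat_pow_add TT simp del: mat_pow.simps)
  qed
  \<comment> \<open>T - T^2 = T (1 - T) T + (1 - T) T (1 - T).\<close>
  have one_minus: "wpos n (\<lambda>i j. mat_pow n T 1 i j - mat_pow n T 2 i j)"
  proof -
    have S: "mat_herm (\<lambda>i j. mat_one n i j - T i j)"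
      using T(1) by (auto simp: mat_herm_def mat_one_def star_diff)
    have a: "mat_mult n T T = mat_pow n T 2" "mat_mult n T (mat_one n) = T" "mat_mult n (mat_one n) T = T"
      "mat_mult n T (mat_mult n T T) = mat_pow n T 3" "mat_mult n T (mat_pow n T 2) = mat_pow n T 3"
      using one[of 1] one'[of 1] mat_pow_add[of n T 1 1] mat_pow_add[of n T 1 2]
      unfolding T1' by (simp_all del: mat_pow.simps add: numeral_3_eq_3 numeral_2_eq_2)
    have "wpos n (mat_mult n T (mat_mult n (\<lambda>i j. mat_one n i j - T i j) T))"
      by (rule wpos_conj[OF T(1,4)])
    moreover have "wpos n (mat_mult n (\<lambda>i j. mat_one n i j - T i j) (mat_mult n T (\<lambda>i j. mat_one n i j - T i j)))"
      by (rule wpos_conj[OF S T(3)])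
    ultimately have "wpos n (\<lambda>i j. (mat_mult n T (mat_mult n (\<lambda>i j. mat_one n i j - T i j) T)) i j
        + mat_mult n (\<lambda>i j. mat_one n i j - T i j) (mat_mult n T (\<lambda>i j. mat_one n i j - T i j)) i j)"
      by (rule wpos_add)
    moreover have "mat_mult n (mat_one n) (mat_pow n T 2) = mat_pow n T 2" by (rule one)
    ultimately show ?thesis by (simp add: diff_l diff_r a T1'[unfolded One_nat_def] del: mat_pow.simps)
  qed
  have d: "wpos n (\<lambda>i j. mat_pow n T k i j - mat_pow n T (Suc k) i j)" for k
  proof -
    obtain m where "k = m + m \<or> k = m + (1 + m)" by (metis add.commute add_Suc_right evenE mult_2 oddE plus_1_eq_Suc)
    then show ?thesis
    proof
      assume k: "k = m + m"
      have "mat_mult n (mat_pow n T m) (mat_mult n (\<lambda>i j. mat_one n i j - T i j) (mat_pow n T m))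
          = (\<lambda>i j. mat_pow n T k i j - mat_pow n T (Suc k) i j)"
        by (simp add: diff_l diff_r one TT mat_pow_add k del: mat_pow.simps)
      then show ?thesis using conj[OF T(4), of m] by simp
    next
      assume k: "k = m + (1 + m)"
      have "mat_mult n (mat_pow n T m) (mat_mult n (\<lambda>i j. mat_pow n T 1 i j - mat_pow n T 2 i j) (mat_pow n T m))
          = (\<lambda>i j. mat_pow n T k i j - mat_pow n T (Suc k) i j)"
        by (simp add: diff_l diff_r mat_pow_add k del: mat_pow.simps)
      then show ?thesis using conj[OF one_minus, of m] by simp
    qed
  qed
  have "wpos n (\<lambda>i j. mat_one n i j - mat_pow n T k i j)" for k
  proof (induction k)
    case 0
    show ?case by (simp add: wpos_def qform_def)
  next
    case (Suc k)
    from wpos_add[OF this d[of k]] show ?case by simp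
  qed
  then show "wpos n (mat_pow n T k)" "wpos n (\<lambda>i j. mat_one n i j - mat_pow n T k i j)" using p by auto
qed

text \<open>The weight a is the sum of the coefficients. Weights add and multiply along with the
  matrices, so the weight of an iterate is the same iterate for the number 1; for T between 0 and 1
  the weight bounds the norm of each entry.\<close>

inductive pow_cone :: "nat \<Rightarrow> (nat \<Rightarrow> nat \<Rightarrow> 'a::cstar) \<Rightarrow> real \<Rightarrow> (nat \<Rightarrow> nat \<Rightarrow> 'a) \<Rightarrow> bool" for n T where
  pow: "a \<ge> 0 \<Longrightarrow> pow_cone n T a (\<lambda>i j. a *\<^sub>R mat_pow n T k i j)"
| add: "pow_cone n T a W \<Longrightarrow> pow_cone n T b Y \<Longrightarrow> pow_cone n T (a + b) (\<lambda>i j. W i j + Y i j)"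

lemma pow_cone_scaleR: "pow_cone n T a W \<Longrightarrow> c \<ge> 0 \<Longrightarrow> pow_cone n T (c * a) (\<lambda>i j. c *\<^sub>R W i j)"
proof (induction rule: pow_cone.induct)
  case (pow a k)
  then show ?case using pow_cone.pow[of "c * a" n T k] by simp
next
  case (add a W b Y)
  then show ?case using pow_cone.add[OF add.IH(1)[OF add.prems] add.IH(2)[OF add.prems]] by (simp add: algebra_simps)
qed

lemma pow_cone_mult: "pow_cone n T a W \<Longrightarrow> pow_cone n T b Y \<Longrightarrow> pow_cone n T (a * b) (mat_mult n W Y)"
proof (induction rule: pow_cone.induct)
  case (pow a k)
  from pow(2) show ?case
  proof (induction rule: pow_cone.induct)
    case (pow b l)
    have "mat_mult n (\<lambda>i j. a *\<^sub>R mat_pow n T k i j) (\<lambda>i j. b *\<^sub>R mat_pow n T l i j)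
        = (\<lambda>i j. (a * b) *\<^sub>R mat_mult n (mat_pow n T k) (mat_pow n T l) i j)"
      by (auto simp: mat_mult_def fun_eq_iff scaleR_sum_right mult.commute)
    then show ?case using pow_cone.pow[of "a * b" n T "k + l"] pow \<open>a \<ge> 0\<close> by (simp add: mat_pow_add)
  next
    case (add b W c Y)
    have "mat_mult n (\<lambda>i j. a *\<^sub>R mat_pow n T k i j) (\<lambda>i j. W i j + Y i j) =
      (\<lambda>i j. mat_mult n (\<lambda>i j. a *\<^sub>R mat_pow n T k i j) W i j + mat_mult n (\<lambda>i j. a *\<^sub>R mat_pow n T k i j) Y i j)"
      by (auto simp: mat_mult_def fun_eq_iff sum.distrib algebra_simps)
    then show ?case using pow_cone.add[OF add.IH] by (simp add: algebra_simps)
  qed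
next
  case (add a W c Z)
  have "mat_mult n (\<lambda>i j. W i j + Z i j) Y = (\<lambda>i j. mat_mult n W Y i j + mat_mult n Z Y i j)"
    by (auto simp: mat_mult_def fun_eq_iff sum.distrib algebra_simps)
  then show ?case using pow_cone.add[OF add.IH(1)[OF add.prems] add.IH(2)[OF add.prems]]
    by (simp add: algebra_simps)
qed

lemma pow_cone_norm:
  assumes T: "mat_herm T" "mat_supp n T" "wpos n T" "wpos n (\<lambda>i j. mat_one n i j - T i j)"
    and ij: "i < n" "j < n" and W: "pow_cone n T a W"
  shows "norm (W i j) \<le> a"
  using W
proof (induction rule: pow_cone.induct)
  case (pow a k)
  have "norm (mat_pow n T k i j) \<le> 1"
    by (rule wpos_entry_norm_le_one[OF wpos_pow(1)[OF T] mat_herm_pow[OF T(1,2)] wpos_pow(2)[OF T] ij])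
  then show ?case using pow by (simp add: mult_left_le)
next
  case (add a W b Y)
  then show ?case by (intro norm_triangle_le) simp
qed

section \<open>Square roots and factorization of positive matrices\<close>

fun mat_sqrt_iter :: "nat \<Rightarrow> (nat \<Rightarrow> nat \<Rightarrow> 'a::cstar) \<Rightarrow> nat \<Rightarrow> nat \<Rightarrow> nat \<Rightarrow> 'a" where
  "mat_sqrt_iter n T 0 = (\<lambda>i j. 0)"
| "mat_sqrt_iter n T (Suc k) = (\<lambda>i j. (1/2) *\<^sub>R (T i j + mat_mult n (mat_sqrt_iter n T k) (mat_sqrt_iter n T k) i j))"

text \<open>The k-th iterate has the k-th real iterate as its weight, and increments have the real
  increments. So every entry is a Cauchy sequence, and limits are taken entrywise.\<close>

lemma mat_sqrt_one_minus:
  fixes T :: "nat \<Rightarrow> nat \<Rightarrow> 'a::cstar"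
  assumes T: "mat_herm T" "mat_supp n T" "wpos n T" "wpos n (\<lambda>i j. mat_one n i j - T i j)"
  obtains Z where "\<And>i j. i < n \<Longrightarrow> j < n \<Longrightarrow> star (Z i j) = Z j i"
    "\<And>i j. i < n \<Longrightarrow> j < n \<Longrightarrow> (\<Sum>k<n. Z i k * Z k j) = mat_one n i j - T i j"
proof -
  let ?f = "mat_sqrt_iter n T" and ?g = "sqrt_iter (1::real)"
  have T1: "mat_pow n T 1 = T" using T(2)
    by (auto simp: mat_mult_def mat_one_def mat_supp_def fun_eq_iff if_distrib[of "\<lambda>x. _ * x"] cong: if_cong)
  have cT: "pow_cone n T 1 T" using pow_cone.pow[of 1 n T 1] unfolding T1 by simp
  have f: "pow_cone n T (?g k) (?f k)" for k
  proof (induction k)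
    case 0
    show ?case using pow_cone.pow[of 0 n T 0] by simp
  next
    case (Suc k)
    show ?case using pow_cone_scaleR[OF pow_cone.add[OF cT pow_cone_mult[OF Suc Suc]], of "1/2"] by simp
  qed
  have df: "pow_cone n T (?g (Suc k) - ?g k) (\<lambda>i j. ?f (Suc k) i j - ?f k i j)" for k
  proof (induction k)
    case 0
    show ?case using pow_cone_scaleR[OF cT, of "1/2"] by (simp add: mat_mult_def cong: if_cong)
  next
    case (Suc k)
    let ?d = "\<lambda>i j. ?f (Suc k) i j - ?f k i j"
    have "?f (Suc (Suc k)) i j - ?f (Suc k) i j
        = (1/2) *\<^sub>R (mat_mult n (?f (Suc k)) (?f (Suc k)) i j - mat_mult n (?f k) (?f k) i j)" for i j
      unfolding mat_sqrt_iter.simps(2)[of n T "Suc k"] by (subst (3) mat_sqrt_iter.simps(2)) (simp add: scaleR_diff_right[symmetric] del: mat_sqrt_iter.simps)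
    also have "\<dots> i j = (1/2) *\<^sub>R (mat_mult n ?d (?f (Suc k)) i j + mat_mult n (?f k) ?d i j)" for i j
      by (simp add: mat_mult_def left_diff_distrib right_diff_distrib sum_subtractf del: mat_sqrt_iter.simps)
    finally have e: "(\<lambda>i j. ?f (Suc (Suc k)) i j - ?f (Suc k) i j)
        = (\<lambda>i j. (1/2) *\<^sub>R (mat_mult n ?d (?f (Suc k)) i j + mat_mult n (?f k) ?d i j))" by blast
    show ?case unfolding e sqrt_iter_Suc_diff real_scaleR_def
      by (intro pow_cone_scaleR pow_cone.add pow_cone_mult Suc f) simp
  qed
  have "\<exists>y. (\<lambda>k. ?f k i j) \<longlonglongrightarrow> y" if "i < n" "j < n" for i j
  proof -
    have "Cauchy (\<lambda>k. ?f k i j)"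
      by (rule Cauchy_of_real_majorant[OF sqrt_iter_1_Cauchy, where C = 1])
        (use pow_cone_norm[OF T that df] in \<open>simp_all del: mat_sqrt_iter.simps sqrt_iter.simps\<close>)
    then show ?thesis using Cauchy_convergent convergent_def by blast
  qed
  then obtain y where y: "\<And>i j. i < n \<Longrightarrow> j < n \<Longrightarrow> (\<lambda>k. ?f k i j) \<longlonglongrightarrow> y i j" by metis
  have fixp: "(1/2) *\<^sub>R (T i j + (\<Sum>k<n. y i k * y k j)) = y i j" if "i < n" "j < n" for i j
  proof -
    have "(\<lambda>k. ?f (Suc k) i j) \<longlonglongrightarrow> (1/2) *\<^sub>R (T i j + (\<Sum>k<n. y i k * y k j))"
      using that by (auto simp: mat_mult_def intro!: tendsto_intros y)
    then show ?thesis using LIMSEQ_Suc[OF y[OF that]] LIMSEQ_unique by blast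
  qed
  have sf: "star (?f k i j) = ?f k j i" for k i j
    by (induction k arbitrary: i j) (use T(1) in \<open>auto simp: star_scaleR star_add mat_herm_def mat_mult_def star_sum star_mult\<close>)
  have sy: "star (y i j) = y j i" if "i < n" "j < n" for i j
    using tendsto_star[OF y[OF that]] y[OF that(2,1)] LIMSEQ_unique by (auto simp: sf)
  define Z where "Z i j = mat_one n i j - y i j" for i j
  show ?thesis
  proof
    fix i j assume ij: "i < n" "j < n"
    show "star (Z i j) = Z j i" using sy[OF ij] ij by (auto simp: Z_def star_diff mat_one_def)
    have "2 *\<^sub>R y i j = T i j + (\<Sum>k<n. y i k * y k j)" by (subst fixp[OF ij, symmetric]) simp
    moreover have "(\<Sum>k<n. Z i k * Z k j) = mat_one n i j - 2 *\<^sub>R y i j + (\<Sum>k<n. y i k * y k j)"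
      using ij by (simp add: Z_def mat_one_def left_diff_distrib right_diff_distrib sum_subtractf sum.distrib
          if_distrib[of "\<lambda>x. x * _"] if_distrib[of "\<lambda>x. _ * x"] scaleR_2 cong: if_cong)
    ultimately show "(\<Sum>k<n. Z i k * Z k j) = mat_one n i j - T i j" by (simp add: algebra_simps)
  qed
qed

text \<open>For large K the matrix T = 1 - M/K lies between 0 and 1; a hermitian root Z of 1 - T =
  M/K gives Y = sqrt K Z.\<close>

theorem weakly_positive_factorization:
  fixes M :: "nat \<Rightarrow> nat \<Rightarrow> 'a::cstar"
  assumes herm: "\<And>i j. i < n \<Longrightarrow> j < n \<Longrightarrow> star (M i j) = M j i"
    and pos: "\<And>\<xi>. nonneg (\<Sum>i<n. \<Sum>j<n. star (\<xi> i) * M i j * \<xi> j)"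
  obtains Y where "\<And>i j. i < n \<Longrightarrow> j < n \<Longrightarrow> M i j = (\<Sum>k<n. star (Y k i) * Y k j)"
proof -
  \<comment> \<open>Summing the hermitian squares of \<xi>_i - M_ij \<xi>_j over i and j bounds
    twice the form by n plus the sum of the squared norms of the entries, times \<Sum> \<xi>_i^*
    \<xi>_i. The final 1 keeps K positive for n = 0.\<close>
  define K where "K = (\<Sum>i<n. \<Sum>j<n. (norm (M i j))\<^sup>2) + real n + 1"
  have K: "K > 0" by (auto simp: K_def intro!: add_nonneg_pos sum_nonneg add_nonneg_nonneg)
  have bound: "nonneg (K *\<^sub>R (\<Sum>i<n. star (\<xi> i) * \<xi> i) - (\<Sum>i<n. \<Sum>j<n. star (\<xi> i) * M i j * \<xi> j))" for \<xi>
  proof -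
    let ?Q = "\<Sum>i<n. \<Sum>j<n. star (\<xi> i) * M i j * \<xi> j"
    let ?s = "\<lambda>i. star (\<xi> i) * \<xi> i"
    let ?N = "\<lambda>i j. star (\<xi> j) * (star (M i j) * M i j) * \<xi> j"
    have q': "(\<Sum>i<n. \<Sum>j<n. star (\<xi> j) * star (M i j) * \<xi> i) = ?Q"
      by (subst sum.swap) (simp add: herm)
    have "nonneg (\<Sum>i<n. \<Sum>j<n. star (\<xi> i - M i j * \<xi> j) * (\<xi> i - M i j * \<xi> j))"
      by (intro nonneg_sum nonneg_star_mult)
    also have "(\<Sum>i<n. \<Sum>j<n. star (\<xi> i - M i j * \<xi> j) * (\<xi> i - M i j * \<xi> j))
       = (\<Sum>i<n. \<Sum>j<n. ?s i) + (\<Sum>i<n. \<Sum>j<n. ?N i j) - ?Q - ?Q"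
    proof -
      have "star (\<xi> i - M i j * \<xi> j) * (\<xi> i - M i j * \<xi> j)
        = ?s i + ?N i j - star (\<xi> i) * M i j * \<xi> j - star (\<xi> j) * star (M i j) * \<xi> i" for i j
        by (simp add: star_diff star_mult algebra_simps)
      then show ?thesis by (simp add: sum.distrib sum_subtractf q')
    qed
    finally have 1: "nonneg ((\<Sum>i<n. \<Sum>j<n. ?s i) + (\<Sum>i<n. \<Sum>j<n. ?N i j) - ?Q - ?Q)" .
    have "nonneg (\<Sum>i<n. \<Sum>j<n. star (\<xi> j) * ((norm (M i j))\<^sup>2 *\<^sub>R 1 - star (M i j) * M i j) * \<xi> j)"
      by (intro nonneg_sum nonneg_conj nonneg_norm_minus) (simp_all add: star_mult norm_star_mult)
    then have 2: "nonneg ((\<Sum>i<n. \<Sum>j<n. (norm (M i j))\<^sup>2 *\<^sub>R ?s j) - (\<Sum>i<n. \<Sum>j<n. ?N i j))"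
      by (simp add: algebra_simps sum_subtractf)
    \<comment> \<open>The terms with l \<noteq> j enlarge \<xi>_j^* \<xi>_j to the full sum over
      l.\<close>
    have 3: "nonneg (\<Sum>i<n. \<Sum>j<n. \<Sum>l<n. (if l = j then 0 else (norm (M i j))\<^sup>2) *\<^sub>R ?s l)"
      by (intro nonneg_sum nonneg_scaleR nonneg_star_mult) auto
    have "(\<Sum>l<n. (if l = j then 0 else (norm (M i j))\<^sup>2) *\<^sub>R ?s l)
        = (norm (M i j))\<^sup>2 *\<^sub>R (\<Sum>l<n. ?s l) - (norm (M i j))\<^sup>2 *\<^sub>R ?s j" if "j < n" for i j
    proof -
      have "(\<Sum>l<n. (if l = j then 0 else (norm (M i j))\<^sup>2) *\<^sub>R ?s l)
         = (\<Sum>l<n. (norm (M i j))\<^sup>2 *\<^sub>R ?s l - (if l = j then (norm (M i j))\<^sup>2 *\<^sub>R ?s j else 0))"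
        by (rule sum.cong) auto
      then show ?thesis using that by (simp add: sum_subtractf scaleR_sum_right)
    qed
    then have "(\<Sum>i<n. \<Sum>j<n. \<Sum>l<n. (if l = j then 0 else (norm (M i j))\<^sup>2) *\<^sub>R ?s l)
       = (\<Sum>i<n. \<Sum>j<n. (norm (M i j))\<^sup>2) *\<^sub>R (\<Sum>l<n. ?s l) - (\<Sum>i<n. \<Sum>j<n. (norm (M i j))\<^sup>2 *\<^sub>R ?s j)"
      by (simp add: sum_subtractf scaleR_sum_left)
    with 3 have 3: "nonneg ((\<Sum>i<n. \<Sum>j<n. (norm (M i j))\<^sup>2) *\<^sub>R (\<Sum>l<n. ?s l) - (\<Sum>i<n. \<Sum>j<n. (norm (M i j))\<^sup>2 *\<^sub>R ?s j))"
      by simp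
    have 4: "(\<Sum>i<n. \<Sum>j<n. ?s i) = real n *\<^sub>R (\<Sum>l<n. ?s l)"
    proof -
      have "(\<Sum>j<n. ?s i) = real n *\<^sub>R ?s i" for i
        using sum_constant_scaleR[of "?s i" "{..<n}"] by (simp only: card_lessThan)
      then show ?thesis by (simp only: scaleR_sum_right)
    qed
    have 5: "nonneg (\<Sum>l<n. ?s l)" by (intro nonneg_sum nonneg_star_mult)
    have "nonneg (((\<Sum>i<n. \<Sum>j<n. ?s i) + (\<Sum>i<n. \<Sum>j<n. ?N i j) - ?Q - ?Q)
      + ((\<Sum>i<n. \<Sum>j<n. (norm (M i j))\<^sup>2 *\<^sub>R ?s j) - (\<Sum>i<n. \<Sum>j<n. ?N i j))
      + ((\<Sum>i<n. \<Sum>j<n. (norm (M i j))\<^sup>2) *\<^sub>R (\<Sum>l<n. ?s l) - (\<Sum>i<n. \<Sum>j<n. (norm (M i j))\<^sup>2 *\<^sub>R ?s j))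
      + (\<Sum>l<n. ?s l) + ?Q)" by (intro nonneg_add 1 2 3 5 pos)
    then show ?thesis unfolding 4 by (simp add: K_def scaleR_left_distrib algebra_simps)
  qed
  define P where "P = (\<lambda>i j. if i < n \<and> j < n then (1/K) *\<^sub>R M i j else 0)"
  define T where "T = (\<lambda>i j. mat_one n i j - P i j)"
  have qP: "qform n P \<xi> = (1/K) *\<^sub>R (\<Sum>i<n. \<Sum>j<n. star (\<xi> i) * M i j * \<xi> j)" for \<xi>
    by (simp add: qform_def P_def scaleR_sum_right)
  have P: "wpos n P" using K by (simp add: wpos_def qP nonneg_scaleR pos)
  have "qform n T \<xi> = (1/K) *\<^sub>R (K *\<^sub>R (\<Sum>i<n. star (\<xi> i) * \<xi> i) - (\<Sum>i<n. \<Sum>j<n. star (\<xi> i) * M i j * \<xi> j))" for \<xi>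
    using K unfolding T_def qform_diff qP qform_one by (simp add: scaleR_diff_right)
  then have wT: "wpos n T" using K by (simp add: wpos_def nonneg_scaleR bound)
  have hT: "mat_herm T"
    by (auto simp: mat_herm_def T_def P_def mat_one_def star_diff star_scaleR herm)
  have sT: "mat_supp n T" by (auto simp: mat_supp_def T_def P_def mat_one_def)
  have "wpos n (\<lambda>i j. mat_one n i j - T i j)" using P by (simp add: T_def)
  then obtain Z where Z: "\<And>i j. i < n \<Longrightarrow> j < n \<Longrightarrow> star (Z i j) = Z j i"
    "\<And>i j. i < n \<Longrightarrow> j < n \<Longrightarrow> (\<Sum>k<n. Z i k * Z k j) = mat_one n i j - T i j"
    using mat_sqrt_one_minus[OF hT sT wT] by metis
  show ?thesis
  proof (rule that[of "\<lambda>i j. sqrt K *\<^sub>R Z i j"])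
    fix i j assume ij: "i < n" "j < n"
    have "(\<Sum>k<n. star (sqrt K *\<^sub>R Z k i) * (sqrt K *\<^sub>R Z k j)) = K *\<^sub>R (\<Sum>k<n. Z i k * Z k j)"
      using K Z(1)[OF _ ij(1)] by (simp add: star_scaleR scaleR_sum_right)
    also have "\<dots> = M i j" using ij K by (simp add: Z(2) T_def P_def)
    finally show "M i j = (\<Sum>k<n. star (sqrt K *\<^sub>R Z k i) * (sqrt K *\<^sub>R Z k j))" by simp
  qed
qed

section \<open>All C*-algebras on a type as coordinates of a single one\<close>

context cstar_algebra
begin

lemma scalar_closed [simp]: "x \<in> carrier A \<Longrightarrow> c \<odot> x \<in> carrier A"
  using smult_closed[of c x] by (simp add: ring_of_type_algebra_def)

lemma scalar_add_left: "x \<in> carrier A \<Longrightarrow> (c + d) \<odot> x = c \<odot> x \<oplus> d \<odot> x"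
  using smult_l_distr[of c d x] by (simp add: ring_of_type_algebra_def)

lemma scalar_add_right: "x \<in> carrier A \<Longrightarrow> y \<in> carrier A \<Longrightarrow> c \<odot> (x \<oplus> y) = c \<odot> x \<oplus> c \<odot> y"
  using smult_r_distr[of c x y] by (simp add: ring_of_type_algebra_def)

lemma scalar_scalar: "x \<in> carrier A \<Longrightarrow> c \<odot> (d \<odot> x) = (c * d) \<odot> x"
  using smult_assoc1[of c d x] by (simp add: ring_of_type_algebra_def)

lemma scalar_1 [simp]: "x \<in> carrier A \<Longrightarrow> 1 \<odot> x = x"
  using smult_one[of x] by (simp add: ring_of_type_algebra_def)

lemma scalar_0 [simp]: "x \<in> carrier A \<Longrightarrow> 0 \<odot> x = \<zero>"
  using smult_l_null[of x] by (simp add: ring_of_type_algebra_def)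

lemma scalar_minus_1: "x \<in> carrier A \<Longrightarrow> \<ominus> x = (- 1) \<odot> x"
proof -
  assume x: "x \<in> carrier A"
  have "(- 1) \<odot> x \<oplus> x = \<zero>" using scalar_add_left[of x "- 1" 1] x by simp
  then show ?thesis using x abelian_group.minus_equality[OF ring.is_abelian_group[OF cstar_algebra.axioms(1)[OF cstar_algebra_axioms]]] by simp
qed

lemma cnorm_0 [simp]: "cnorm A \<zero> = 0"
  using cnorm_eq_0 by simp

lemma cnorm_uminus: "x \<in> carrier A \<Longrightarrow> cnorm A (\<ominus> x) = cnorm A x"
  by (simp add: scalar_minus_1 cnorm_smult)

lemma adj_one [simp]: "adj A \<one> = \<one>"
  using adj_mult[of "adj A \<one>" \<one>] by (simp add: adj_closed adj_adj)

lemma adj_zero [simp]: "adj A \<zero> = \<zero>"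
  using adj_smult[of \<one> 0] by (simp add: adj_closed)

lemma cnorm_one_le: "cnorm A \<one> \<le> 1"
  using cstar_identity[of \<one>] by (auto simp: power2_eq_square)

lemma cnorm_adj: "x \<in> carrier A \<Longrightarrow> cnorm A (adj A x) = cnorm A x"
proof -
  have *: "cnorm A x \<le> cnorm A (adj A x)" if x: "x \<in> carrier A" for x
  proof (cases "cnorm A x = 0")
    case True
    then show ?thesis using cnorm_nonneg[OF adj_closed[OF x]] by simp
  next
    case False
    have "cnorm A x * cnorm A x \<le> cnorm A (adj A x) * cnorm A x"
      using cstar_identity[OF x] cnorm_mult[OF adj_closed[OF x] x] unfolding power2_eq_square by simp
    then show ?thesis using False cnorm_nonneg[OF x] by simp
  qed
  assume x: "x \<in> carrier A"
  show ?thesis using *[OF x] *[OF adj_closed[OF x]] adj_adj[OF x] by simp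
qed

end

text \<open>
  The bounded families form the \<open>\<ell>\<^sup>\<infinity>\<close>-product of all C*-algebras carried by subsets of \<open>'d\<close>, so that
  the type class theory applies to each of them.  The additional coordinate \<open>\<complex>\<close> provides a
  character, through which unital maps between single algebras extend to unital maps of products.
\<close>

typedef 'd univ = "{(f :: 'd cstar_algebra \<Rightarrow> 'd, c :: complex).
    (\<forall>A. cstar_algebra A \<longrightarrow> f A \<in> carrier A) \<and> (\<forall>A. \<not> cstar_algebra A \<longrightarrow> f A = undefined) \<and>
    (\<exists>K. \<forall>A. cstar_algebra A \<longrightarrow> cnorm A (f A) \<le> K)}"
proof
  show "(\<lambda>A. if cstar_algebra A then \<zero>\<^bsub>A\<^esub> else undefined, 0) \<in> {(f :: 'd cstar_algebra \<Rightarrow> 'd, c :: complex).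
    (\<forall>A. cstar_algebra A \<longrightarrow> f A \<in> carrier A) \<and> (\<forall>A. \<not> cstar_algebra A \<longrightarrow> f A = undefined) \<and>
    (\<exists>K. \<forall>A. cstar_algebra A \<longrightarrow> cnorm A (f A) \<le> K)}"
    by (auto intro!: exI[of _ 0] simp: cstar_algebra.cnorm_0 intro: abelian_monoid.zero_closed
        abelian_group.axioms ring.is_abelian_group cstar_algebra.axioms)
qed

definition coord :: "'d cstar_algebra \<Rightarrow> 'd univ \<Rightarrow> 'd" where
  "coord A u = fst (Rep_univ u) A"

definition char :: "'d univ \<Rightarrow> complex" where
  "char u = snd (Rep_univ u)"

definition family :: "('d cstar_algebra \<Rightarrow> 'd) \<Rightarrow> complex \<Rightarrow> 'd univ" where
  "family f c = Abs_univ (\<lambda>A. if cstar_algebra A then f A else undefined, c)"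

lemma coord_closed [simp]: "cstar_algebra A \<Longrightarrow> coord A u \<in> carrier A"
  using Rep_univ[of u] by (auto simp: coord_def)

lemma coord_bounded: obtains K where "\<And>A. cstar_algebra A \<Longrightarrow> cnorm A (coord A u) \<le> K"
proof -
  have "\<exists>K. \<forall>A. cstar_algebra A \<longrightarrow> cnorm A (coord A u) \<le> K"
    using Rep_univ[of u] by (auto simp: coord_def; blast)
  then show ?thesis using that by blast
qed

lemma univ_eqI: "char u = char v \<Longrightarrow> (\<And>A. cstar_algebra A \<Longrightarrow> coord A u = coord A v) \<Longrightarrow> u = v"
proof -
  assume *: "char u = char v" "\<And>A. cstar_algebra A \<Longrightarrow> coord A u = coord A v"
  have "fst (Rep_univ u) A = fst (Rep_univ v) A" for A
    using *(2)[of A] Rep_univ[of u] Rep_univ[of v] by (cases "cstar_algebra A") (auto simp: coord_def)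
  then show "u = v" using *(1) by (metis Rep_univ_inject char_def prod_eqI ext)
qed

lemma family:
  assumes "\<And>A. cstar_algebra A \<Longrightarrow> f A \<in> carrier A" "\<And>A. cstar_algebra A \<Longrightarrow> cnorm A (f A) \<le> K"
  shows "cstar_algebra A \<Longrightarrow> coord A (family f c) = f A" "char (family f c) = c"
proof -
  have "Rep_univ (family f c) = (\<lambda>A. if cstar_algebra A then f A else undefined, c)"
    unfolding family_def by (rule Abs_univ_inverse) (use assms in auto)
  then show "cstar_algebra A \<Longrightarrow> coord A (family f c) = f A" "char (family f c) = c"
    by (simp_all add: coord_def char_def)
qed

section \<open>The product of all C*-algebras on a type as an instance of the class\<close>

instantiation univ :: (type) "{zero, one, plus, minus, uminus, times, scaleR}"
begin

definition "0 = family (\<lambda>A. \<zero>\<^bsub>A\<^esub>) 0"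
definition "1 = family (\<lambda>A. \<one>\<^bsub>A\<^esub>) 1"
definition "u + v = family (\<lambda>A. coord A u \<oplus>\<^bsub>A\<^esub> coord A v) (char u + char v)"
definition "- u = family (\<lambda>A. \<ominus>\<^bsub>A\<^esub> coord A u) (- char u)"
definition "u - v = family (\<lambda>A. coord A u \<ominus>\<^bsub>A\<^esub> coord A v) (char u - char v)"
definition "u * v = family (\<lambda>A. coord A u \<otimes>\<^bsub>A\<^esub> coord A v) (char u * char v)"
definition "r *\<^sub>R u = family (\<lambda>A. complex_of_real r \<odot>\<^bsub>A\<^esub> coord A u) (of_real r * char u)"

instance ..

end

definition univ_star :: "'d univ \<Rightarrow> 'd univ" where
  "univ_star u = family (\<lambda>A. adj A (coord A u)) (cnj (char u))"

definition univ_im :: "'d univ" where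
  "univ_im = family (\<lambda>A. \<i> \<odot>\<^bsub>A\<^esub> \<one>\<^bsub>A\<^esub>) \<i>"

lemma coord_zero [simp]: "cstar_algebra A \<Longrightarrow> coord A (0 :: 'a univ) = \<zero>\<^bsub>A\<^esub>" and char_zero [simp]: "char (0 :: 'a univ) = 0"
proof -
  have "cstar_algebra A \<Longrightarrow> \<zero>\<^bsub>A\<^esub> \<in> carrier A \<and> cnorm A \<zero>\<^bsub>A\<^esub> \<le> 0" for A :: "'a cstar_algebra"
  proof -
    assume "cstar_algebra A" then interpret cstar_algebra A .
    show ?thesis by simp
  qed
  then show "cstar_algebra A \<Longrightarrow> coord A (0 :: 'a univ) = \<zero>\<^bsub>A\<^esub>" "char (0 :: 'a univ) = 0"
    unfolding zero_univ_def by (auto intro!: family)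
qed

lemma coord_one [simp]: "cstar_algebra A \<Longrightarrow> coord A (1 :: 'a univ) = \<one>\<^bsub>A\<^esub>" and char_one [simp]: "char (1 :: 'a univ) = 1"
proof -
  have "cstar_algebra A \<Longrightarrow> \<one>\<^bsub>A\<^esub> \<in> carrier A \<and> cnorm A \<one>\<^bsub>A\<^esub> \<le> 1" for A :: "'a cstar_algebra"
  proof -
    assume "cstar_algebra A" then interpret cstar_algebra A .
    show ?thesis by (simp add: cnorm_one_le)
  qed
  then show "cstar_algebra A \<Longrightarrow> coord A (1 :: 'a univ) = \<one>\<^bsub>A\<^esub>" "char (1 :: 'a univ) = 1"
    unfolding one_univ_def by (auto intro!: family)
qed

lemma coord_im [simp]: "cstar_algebra A \<Longrightarrow> coord A (univ_im :: 'a univ) = \<i> \<odot>\<^bsub>A\<^esub> \<one>\<^bsub>A\<^esub>" and char_im [simp]: "char (univ_im :: 'a univ) = \<i>"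
proof -
  have "cstar_algebra A \<Longrightarrow> \<i> \<odot>\<^bsub>A\<^esub> \<one>\<^bsub>A\<^esub> \<in> carrier A \<and> cnorm A (\<i> \<odot>\<^bsub>A\<^esub> \<one>\<^bsub>A\<^esub>) \<le> 1" for A :: "'a cstar_algebra"
  proof -
    assume "cstar_algebra A" then interpret cstar_algebra A .
    show ?thesis by (simp add: cnorm_one_le cnorm_smult)
  qed
  then show "cstar_algebra A \<Longrightarrow> coord A (univ_im :: 'a univ) = \<i> \<odot>\<^bsub>A\<^esub> \<one>\<^bsub>A\<^esub>" "char (univ_im :: 'a univ) = \<i>"
    unfolding univ_im_def by (auto intro!: family)
qed

lemma coord_plus [simp]: "cstar_algebra A \<Longrightarrow> coord A (u + v) = coord A u \<oplus>\<^bsub>A\<^esub> coord A v"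
  and char_plus [simp]: "char (u + v) = char u + char v"
proof -
  obtain K L where K: "\<And>A. cstar_algebra A \<Longrightarrow> cnorm A (coord A u) \<le> K" and L: "\<And>A. cstar_algebra A \<Longrightarrow> cnorm A (coord A v) \<le> L"
    using coord_bounded by metis
  have "cstar_algebra A \<Longrightarrow> coord A u \<oplus>\<^bsub>A\<^esub> coord A v \<in> carrier A \<and> cnorm A (coord A u \<oplus>\<^bsub>A\<^esub> coord A v) \<le> K + L" for A
  proof -
    assume A: "cstar_algebra A" then interpret cstar_algebra A .
    show ?thesis using K[OF A] L[OF A] cnorm_triangle[of "coord A u" "coord A v"] A by simp
  qed
  then show "cstar_algebra A \<Longrightarrow> coord A (u + v) = coord A u \<oplus>\<^bsub>A\<^esub> coord A v" "char (u + v) = char u + char v"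
    unfolding plus_univ_def by (auto intro!: family)
qed

lemma coord_uminus [simp]: "cstar_algebra A \<Longrightarrow> coord A (- u) = \<ominus>\<^bsub>A\<^esub> coord A u"
  and char_uminus [simp]: "char (- u) = - char u"
proof -
  obtain K where K: "\<And>A. cstar_algebra A \<Longrightarrow> cnorm A (coord A u) \<le> K" using coord_bounded by metis
  have "cstar_algebra A \<Longrightarrow> \<ominus>\<^bsub>A\<^esub> coord A u \<in> carrier A \<and> cnorm A (\<ominus>\<^bsub>A\<^esub> coord A u) \<le> K" for A
  proof -
    assume A: "cstar_algebra A" then interpret cstar_algebra A .
    show ?thesis using K[OF A] A by (simp add: cnorm_uminus)
  qed
  then show "cstar_algebra A \<Longrightarrow> coord A (- u) = \<ominus>\<^bsub>A\<^esub> coord A u" "char (- u) = - char u"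
    unfolding uminus_univ_def by (auto intro!: family)
qed

lemma diff_univ: "u - v = u + - (v :: 'd univ)"
  unfolding plus_univ_def minus_univ_def family_def
  by (rule arg_cong[where f = Abs_univ]) (auto simp: fun_eq_iff a_minus_def)

lemma coord_minus [simp]: "cstar_algebra A \<Longrightarrow> coord A (u - v) = coord A u \<ominus>\<^bsub>A\<^esub> coord A v"
  and char_minus [simp]: "char (u - v) = char u - char v"
  unfolding diff_univ by (simp_all add: a_minus_def)

lemma coord_times [simp]: "cstar_algebra A \<Longrightarrow> coord A (u * v) = coord A u \<otimes>\<^bsub>A\<^esub> coord A v"
  and char_times [simp]: "char (u * v) = char u * char v"
proof -
  obtain K L where K: "\<And>A. cstar_algebra A \<Longrightarrow> cnorm A (coord A u) \<le> K" and L: "\<And>A. cstar_algebra A \<Longrightarrow> cnorm A (coord A v) \<le> L"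
    using coord_bounded by metis
  have "cstar_algebra A \<Longrightarrow> coord A u \<otimes>\<^bsub>A\<^esub> coord A v \<in> carrier A \<and> cnorm A (coord A u \<otimes>\<^bsub>A\<^esub> coord A v) \<le> \<bar>K\<bar> * \<bar>L\<bar>" for A
  proof -
    assume A: "cstar_algebra A" then interpret cstar_algebra A .
    have "cnorm A (coord A u) * cnorm A (coord A v) \<le> \<bar>K\<bar> * \<bar>L\<bar>"
      using K[OF A] L[OF A] A by (intro mult_mono) (auto simp: cnorm_nonneg)
    then show ?thesis using cnorm_mult[of "coord A u" "coord A v"] A by simp
  qed
  then show "cstar_algebra A \<Longrightarrow> coord A (u * v) = coord A u \<otimes>\<^bsub>A\<^esub> coord A v" "char (u * v) = char u * char v"
    unfolding times_univ_def by (auto intro!: family)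
qed

lemma coord_scaleR [simp]: "cstar_algebra A \<Longrightarrow> coord A (r *\<^sub>R u) = complex_of_real r \<odot>\<^bsub>A\<^esub> coord A u"
  and char_scaleR [simp]: "char (r *\<^sub>R u) = of_real r * char u"
proof -
  obtain K where K: "\<And>A. cstar_algebra A \<Longrightarrow> cnorm A (coord A u) \<le> K" using coord_bounded by metis
  have "cstar_algebra A \<Longrightarrow> complex_of_real r \<odot>\<^bsub>A\<^esub> coord A u \<in> carrier A \<and>
      cnorm A (complex_of_real r \<odot>\<^bsub>A\<^esub> coord A u) \<le> \<bar>r\<bar> * K" for A
  proof -
    assume A: "cstar_algebra A" then interpret cstar_algebra A .
    show ?thesis using K[OF A] A by (simp add: cnorm_smult mult_left_mono)
  qed
  then show "cstar_algebra A \<Longrightarrow> coord A (r *\<^sub>R u) = complex_of_real r \<odot>\<^bsub>A\<^esub> coord A u" "char (r *\<^sub>R u) = of_real r * char u"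
    unfolding scaleR_univ_def by (auto intro!: family)
qed

lemma coord_star [simp]: "cstar_algebra A \<Longrightarrow> coord A (univ_star u) = adj A (coord A u)"
  and char_star [simp]: "char (univ_star u) = cnj (char u)"
proof -
  obtain K where K: "\<And>A. cstar_algebra A \<Longrightarrow> cnorm A (coord A u) \<le> K" using coord_bounded by metis
  have "cstar_algebra A \<Longrightarrow> adj A (coord A u) \<in> carrier A \<and> cnorm A (adj A (coord A u)) \<le> K" for A
  proof -
    assume A: "cstar_algebra A" then interpret cstar_algebra A .
    show ?thesis using K[OF A] A by (simp add: cnorm_adj adj_closed)
  qed
  then show "cstar_algebra A \<Longrightarrow> coord A (univ_star u) = adj A (coord A u)" "char (univ_star u) = cnj (char u)"
    unfolding univ_star_def by (auto intro!: family)
qed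

instance univ :: (type) ring_1
proof
  fix u v w :: "'a univ"
  show "u + v + w = u + (v + w)"
  proof (rule univ_eqI)
    fix A :: "'a cstar_algebra" assume A: "cstar_algebra A" interpret A: ring A by (rule cstar_algebra.axioms(1)[OF A])
    interpret cstar_algebra A by (rule A)
    show "coord A (u + v + w) = coord A (u + (v + w))" using A by (simp add: A.a_assoc)
  qed simp
  show "u + v = v + u"
  proof (rule univ_eqI)
    fix A :: "'a cstar_algebra" assume A: "cstar_algebra A" interpret A: ring A by (rule cstar_algebra.axioms(1)[OF A])
    interpret cstar_algebra A by (rule A)
    show "coord A (u + v) = coord A (v + u)" using A by (simp add: A.a_comm)
  qed simp
  show "0 + u = u"
  proof (rule univ_eqI)
    fix A :: "'a cstar_algebra" assume A: "cstar_algebra A" interpret A: ring A by (rule cstar_algebra.axioms(1)[OF A])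
    interpret cstar_algebra A by (rule A)
    show "coord A (0 + u) = coord A u" using A by simp
  qed simp
  show "- u + u = 0"
  proof (rule univ_eqI)
    fix A :: "'a cstar_algebra" assume A: "cstar_algebra A" interpret A: ring A by (rule cstar_algebra.axioms(1)[OF A])
    interpret cstar_algebra A by (rule A)
    show "coord A (- u + u) = coord A 0" using A by (simp add: A.l_neg)
  qed simp
  show "u - v = u + - v" by (rule diff_univ)
  show "u * v * w = u * (v * w)"
  proof (rule univ_eqI)
    fix A :: "'a cstar_algebra" assume A: "cstar_algebra A" interpret A: ring A by (rule cstar_algebra.axioms(1)[OF A])
    interpret cstar_algebra A by (rule A)
    show "coord A (u * v * w) = coord A (u * (v * w))" using A by (simp add: A.m_assoc)
  qed simp
  show "1 * u = u"
  proof (rule univ_eqI)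
    fix A :: "'a cstar_algebra" assume A: "cstar_algebra A" interpret A: ring A by (rule cstar_algebra.axioms(1)[OF A])
    interpret cstar_algebra A by (rule A)
    show "coord A (1 * u) = coord A u" using A by simp
  qed simp
  show "u * 1 = u"
  proof (rule univ_eqI)
    fix A :: "'a cstar_algebra" assume A: "cstar_algebra A" interpret A: ring A by (rule cstar_algebra.axioms(1)[OF A])
    interpret cstar_algebra A by (rule A)
    show "coord A (u * 1) = coord A u" using A by simp
  qed simp
  show "(u + v) * w = u * w + v * w"
  proof (rule univ_eqI)
    fix A :: "'a cstar_algebra" assume A: "cstar_algebra A" interpret A: ring A by (rule cstar_algebra.axioms(1)[OF A])
    interpret cstar_algebra A by (rule A)
    show "coord A ((u + v) * w) = coord A (u * w + v * w)" using A by (simp add: A.l_distr)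
  qed (simp add: distrib_right)
  show "u * (v + w) = u * v + u * w"
  proof (rule univ_eqI)
    fix A :: "'a cstar_algebra" assume A: "cstar_algebra A" interpret A: ring A by (rule cstar_algebra.axioms(1)[OF A])
    interpret cstar_algebra A by (rule A)
    show "coord A (u * (v + w)) = coord A (u * v + u * w)" using A by (simp add: A.r_distr)
  qed (simp add: distrib_left)
  \<comment> \<open>Only the complex coordinate is sure to separate 0 and 1: on a one-element type
    every C*-algebra is zero.\<close>
  show "(0 :: 'a univ) \<noteq> 1" using char_zero char_one by (metis zero_neq_one)
qed

instance univ :: (type) real_algebra_1
proof
  fix u v :: "'a univ" and r s :: real
  show "r *\<^sub>R (u + v) = r *\<^sub>R u + r *\<^sub>R v"
  proof (rule univ_eqI)
    fix A :: "'a cstar_algebra" assume A: "cstar_algebra A" interpret A: ring A by (rule cstar_algebra.axioms(1)[OF A])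
    interpret cstar_algebra A by (rule A)
    show "coord A (r *\<^sub>R (u + v)) = coord A (r *\<^sub>R u + r *\<^sub>R v)" using A by (simp add: scalar_add_right)
  qed (simp add: distrib_left)
  show "(r + s) *\<^sub>R u = r *\<^sub>R u + s *\<^sub>R u"
  proof (rule univ_eqI)
    fix A :: "'a cstar_algebra" assume A: "cstar_algebra A" interpret A: ring A by (rule cstar_algebra.axioms(1)[OF A])
    interpret cstar_algebra A by (rule A)
    show "coord A ((r + s) *\<^sub>R u) = coord A (r *\<^sub>R u + s *\<^sub>R u)" using A by (simp add: scalar_add_left)
  qed (simp add: distrib_right)
  show "r *\<^sub>R s *\<^sub>R u = (r * s) *\<^sub>R u"
  proof (rule univ_eqI)
    fix A :: "'a cstar_algebra" assume A: "cstar_algebra A" interpret A: ring A by (rule cstar_algebra.axioms(1)[OF A])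
    interpret cstar_algebra A by (rule A)
    show "coord A (r *\<^sub>R s *\<^sub>R u) = coord A ((r * s) *\<^sub>R u)" using A by (simp add: scalar_scalar)
  qed simp
  show "1 *\<^sub>R u = u"
  proof (rule univ_eqI)
    fix A :: "'a cstar_algebra" assume A: "cstar_algebra A" interpret A: ring A by (rule cstar_algebra.axioms(1)[OF A])
    interpret cstar_algebra A by (rule A)
    show "coord A (1 *\<^sub>R u) = coord A u" using A by simp
  qed simp
  show "r *\<^sub>R u * v = r *\<^sub>R (u * v)"
  proof (rule univ_eqI)
    fix A :: "'a cstar_algebra" assume A: "cstar_algebra A" interpret A: ring A by (rule cstar_algebra.axioms(1)[OF A])
    interpret cstar_algebra A by (rule A)
    show "coord A (r *\<^sub>R u * v) = coord A (r *\<^sub>R (u * v))" using A by (simp add: smult_mult_left)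
  qed simp
  show "u * r *\<^sub>R v = r *\<^sub>R (u * v)"
  proof (rule univ_eqI)
    fix A :: "'a cstar_algebra" assume A: "cstar_algebra A" interpret A: ring A by (rule cstar_algebra.axioms(1)[OF A])
    interpret cstar_algebra A by (rule A)
    show "coord A (u * r *\<^sub>R v) = coord A (r *\<^sub>R (u * v))" using A by (simp add: smult_mult_right)
  qed simp
qed

instantiation univ :: (type) real_normed_algebra_1
begin

definition "norm u = Sup (insert (cmod (char u)) ((\<lambda>A. cnorm A (coord A u)) ` Collect cstar_algebra))"
definition "dist u v = norm (u - v :: 'a univ)"
definition "sgn u = inverse (norm u) *\<^sub>R (u :: 'a univ)"
definition "uniformity = (INF e\<in>{0 <..}. principal {(u :: 'a univ, v). dist u v < e})"
definition "open (U :: 'a univ set) \<longleftrightarrow> (\<forall>x\<in>U. eventually (\<lambda>(x', y). x' = x \<longrightarrow> y \<in> U) uniformity)"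

lemma norm_univ_bdd: "bdd_above (insert (cmod (char u)) ((\<lambda>A. cnorm A (coord A u)) ` Collect cstar_algebra))"
  for u :: "'a univ"
  by (rule coord_bounded[of u]) (auto simp: bdd_above_def intro!: exI[of _ "max _ _"] le_max_iff_disj[THEN iffD2])

lemma cmod_char_le: "cmod (char u) \<le> norm u" for u :: "'a univ"
  unfolding norm_univ_def by (rule cSup_upper[OF _ norm_univ_bdd]) simp

lemma cnorm_coord_le: "cstar_algebra A \<Longrightarrow> cnorm A (coord A u) \<le> norm u" for u :: "'a univ"
  unfolding norm_univ_def by (rule cSup_upper[OF _ norm_univ_bdd]) simp

lemma norm_univ_leI:
  "cmod (char u) \<le> K \<Longrightarrow> (\<And>A. cstar_algebra A \<Longrightarrow> cnorm A (coord A u) \<le> K) \<Longrightarrow> norm u \<le> K" for u :: "'a univ"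
  unfolding norm_univ_def by (rule cSup_least) auto

lemma norm_univ_nonneg: "0 \<le> norm u" for u :: "'a univ"
  using cmod_char_le[of u] norm_ge_zero order_trans by blast

instance
proof
  fix u v :: "'a univ" and r :: real
  show "dist u v = norm (u - v)" by (rule dist_univ_def)
  show "sgn u = inverse (norm u) *\<^sub>R u" by (rule sgn_univ_def)
  show "uniformity = (INF e\<in>{0 <..}. principal {(x, y). dist x (y :: 'a univ) < e})" by (rule uniformity_univ_def)
  show "open U \<longleftrightarrow> (\<forall>x\<in>U. \<forall>\<^sub>F (x', y) in uniformity. x' = x \<longrightarrow> y \<in> U)" for U :: "'a univ set"
    by (rule open_univ_def)
  show "norm u = 0 \<longleftrightarrow> u = 0"
  proof
    assume n: "norm u = 0"
    show "u = 0"
    proof (rule univ_eqI)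
      show "char u = char 0" using cmod_char_le[of u] n by simp
      fix A :: "'a cstar_algebra" assume A: "cstar_algebra A" then interpret cstar_algebra A .
      have "cnorm A (coord A u) = 0" using cnorm_coord_le[OF A, of u] n cnorm_nonneg[of "coord A u"] A by simp
      then show "coord A u = coord A 0" using A cnorm_eq_0 by simp
    qed
  next
    assume "u = 0"
    have "norm (0 :: 'a univ) \<le> 0"
      by (rule norm_univ_leI) (auto simp: cstar_algebra.cnorm_0)
    then show "norm u = 0" using \<open>u = 0\<close> norm_univ_nonneg[of u] by simp
  qed
  show "norm (u + v) \<le> norm u + norm v"
  proof (rule norm_univ_leI)
    show "cmod (char (u + v)) \<le> norm u + norm v"
      using cmod_char_le[of u] cmod_char_le[of v] by (simp add: norm_triangle_mono)
    fix A :: "'a cstar_algebra" assume A: "cstar_algebra A" then interpret cstar_algebra A .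
    show "cnorm A (coord A (u + v)) \<le> norm u + norm v"
      using cnorm_triangle[of "coord A u" "coord A v"] cnorm_coord_le[OF A, of u] cnorm_coord_le[OF A, of v] A by simp
  qed
  have le: "norm (r *\<^sub>R u) \<le> \<bar>r\<bar> * norm u" for r and u :: "'a univ"
  proof (rule norm_univ_leI)
    show "cmod (char (r *\<^sub>R u)) \<le> \<bar>r\<bar> * norm u"
      using cmod_char_le[of u] by (simp add: norm_mult mult_left_mono)
    fix A :: "'a cstar_algebra" assume A: "cstar_algebra A" then interpret cstar_algebra A .
    show "cnorm A (coord A (r *\<^sub>R u)) \<le> \<bar>r\<bar> * norm u"
      using A by (simp add: cnorm_smult mult_left_mono cnorm_coord_le)
  qed
  show "norm (r *\<^sub>R u) = \<bar>r\<bar> * norm u"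
  proof (cases "r = 0")
    case True
    then show ?thesis using le[of r u] norm_univ_nonneg[of "r *\<^sub>R u"] by simp
  next
    case False
    have "norm u \<le> \<bar>inverse r\<bar> * norm (r *\<^sub>R u)" using le[of "inverse r" "r *\<^sub>R u"] False by simp
    then have "\<bar>r\<bar> * norm u \<le> norm (r *\<^sub>R u)" using False by (simp add: abs_inverse field_simps)
    then show ?thesis using le[of r u] by simp
  qed
  show "norm (u * v) \<le> norm u * norm v"
  proof (rule norm_univ_leI)
    show "cmod (char (u * v)) \<le> norm u * norm v"
      using cmod_char_le[of u] cmod_char_le[of v] norm_univ_nonneg[of u] by (simp add: norm_mult mult_mono)
    fix A :: "'a cstar_algebra" assume A: "cstar_algebra A" then interpret cstar_algebra A .
    have "cnorm A (coord A u) * cnorm A (coord A v) \<le> norm u * norm v"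
      using A by (intro mult_mono cnorm_coord_le norm_univ_nonneg) (auto intro: cnorm_nonneg)
    then show "cnorm A (coord A (u * v)) \<le> norm u * norm v"
      using cnorm_mult[of "coord A u" "coord A v"] A by simp
  qed
  show "norm (1 :: 'a univ) = 1"
  proof (rule antisym)
    show "norm (1 :: 'a univ) \<le> 1" by (rule norm_univ_leI) (auto simp: cstar_algebra.cnorm_one_le)
    show "1 \<le> norm (1 :: 'a univ)" using cmod_char_le[of "1 :: 'a univ"] by simp
  qed
qed

end

instance univ :: (type) banach
proof
  fix s :: "nat \<Rightarrow> 'a univ" assume C: "Cauchy s"
  have "Cauchy (\<lambda>n. char (s n))"
    using C unfolding Cauchy_def dist_norm by (metis char_minus cmod_char_le order_le_less_trans)
  then obtain c where c: "(\<lambda>n. char (s n)) \<longlonglongrightarrow> c" using Cauchy_convergent convergent_def by blast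
  have "\<exists>x\<in>carrier A. (\<lambda>n. cnorm A (coord A (s n) \<ominus>\<^bsub>A\<^esub> x)) \<longlonglongrightarrow> 0" if A: "cstar_algebra A" for A
  proof -
    interpret A: ring A by (rule cstar_algebra.axioms(1)[OF A])
    interpret cstar_algebra A by (rule A)
    show ?thesis
    proof (rule cnorm_complete)
      show "coord A (s n) \<in> carrier A" for n using A by simp
      fix e :: real assume "e > 0"
      then obtain N where "\<forall>m\<ge>N. \<forall>n\<ge>N. norm (s m - s n) < e" using C unfolding Cauchy_def dist_norm by blast
      then show "\<exists>N. \<forall>m\<ge>N. \<forall>n\<ge>N. cnorm A (coord A (s m) \<ominus>\<^bsub>A\<^esub> coord A (s n)) < e"
        using cnorm_coord_le[OF A] A by (metis coord_minus order_le_less_trans)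
    qed
  qed
  then obtain l where l: "\<And>A. cstar_algebra A \<Longrightarrow> l A \<in> carrier A"
    "\<And>A. cstar_algebra A \<Longrightarrow> (\<lambda>n. cnorm A (coord A (s n) \<ominus>\<^bsub>A\<^esub> l A)) \<longlonglongrightarrow> 0" by metis
  \<comment> \<open>The bound does not depend on A. It makes the family of limits bounded, hence an
    element of the product, and turns coordinatewise convergence into convergence in norm.\<close>
  have close: "cnorm A (coord A (s n) \<ominus>\<^bsub>A\<^esub> l A) \<le> e"
    if A: "cstar_algebra A" and N: "\<forall>m\<ge>N. norm (s n - s m) \<le> e" for A n N e
  proof -
    interpret A: ring A by (rule cstar_algebra.axioms(1)[OF A])
    interpret cstar_algebra A by (rule A)
    have "cnorm A (coord A (s n) \<ominus>\<^bsub>A\<^esub> l A) \<le> e + cnorm A (coord A (s m) \<ominus>\<^bsub>A\<^esub> l A)" if "m \<ge> N" for m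
    proof -
      have "coord A (s n) \<ominus>\<^bsub>A\<^esub> l A = (coord A (s n) \<ominus>\<^bsub>A\<^esub> coord A (s m)) \<oplus>\<^bsub>A\<^esub> (coord A (s m) \<ominus>\<^bsub>A\<^esub> l A)"
        using A l(1)[OF A] by (simp add: a_minus_def A.a_assoc A.r_neg1 A.l_neg A.r_neg2 A.minus_add)
      then have "cnorm A (coord A (s n) \<ominus>\<^bsub>A\<^esub> l A) \<le> cnorm A (coord A (s n - s m)) + cnorm A (coord A (s m) \<ominus>\<^bsub>A\<^esub> l A)"
        using cnorm_triangle[of "coord A (s n) \<ominus>\<^bsub>A\<^esub> coord A (s m)" "coord A (s m) \<ominus>\<^bsub>A\<^esub> l A"] A l(1)[OF A] by simp
      then show ?thesis using cnorm_coord_le[OF A, of "s n - s m"] N that by force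
    qed
    moreover have "(\<lambda>m. e + cnorm A (coord A (s m) \<ominus>\<^bsub>A\<^esub> l A)) \<longlonglongrightarrow> e + 0" by (intro tendsto_intros l A)
    ultimately show ?thesis using LIMSEQ_le_const[of _ e] by fastforce
  qed
  obtain N1 where N1: "\<forall>m\<ge>N1. norm (s N1 - s m) \<le> 1"
    using C unfolding Cauchy_def dist_norm by (metis less_imp_le order_refl zero_less_one)
  have bdd: "cnorm A (l A) \<le> norm (s N1) + 1" if A: "cstar_algebra A" for A
  proof -
    interpret A: ring A by (rule cstar_algebra.axioms(1)[OF A])
    interpret cstar_algebra A by (rule A)
    have "l A = coord A (s N1) \<oplus>\<^bsub>A\<^esub> \<ominus>\<^bsub>A\<^esub> (coord A (s N1) \<ominus>\<^bsub>A\<^esub> l A)"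
      using A l(1)[OF A] by (simp add: a_minus_def A.minus_add A.r_neg A.a_assoc[symmetric])
    then have "cnorm A (l A) \<le> cnorm A (coord A (s N1)) + cnorm A (coord A (s N1) \<ominus>\<^bsub>A\<^esub> l A)"
      using cnorm_triangle[of "coord A (s N1)" "\<ominus>\<^bsub>A\<^esub> (coord A (s N1) \<ominus>\<^bsub>A\<^esub> l A)"] A l(1)[OF A] by (simp add: cnorm_uminus)
    then show ?thesis using close[OF A N1] cnorm_coord_le[OF A, of "s N1"] by simp
  qed
  define x where "x = family l c"
  have x: "cstar_algebra A \<Longrightarrow> coord A x = l A" "char x = c" for A
    unfolding x_def by (rule family[OF l(1) bdd]; assumption)+
  have "s \<longlonglongrightarrow> x"
  proof (rule LIMSEQ_I)
    fix e :: real assume e: "e > 0"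
    obtain N where N: "\<And>m n. m \<ge> N \<Longrightarrow> n \<ge> N \<Longrightarrow> norm (s n - s m) < e/2"
      using C e unfolding Cauchy_def dist_norm by (meson half_gt_zero)
    show "\<exists>N. \<forall>n\<ge>N. norm (s n - x) < e"
    proof (intro exI allI impI)
      fix n assume n: "n \<ge> N"
      have "norm (s n - x) \<le> e/2"
      proof (rule norm_univ_leI)
        have "(\<lambda>m. cmod (char (s n) - char (s m))) \<longlonglongrightarrow> cmod (char (s n) - c)" by (intro tendsto_intros c)
        then show "cmod (char (s n - x)) \<le> e/2"
          unfolding char_minus x
        proof (rule LIMSEQ_le_const2)
          show "\<exists>N. \<forall>m\<ge>N. cmod (char (s n) - char (s m)) \<le> e/2"
            using N n cmod_char_le[of "s n - s _"] by (intro exI[of _ N]) (metis char_minus cmod_char_le less_imp_le order_trans)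
        qed
        fix A :: "'a cstar_algebra" assume A: "cstar_algebra A"
        have "cnorm A (coord A (s n) \<ominus>\<^bsub>A\<^esub> l A) \<le> e/2"
          by (rule close[OF A, of N]) (use N n in \<open>auto intro: less_imp_le\<close>)
        then show "cnorm A (coord A (s n - x)) \<le> e/2" using A x by simp
      qed
      then show "norm (s n - x) < e" using e by simp
    qed
  qed
  then show "convergent s" unfolding convergent_def by blast
qed

instantiation univ :: (type) cstar
begin

definition "star = (univ_star :: 'a univ \<Rightarrow> 'a univ)"
definition "im = (univ_im :: 'a univ)"

instance
proof
  fix u v :: "'a univ" and r :: real
  show "star (star u) = u"
  proof (rule univ_eqI)
    fix A :: "'a cstar_algebra" assume A: "cstar_algebra A" interpret A: ring A by (rule cstar_algebra.axioms(1)[OF A])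
    interpret cstar_algebra A by (rule A)
    show "coord A (star (star u)) = coord A u" using A by (simp add: star_univ_def adj_adj)
  qed (simp add: star_univ_def)
  show "star (u + v) = star u + star v"
  proof (rule univ_eqI)
    fix A :: "'a cstar_algebra" assume A: "cstar_algebra A" interpret A: ring A by (rule cstar_algebra.axioms(1)[OF A])
    interpret cstar_algebra A by (rule A)
    show "coord A (star (u + v)) = coord A (star u + star v)" using A by (simp add: star_univ_def adj_add)
  qed (simp add: star_univ_def)
  show "star (u * v) = star v * star u"
  proof (rule univ_eqI)
    fix A :: "'a cstar_algebra" assume A: "cstar_algebra A" interpret A: ring A by (rule cstar_algebra.axioms(1)[OF A])
    interpret cstar_algebra A by (rule A)
    show "coord A (star (u * v)) = coord A (star v * star u)" using A by (simp add: star_univ_def adj_mult)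
  qed (simp add: star_univ_def)
  show "star (r *\<^sub>R u) = r *\<^sub>R star u"
  proof (rule univ_eqI)
    fix A :: "'a cstar_algebra" assume A: "cstar_algebra A" interpret A: ring A by (rule cstar_algebra.axioms(1)[OF A])
    interpret cstar_algebra A by (rule A)
    show "coord A (star (r *\<^sub>R u)) = coord A (r *\<^sub>R star u)" using A by (simp add: star_univ_def adj_smult)
  qed (simp add: star_univ_def)
  show "im * im = (- 1 :: 'a univ)"
  proof (rule univ_eqI)
    fix A :: "'a cstar_algebra" assume A: "cstar_algebra A" interpret A: ring A by (rule cstar_algebra.axioms(1)[OF A])
    interpret cstar_algebra A by (rule A)
    show "coord A (im * im) = coord A (- 1)"
      using A by (simp add: im_univ_def smult_mult_left smult_mult_right scalar_scalar scalar_minus_1)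
  qed (simp add: im_univ_def)
  show "im * u = u * im"
  proof (rule univ_eqI)
    fix A :: "'a cstar_algebra" assume A: "cstar_algebra A" interpret A: ring A by (rule cstar_algebra.axioms(1)[OF A])
    interpret cstar_algebra A by (rule A)
    show "coord A (im * u) = coord A (u * im)"
      using A by (simp add: im_univ_def smult_mult_left smult_mult_right)
  qed (simp add: im_univ_def)
  show "star im = (- im :: 'a univ)"
  proof (rule univ_eqI)
    fix A :: "'a cstar_algebra" assume A: "cstar_algebra A" interpret A: ring A by (rule cstar_algebra.axioms(1)[OF A])
    interpret cstar_algebra A by (rule A)
    show "coord A (star im) = coord A (- im)"
      using A by (simp add: star_univ_def im_univ_def adj_smult scalar_minus_1 scalar_scalar)
  qed (simp add: star_univ_def im_univ_def)
  show "norm (star u * u) = (norm u)\<^sup>2"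
  proof (rule antisym)
    show "norm (star u * u) \<le> (norm u)\<^sup>2"
    proof (rule norm_univ_leI)
      show "cmod (char (star u * u)) \<le> (norm u)\<^sup>2"
        using cmod_char_le[of u] by (simp add: star_univ_def norm_mult power2_eq_square mult_mono)
      fix A :: "'a cstar_algebra" assume A: "cstar_algebra A" then interpret cstar_algebra A .
      show "cnorm A (coord A (star u * u)) \<le> (norm u)\<^sup>2"
        using A cnorm_coord_le[OF A, of u] by (simp add: star_univ_def cstar_identity power_mono cnorm_nonneg)
    qed
    have "norm u \<le> sqrt (norm (star u * u))"
    proof (rule norm_univ_leI)
      show "cmod (char u) \<le> sqrt (norm (star u * u))"
        using cmod_char_le[of "star u * u"] by (intro real_le_rsqrt) (simp add: star_univ_def norm_mult power2_eq_square)
      fix A :: "'a cstar_algebra" assume A: "cstar_algebra A" then interpret cstar_algebra A .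
      show "cnorm A (coord A u) \<le> sqrt (norm (star u * u))"
        using A cnorm_coord_le[OF A, of "star u * u"] by (intro real_le_rsqrt) (simp add: star_univ_def cstar_identity)
    qed
    then have "(norm u)\<^sup>2 \<le> (sqrt (norm (star u * u)))\<^sup>2" by (rule power_mono) simp
    then show "(norm u)\<^sup>2 \<le> norm (star u * u)" by simp
  qed
qed

end

section \<open>The monotone product over abstract C*-algebras\<close>

text \<open>Complex scalars act by multiplication with these central elements, since the type class
  carries real scalars only.\<close>

definition scal :: "complex \<Rightarrow> 'a::cstar" where
  "scal c = Re c *\<^sub>R 1 + Im c *\<^sub>R im"

lemma scal_0 [simp]: "scal 0 = 0" and scal_1 [simp]: "scal 1 = 1"
  and scal_i: "scal \<i> = im" and scal_of_real: "scal (of_real r) = r *\<^sub>R 1"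
  by (simp_all add: scal_def)

lemma scal_add: "scal (c + d) = scal c + scal d"
  by (simp add: scal_def algebra_simps)

lemma scal_mult: "scal (c * d) = scal c * scal d"
  by (simp add: scal_def algebra_simps im_im)

lemma scal_comm: "x * scal c = scal c * x"
  by (simp add: scal_def algebra_simps im_comm)

lemma scal_left_comm: "x * (scal c * y) = scal c * (x * y)"
  by (metis mult.assoc scal_comm)

lemma star_scal: "star (scal c) = scal (cnj c)"
  by (simp add: scal_def star_add star_scaleR star_im)

lemma star_eq_of_polarization:
  assumes "star (x + y) = x + y" "star (im * x - im * y) = im * x - im * (y :: 'a::cstar)"
  shows "star x = y"
proof -
  have "star x * im - star y * im = im * y - im * x"
    using assms(2) by (simp add: star_diff star_mult star_im algebra_simps)
  then have "im * (star x - star y) = im * (y - x)" by (simp add: im_comm right_diff_distrib)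
  then have "im * (im * (star x - star y)) = im * (im * (y - x))" by simp
  then have "star x - star y = y - x" by (simp add: im_im_left algebra_simps)
  moreover have "star x + star y = x + y" using assms(1) by (simp add: star_add)
  ultimately have "(star x - star y) + (star x + star y) = (y - x) + (x + y)" by (simp only:)
  then have "2 *\<^sub>R star x = 2 *\<^sub>R y" by (simp add: scaleR_2)
  then show ?thesis by simp
qed

text \<open>Positivity at 1 + x and at 1 + i x shows that \<open>\<phi> x + \<phi> (star x)\<close>
  and \<open>im * \<phi> x - im * \<phi> (star x)\<close> are self-adjoint, and these two facts
  determine \<open>star (\<phi> x)\<close>.\<close>

lemma star_of_positive:
  fixes \<phi> :: "'a::cstar \<Rightarrow> 'c::cstar"
  assumes pos: "\<And>x. nonneg (\<phi> (star x * x))" and add: "\<And>x y. \<phi> (x + y) = \<phi> x + \<phi> y"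
    and sc: "\<And>c x. \<phi> (scal c * x) = scal c * \<phi> x"
  shows "star (\<phi> x) = \<phi> (star x)"
proof (rule star_eq_of_polarization)
  have sa: "star (\<phi> (star y * y)) = \<phi> (star y * y)" for y using pos nonneg_star by blast
  have min: "\<phi> (- y) = - \<phi> y" for y using sc[of "- 1" y] by (simp add: scal_def)
  have "\<phi> (star (1 + x) * (1 + x)) = \<phi> (star 1 * 1) + (\<phi> x + \<phi> (star x)) + \<phi> (star x * x)"
    by (simp add: star_add algebra_simps add)
  then show "star (\<phi> x + \<phi> (star x)) = \<phi> x + \<phi> (star x)"
    using sa[of "1 + x"] sa[of 1] sa[of x] by (simp add: star_add)
  have i: "\<phi> (im * y) = im * \<phi> y" for y using sc[of \<i> y] by (simp add: scal_i)
  have "\<phi> (star (1 + im * x) * (1 + im * x)) = \<phi> (star 1 * 1) + (im * \<phi> x - im * \<phi> (star x)) + \<phi> (star x * x)"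
  proof -
    have "star (1 + im * x) * (1 + im * x) = 1 + im * x + - (im * star x) + star x * x"
      by (simp add: star_add star_mult star_im algebra_simps im_comm[of "star x", symmetric] im_left_commute[of "star x"] im_im_left)
    then show ?thesis by (simp only: add min i) simp
  qed
  then show "star (im * \<phi> x - im * \<phi> (star x)) = im * \<phi> x - im * \<phi> (star x)"
    using sa[of "1 + im * x"] sa[of 1] sa[of x] by (simp add: star_add)
qed

text \<open>Complete positivity enters through Gram matrices. The bimodule laws of \<psi> are
  required only under \<open>\<iota> j\<close> or \<open>\<kappa>\<close>: the lift of a given
  \<psi> fills the coordinates other than B from the character alone, so the two sides may differ
  there.\<close>

locale monotone_data =
  fixes \<theta> :: "'i::linorder \<Rightarrow> 'a::cstar \<Rightarrow> 'd::cstar"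
    and \<psi> :: "'i \<Rightarrow> 'a \<Rightarrow> 'b::cstar"
    and \<iota> :: "'i \<Rightarrow> 'b \<Rightarrow> 'a"
    and \<kappa> :: "'b \<Rightarrow> 'd"
  assumes \<theta>_add: "\<theta> i (x + y) = \<theta> i x + \<theta> i y"
    and \<theta>_scal: "\<theta> i (scal c * x) = scal c * \<theta> i x"
    and \<theta>_left: "\<theta> i (\<iota> i b * x) = \<kappa> b * \<theta> i x"
    and \<theta>_right: "\<theta> i (x * \<iota> i b) = \<theta> i x * \<kappa> b"
    and \<theta>_one: "\<theta> i 1 = 1"
    and \<theta>_pos: "nonneg (\<Sum>m<(n::nat). \<Sum>k<n. star (d m) * \<theta> i (star (z m) * z k) * d k)"
    and \<psi>_add: "\<psi> i (x + y) = \<psi> i x + \<psi> i y"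
    and \<psi>_scal: "\<psi> i (scal c * x) = scal c * \<psi> i x"
    and \<iota>_\<psi>_left: "\<iota> j (\<psi> i (\<iota> i b * x)) = \<iota> j (b * \<psi> i x)"
    and \<kappa>_\<psi>_left: "\<kappa> (\<psi> i (\<iota> i b * x)) = \<kappa> (b * \<psi> i x)"
    and \<iota>_\<psi>_right: "\<iota> j (\<psi> i (x * \<iota> i b)) = \<iota> j (\<psi> i x * b)"
    and \<kappa>_\<psi>_right: "\<kappa> (\<psi> i (x * \<iota> i b)) = \<kappa> (\<psi> i x * b)"
    and \<psi>_one: "\<psi> i 1 = 1"
    and \<psi>_pos: "nonneg (\<Sum>m<(n::nat). \<Sum>k<n. star (\<xi> m) * \<psi> i (star (z m) * z k) * \<xi> k)"
    and \<iota>_add: "\<iota> i (b + b') = \<iota> i b + \<iota> i b'"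
    and \<iota>_mult: "\<iota> i (b * b') = \<iota> i b * \<iota> i b'"
    and \<iota>_scal: "\<iota> i (scal c * b) = scal c * \<iota> i b"
    and \<iota>_one: "\<iota> i 1 = 1"
    and \<iota>_star: "\<iota> i (star b) = star (\<iota> i b)"
    and \<kappa>_add: "\<kappa> (b + b') = \<kappa> b + \<kappa> b'"
    and \<kappa>_mult: "\<kappa> (b * b') = \<kappa> b * \<kappa> b'"
    and \<kappa>_scal: "\<kappa> (scal c * b) = scal c * \<kappa> b"
    and \<kappa>_one: "\<kappa> 1 = 1"
    and \<kappa>_star: "\<kappa> (star b) = star (\<kappa> b)"
begin

lemma \<iota>_0: "\<iota> i 0 = 0" using \<iota>_add[of i 0 0] by simp
lemma \<kappa>_0: "\<kappa> 0 = 0" using \<kappa>_add[of 0 0] by simp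
lemma \<iota>_sum: "\<iota> i (sum f S) = (\<Sum>x\<in>S. \<iota> i (f x))"
  by (induction S rule: infinite_finite_induct) (auto simp: \<iota>_add \<iota>_0)
lemma \<kappa>_sum: "\<kappa> (sum f S) = (\<Sum>x\<in>S. \<kappa> (f x))"
  by (induction S rule: infinite_finite_induct) (auto simp: \<kappa>_add \<kappa>_0)
lemma \<iota>_\<psi>_\<iota>: "\<iota> j (\<psi> i (\<iota> i b)) = \<iota> j b" using \<iota>_\<psi>_left[of j i b 1] by (simp add: \<psi>_one)
lemma \<kappa>_\<psi>_\<iota>: "\<kappa> (\<psi> i (\<iota> i b)) = \<kappa> b" using \<kappa>_\<psi>_left[of i b 1] by (simp add: \<psi>_one)
lemma \<theta>_\<iota>: "\<theta> i (\<iota> i b) = \<kappa> b" using \<theta>_left[of i b 1] by (simp add: \<theta>_one)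

lemma \<psi>_star: "star (\<psi> i x) = \<psi> i (star x)"
proof (rule star_of_positive)
  show "nonneg (\<psi> i (star x * x))" for x using \<psi>_pos[where n = 1 and \<xi> = "\<lambda>_. 1" and z = "\<lambda>_. x"] by simp
qed (fact \<psi>_add \<psi>_scal)+

lemma \<theta>_star: "star (\<theta> i x) = \<theta> i (star x)"
proof (rule star_of_positive)
  show "nonneg (\<theta> i (star x * x))" for x using \<theta>_pos[where n = 1 and d = "\<lambda>_. 1" and z = "\<lambda>_. x"] by simp
qed (fact \<theta>_add \<theta>_scal)+

text \<open>
  \<open>G s w\<close> is the value of the word \<open>rev s @ w\<close>, where the stack \<open>s\<close> holds a prefix with increasing
  indices, whose last letter is on top; reading a letter with a smaller index turns the top letter
  into a peak.
\<close>

function G :: "('i \<times> 'a) list \<Rightarrow> ('i \<times> 'a) list \<Rightarrow> 'd" where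
  "G [] [] = 1"
| "G ((k, c) # s) [] = G s [] * \<theta> k c"
| "G [] ((j, a) # w) = G [(j, a)] w"
| "G [(k, c)] ((j, a) # w) =
    (if k < j then G [(j, a), (k, c)] w else if k = j then G [(k, c * a)] w
     else \<theta> k c * G [(j, a)] w)"
| "G ((k, c) # (l, e) # t) ((j, a) # w) =
    (if k < j then G ((j, a) # (k, c) # (l, e) # t) w
     else if k = j then G ((k, c * a) # (l, e) # t) w
     else G ((l, e * \<iota> l (\<psi> k c)) # t) ((j, a) # w)
       + G ((l, e) # t) [] * (\<theta> k c - \<kappa> (\<psi> k c)) * G [(j, a)] w)"
  by pat_completeness auto
termination
  \<comment> \<open>A pushed letter moves from w to the stack, and weight 2 in w makes this a
    decrease. Popping a peak shortens the stack alone.\<close>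
  by (relation "measure (\<lambda>(s, w). 2 * length w + length s)") auto

abbreviation F :: "('i \<times> 'a) list \<Rightarrow> 'd" where
  "F w \<equiv> G [] w"

section \<open>Identities for the value of a word\<close>

lemma G_push: "k < j \<Longrightarrow> G ((k, c) # s) ((j, a) # w) = G ((j, a) # (k, c) # s) w"
  by (cases s) auto

lemma G_same: "G ((k, c) # s) ((k, a) # w) = G ((k, c * a) # s) w"
  by (cases s) auto

text \<open>Reading (i, a) unfolds to a sum of left multiples of values with (i, e a) on top of some
  stack, where e, the stacks and the left factors do not depend on a. A relation that respects sums
  and left multiplication therefore has to be checked for those values only. It is ternary so that
  it can express additivity and rule (3).\<close>

lemma G_read:
  assumes add: "\<And>x y z x' y' z'. P x y z \<Longrightarrow> P x' y' z' \<Longrightarrow> P (x + x') (y + y') (z + z')"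
    and lmult: "\<And>d x y z. P x y z \<Longrightarrow> P (d * x) (d * y) (d * z)"
    and base: "\<And>s e. P (G ((i, e * a1) # s) z1) (G ((i, e * a2) # s) z2) (G ((i, e * a3) # s) z3)"
  shows "P (G s ((i, a1) # z1)) (G s ((i, a2) # z2)) (G s ((i, a3) # z3))"
proof (induction "length s" arbitrary: s rule: less_induct)
  case less
  have base1: "P (G ((i, a1) # s) z1) (G ((i, a2) # s) z2) (G ((i, a3) # s) z3)" for s
    using base[of 1 s] by simp
  show ?case
  proof (cases s)
    case Nil
    then show ?thesis using base1 by simp
  next
    case (Cons x s')
    obtain k c where x: "x = (k, c)" by fastforce
    show ?thesis
    proof (cases s')
      case Nil
      then show ?thesis using base base1 lmult Cons x by simp
    next
      case (Cons y t)
      obtain l e where y: "y = (l, e)" by fastforce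
      have "P (G ((l, e * \<iota> l (\<psi> k c)) # t) ((i, a1) # z1)) (G ((l, e * \<iota> l (\<psi> k c)) # t) ((i, a2) # z2))
          (G ((l, e * \<iota> l (\<psi> k c)) # t) ((i, a3) # z3))"
        using less[of "(l, e * \<iota> l (\<psi> k c)) # t"] \<open>s = x # s'\<close> Cons by simp
      then show ?thesis
        using base base1 lmult add \<open>s = x # s'\<close> Cons x y by simp
    qed
  qed
qed

lemma G_prefix:
  assumes add: "\<And>x y z x' y' z'. P x y z \<Longrightarrow> P x' y' z' \<Longrightarrow> P (x + x') (y + y') (z + z')"
    and lmult: "\<And>d x y z. P x y z \<Longrightarrow> P (d * x) (d * y) (d * z)"
    and base: "\<And>s. P (G s z1) (G s z2) (G s z3)"
  shows "P (G s (w @ z1)) (G s (w @ z2)) (G s (w @ z3))"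
proof (induction w arbitrary: s)
  case Nil
  show ?case using base by simp
next
  case (Cons x w)
  show ?case using G_read[of P "fst x" "snd x" "w @ z1" "snd x" "w @ z2" "snd x" "w @ z3" s] add lmult Cons
    by simp
qed

text \<open>The length of q counts in the induction because a popped letter (k, c) is absorbed,
  through \<iota>(\<psi>(c)), into the next letter of q, and the linear dependence moves
  there.\<close>

lemma G_stack_linear:
  "G (p @ (k, scal \<alpha> * c + scal \<beta> * c') # q) w
     = scal \<alpha> * G (p @ (k, c) # q) w + scal \<beta> * G (p @ (k, c') # q) w"
proof (induction "2 * length w + length p + length q" arbitrary: p q k c c' w rule: less_induct)
  case less
  show ?case
  proof (cases w)
    case Nil
    show ?thesis
    proof (cases p)
      case Nil
      then show ?thesis using \<open>w = []\<close> by (simp add: \<theta>_add \<theta>_scal algebra_simps scal_left_comm)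
    next
      case (Cons x p')
      obtain k1 c1 where x: "x = (k1, c1)" by fastforce
      show ?thesis using less[of w p' q k c c'] \<open>w = []\<close> Cons x by (simp add: algebra_simps)
    qed
  next
    case w: (Cons y w')
    obtain j a where y: "y = (j, a)" by fastforce
    consider "p = []" "q = []" | l e t where "p = []" "q = (l, e) # t"
      | k1 c1 where "p = [(k1, c1)]" | k1 c1 l e t where "p = (k1, c1) # (l, e) # t"
      by (metis list.exhaust prod.exhaust)
    then show ?thesis
    proof cases
      case 1
      show ?thesis
        using less[of w' "[(j, a)]" "[]" k c c'] less[of w' "[]" "[]" j "c * a" "c' * a"] w y 1
        by (simp add: \<theta>_add \<theta>_scal algebra_simps scal_left_comm)
    next
      case 2
      have "e * \<iota> l (\<psi> k (scal \<alpha> * c + scal \<beta> * c'))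
          = scal \<alpha> * (e * \<iota> l (\<psi> k c)) + scal \<beta> * (e * \<iota> l (\<psi> k c'))"
        by (simp add: \<psi>_add \<psi>_scal \<iota>_add \<iota>_scal distrib_left scal_left_comm)
      then have "G ((l, e * \<iota> l (\<psi> k (scal \<alpha> * c + scal \<beta> * c'))) # t) w
          = scal \<alpha> * G ((l, e * \<iota> l (\<psi> k c)) # t) w + scal \<beta> * G ((l, e * \<iota> l (\<psi> k c')) # t) w"
        using less[of w "[]" t l "e * \<iota> l (\<psi> k c)" "e * \<iota> l (\<psi> k c')"] 2 by simp
      then show ?thesis
        using less[of w' "[(j, a)]" q k c c'] less[of w' "[]" q j "c * a" "c' * a"] w y 2
        by (simp add: \<theta>_add \<theta>_scal \<psi>_add \<psi>_scal \<kappa>_add \<kappa>_scal algebra_simps scal_left_comm)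
    next
      case 3
      have "G ((k, (scal \<alpha> * c + scal \<beta> * c') * \<iota> k (\<psi> k1 c1)) # q) w
          = scal \<alpha> * G ((k, c * \<iota> k (\<psi> k1 c1)) # q) w + scal \<beta> * G ((k, c' * \<iota> k (\<psi> k1 c1)) # q) w"
        using less[of w "[]" q k "c * \<iota> k (\<psi> k1 c1)" "c' * \<iota> k (\<psi> k1 c1)"] 3
        by (simp add: distrib_right mult.assoc)
      then show ?thesis
        using less[of w' "[(j, a), (k1, c1)]" q k c c'] less[of w' "[(j, c1 * a)]" q k c c']
          less[of "[]" "[]" q k c c'] w y 3
        by (simp add: distrib_right mult.assoc distrib_left)
    next
      case 4
      then show ?thesis
        using less[of w' "(j, a) # p" q k c c'] less[of w' "(j, c1 * a) # (l, e) # t" q k c c']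
          less[of w "(l, e * \<iota> l (\<psi> k1 c1)) # t" q k c c'] less[of "[]" "(l, e) # t" q k c c'] w y
        by (simp add: distrib_right mult.assoc distrib_left)
    qed
  qed
qed

text \<open>The stack is reversed: (l, e) stands before (k, c) in the word, so b moves across the
  tensor sign between them.\<close>

lemma G_stack_balanced:
  "G (p @ (k, \<iota> k b * c) # (l, e) # q) w = G (p @ (k, c) # (l, e * \<iota> l b) # q) w"
proof (induction "2 * length w + length p" arbitrary: p k c w rule: less_induct)
  case less
  show ?case
  proof (cases w)
    case Nil
    show ?thesis
    proof (cases p)
      case Nil
      then show ?thesis using \<open>w = []\<close> by (simp add: \<theta>_left \<theta>_right mult.assoc)
    next
      case (Cons x p')
      obtain k1 c1 where x: "x = (k1, c1)" by fastforce
      show ?thesis using less[of w p' k c] \<open>w = []\<close> Cons x by simp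
    qed
  next
    case w: (Cons y w')
    obtain j a where y: "y = (j, a)" by fastforce
    consider "p = []" | k1 c1 where "p = [(k1, c1)]" | k1 c1 l1 e1 t where "p = (k1, c1) # (l1, e1) # t"
      by (metis list.exhaust prod.exhaust)
    then show ?thesis
    proof cases
      case 1
      show ?thesis
        using less[of w' "[(j, a)]" k c] less[of w' "[]" j "c * a"] w y 1
        by (simp add: \<theta>_left \<theta>_right \<iota>_\<psi>_left \<kappa>_\<psi>_left \<kappa>_mult \<iota>_mult mult.assoc right_diff_distrib)
    next
      case 2
      show ?thesis
        using less[of w' "[(j, a), (k1, c1)]" k c] less[of w' "[(j, c1 * a)]" k c]
          less[of w "[]" k "c * \<iota> k (\<psi> k1 c1)"] less[of "[]" "[]" k c] w y 2
        by (simp add: mult.assoc)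
    next
      case 3
      then show ?thesis
        using less[of w' "(j, a) # p" k c] less[of w' "(j, c1 * a) # (l1, e1) # t" k c]
          less[of w "(l1, e1 * \<iota> l1 (\<psi> k1 c1)) # t" k c] less[of "[]" "(l1, e1) # t" k c] w y
        by simp
    qed
  qed
qed

text \<open>The bottom of the stack is the first letter of the word.\<close>

lemma G_stack_left: "G (p @ [(k, \<iota> k b * c)]) w = \<kappa> b * G (p @ [(k, c)]) w"
proof (induction "2 * length w + length p" arbitrary: p k c w rule: less_induct)
  case less
  show ?case
  proof (cases w)
    case Nil
    show ?thesis
    proof (cases p)
      case Nil
      then show ?thesis using \<open>w = []\<close> by (simp add: \<theta>_left)
    next
      case (Cons x p')
      obtain k1 c1 where x: "x = (k1, c1)" by fastforce
      show ?thesis using less[of w p' k c] \<open>w = []\<close> Cons x by (simp add: mult.assoc)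
    qed
  next
    case w: (Cons y w')
    obtain j a where y: "y = (j, a)" by fastforce
    consider "p = []" | k1 c1 where "p = [(k1, c1)]" | k1 c1 l1 e1 t where "p = (k1, c1) # (l1, e1) # t"
      by (metis list.exhaust prod.exhaust)
    then show ?thesis
    proof cases
      case 1
      show ?thesis
        using less[of w' "[(j, a)]" k c] less[of w' "[]" j "c * a"] w y 1
        by (simp add: \<theta>_left mult.assoc)
    next
      case 2
      show ?thesis
        using less[of w' "[(j, a), (k1, c1)]" k c] less[of w' "[(j, c1 * a)]" k c]
          less[of w "[]" k "c * \<iota> k (\<psi> k1 c1)"] less[of "[]" "[]" k c] w y 2
        by (simp add: mult.assoc distrib_left)
    next
      case 3
      then show ?thesis
        using less[of w' "(j, a) # p" k c] less[of w' "(j, c1 * a) # (l1, e1) # t" k c]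
          less[of w "(l1, e1 * \<iota> l1 (\<psi> k1 c1)) # t" k c] less[of "[]" "(l1, e1) # t" k c] w y
        by (simp add: mult.assoc distrib_left)
    qed
  qed
qed

lemma G_balanced: "G ((i, a * \<iota> i b) # s) ((j, c) # v) = G ((i, a) # s) ((j, \<iota> j b * c) # v)"
proof (induction "length s" arbitrary: s i a b rule: less_induct)
  case less
  consider "i < j" | "i = j" | "j < i" by fastforce
  then show ?case
  proof cases
    case 1
    then show ?thesis using G_stack_balanced[of "[]" j b c i a s v] by (simp add: G_push)
  next
    case 2
    then show ?thesis by (simp add: G_same mult.assoc)
  next
    case 3
    then have n: "\<not> i < j" "i \<noteq> j" by auto
    show ?thesis
    proof (cases s)
      case Nil
      then show ?thesis using n G_stack_left[of "[]" j b c v] by (simp add: \<theta>_right mult.assoc)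
    next
      case (Cons x t)
      obtain l e where x: "x = (l, e)" by fastforce
      show ?thesis
        using n Cons x less[of t l "e * \<iota> l (\<psi> i a)" b] G_stack_left[of "[]" j b c v]
        by (simp add: \<theta>_right \<iota>_\<psi>_right \<kappa>_\<psi>_right \<iota>_mult \<kappa>_mult mult.assoc left_diff_distrib right_diff_distrib)
    qed
  qed
qed

lemma F_linear:
  "F (u @ (i, scal \<alpha> * a + scal \<beta> * a') # v) = scal \<alpha> * F (u @ (i, a) # v) + scal \<beta> * F (u @ (i, a') # v)"
proof (rule G_prefix[where P = "\<lambda>x y z. x = scal \<alpha> * y + scal \<beta> * z"])
  show "G s ((i, scal \<alpha> * a + scal \<beta> * a') # v) = scal \<alpha> * G s ((i, a) # v) + scal \<beta> * G s ((i, a') # v)" for s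
    using G_stack_linear[of "[]" i \<alpha> _ \<beta>]
    by (intro G_read[where P = "\<lambda>x y z. x = scal \<alpha> * y + scal \<beta> * z"])
      (simp_all add: distrib_left scal_left_comm)
qed (simp_all add: distrib_left scal_left_comm)

lemma F_add: "F (u @ (i, a + a') # v) = F (u @ (i, a) # v) + F (u @ (i, a') # v)"
  using F_linear[of u i 1 a 1 a' v] by simp

lemma F_scal: "F (u @ (i, scal \<alpha> * a) # v) = scal \<alpha> * F (u @ (i, a) # v)"
  using F_linear[of u i \<alpha> a 0 a v] by simp

text \<open>It also allows \<psi>(b) of a peak to be multiplied into either neighbour:
  \<open>G\<close> uses the left one, the rule for the monotone product the right one.\<close>

lemma F_balanced: "F (u @ (i, a * \<iota> i b) # (j, c) # v) = F (u @ (i, a) # (j, \<iota> j b * c) # v)"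
proof (rule G_prefix[where P = "\<lambda>x y z. x = y"])
  show "G s ((i, a * \<iota> i b) # (j, c) # v) = G s ((i, a) # (j, \<iota> j b * c) # v)" for s
    by (rule G_read[where P = "\<lambda>x y z. x = y"]) (simp_all add: G_balanced flip: mult.assoc)
qed simp_all

text \<open>Unreduced words are evaluated consistently with the multiplication of the single
  algebras, so a product of words may be treated as their concatenation.\<close>

lemma F_merge: "F (u @ (i, a) # (i, b) # v) = F (u @ (i, a * b) # v)"
proof (rule G_prefix[where P = "\<lambda>x y z. x = y"])
  show "G s ((i, a) # (i, b) # v) = G s ((i, a * b) # v)" for s
    by (rule G_read[where P = "\<lambda>x y z. x = y"]) (simp_all add: G_same mult.assoc)
qed simp_all

lemma F_left: "F ((i, \<iota> i b * a) # v) = \<kappa> b * F ((i, a) # v)"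
  using G_stack_left[of "[]"] by simp

lemma F_right: "F (u @ [(i, a * \<iota> i b)]) = F (u @ [(i, a)]) * \<kappa> b"
proof (rule G_prefix[where P = "\<lambda>x y z. x = y * \<kappa> b"])
  show "G s [(i, a * \<iota> i b)] = G s [(i, a)] * \<kappa> b" for s
    by (rule G_read[where P = "\<lambda>x y z. x = y * \<kappa> b"])
      (simp_all add: distrib_right \<theta>_right flip: mult.assoc)
qed (simp_all add: distrib_right mult.assoc)

lemma F_descent: "j < i \<Longrightarrow> F ((i, a) # (j, c) # v) = \<theta> i a * F ((j, c) # v)"
  by (auto dest: less_asym)

lemma F_ascent: "j < i \<Longrightarrow> F (u @ [(j, c), (i, a)]) = F (u @ [(j, c)]) * \<theta> i a"
proof (rule G_prefix[where P = "\<lambda>x y z. x = y * \<theta> i a"])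
  assume "j < i"
  then show "G s [(j, c), (i, a)] = G s [(j, c)] * \<theta> i a" for s
    by (intro G_read[where P = "\<lambda>x y z. x = y * \<theta> i a"]) (simp_all add: distrib_right mult.assoc G_push)
qed (simp_all add: distrib_right mult.assoc)

text \<open>\<open>G\<close> resolves peaks in its own order; this is rule (3) at an arbitrary peak.
  The value of the suffix after the peak is a constant of the transferred relation, which is then
  pulled through the letter before the peak and the prefix.\<close>

lemma F_peak:
  assumes "i < k" "j < k"
  shows "F (u @ (i, a) # (k, b) # (j, c) # v)
    = F (u @ (i, a * \<iota> i (\<psi> k b)) # (j, c) # v) + F (u @ [(i, a)]) * (\<theta> k b - \<kappa> (\<psi> k b)) * F ((j, c) # v)"
proof -
  have n: "\<not> k < j" "k \<noteq> j" using assms(2) by auto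
  let ?P = "\<lambda>x y z. x = y + z * (\<theta> k b - \<kappa> (\<psi> k b)) * F ((j, c) # v)"
  show ?thesis
  proof (rule G_prefix[where P = ?P])
    show "G s ((i, a) # (k, b) # (j, c) # v) = G s ((i, a * \<iota> i (\<psi> k b)) # (j, c) # v)
       + G s [(i, a)] * (\<theta> k b - \<kappa> (\<psi> k b)) * F ((j, c) # v)" for s
      by (rule G_read[where P = ?P])
        (use assms n in \<open>simp_all add: G_push distrib_left distrib_right flip: mult.assoc\<close>)
  qed (simp_all add: distrib_left distrib_right mult.assoc)
qed

end

section \<open>Adjoints of words and reduction to descending words\<close>

definition word_star :: "('i \<times> 'a::cstar) list \<Rightarrow> ('i \<times> 'a) list" where
  "word_star w = rev (map (\<lambda>(i, a). (i, star a)) w)"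

lemma word_star_simps [simp]:
  "word_star [] = []" "word_star ((i, a) # w) = word_star w @ [(i, star a)]"
  "word_star (u @ v) = word_star v @ word_star u" "word_star (word_star w) = w"
  by (simp_all add: word_star_def rev_map case_prod_beta comp_def)

definition descending :: "('i::linorder \<times> 'a) list \<Rightarrow> bool" where
  "descending w \<longleftrightarrow> sorted_wrt (\<lambda>x y. fst x > fst y) w"

lemma sum_list_map_concat: "sum_list (map f (concat ls)) = (\<Sum>l\<leftarrow>ls. sum_list (map f l))"
  by (induction ls) auto

text \<open>Look at the last pair of neighbours whose indices do not decrease. Behind it the word
  descends, so the pair is a repetition, an ascent at the end of the word, or the left flank of a
  peak.\<close>

lemma word_cases:
  fixes w :: "('i::linorder \<times> 'a) list"
  obtains "descending w"
  | u i a b v where "w = u @ (i, a) # (i, b) # v"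
  | u i a k b where "w = u @ [(i, a), (k, b)]" "i < k"
  | u i a k b j c v where "w = u @ (i, a) # (k, b) # (j, c) # v" "i < k" "j < k"
proof -
  have "descending w \<or> (\<exists>u i a b v. w = u @ (i, a) # (i, b) # v)
    \<or> (\<exists>u i a k b. w = u @ [(i, a), (k, b)] \<and> i < k)
    \<or> (\<exists>u i a k b j c v. w = u @ (i, a) # (k, b) # (j, c) # v \<and> i < k \<and> j < k)"
  proof (induction w)
    case Nil
    show ?case by (simp add: descending_def)
  next
    case (Cons x w)
    show ?case
    proof (cases "descending w")
      case False
      with Cons show ?thesis by (metis append_Cons)
    next
      case True
      obtain i a where x: "x = (i, a)" by fastforce
      show ?thesis
      proof (cases w)
        case Nil
        then show ?thesis by (simp add: descending_def)
      next
        case w: (Cons y v)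
        obtain k b where y: "y = (k, b)" by fastforce
        consider "k < i" | "k = i" | "i < k" by fastforce
        then show ?thesis
        proof cases
          case 1
          then have "descending (x # w)" using True w x y by (auto simp: descending_def)
          then show ?thesis by blast
        next
          case 2
          then have "x # w = [] @ (i, a) # (i, b) # v" using w x y by simp
          then show ?thesis by blast
        next
          case 3
          show ?thesis
          proof (cases v)
            case Nil
            then have "x # w = [] @ [(i, a), (k, b)]" using w x y by simp
            then show ?thesis using 3 by blast
          next
            case (Cons z v')
            obtain j c where z: "z = (j, c)" by fastforce
            have "x # w = [] @ (i, a) # (k, b) # (j, c) # v'" using w x y z Cons by simp
            moreover have "j < k" using True w y z Cons by (simp add: descending_def)
            ultimately show ?thesis using 3 by blast
          qed
        qed
      qed
    qed
  qed
  then show ?thesis using that by blast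
qed

lemma descending_Cons2:
  "descending ((i, a) # (j, c) # v) \<longleftrightarrow> j < i \<and> descending ((j, c) # v)"
  by (auto simp: descending_def)

context monotone_data
begin

text \<open>The adjoint exchanges rules (1) and (2) and maps rule (3) to itself, up to moving
  \<psi>(b) to the other neighbour of the peak. The maps \<theta> and \<psi> are hermitian because
  they are positive.\<close>

lemma F_star: "F (word_star w) = star (F w)"
proof (induction "length w" arbitrary: w rule: less_induct)
  case less
  show ?case
  proof (cases w rule: word_cases)
    case 1
    show ?thesis
    proof (cases w)
      case Nil
      then show ?thesis by simp
    next
      case w: (Cons x v)
      obtain i a where x: "x = (i, a)" by fastforce
      show ?thesis
      proof (cases v)
        case Nil
        then show ?thesis using w x by (simp add: \<theta>_star)
      next
        case (Cons y v')
        obtain j c where y: "y = (j, c)" by fastforce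
        have "j < i" using 1 w x y Cons by (simp add: descending_Cons2)
        then show ?thesis
          using less[of v] F_ascent[of j i "word_star v'" "star c" "star a"] F_descent[of j i a c v'] w x y Cons
          by (simp add: star_mult \<theta>_star del: G.simps)
      qed
    qed
  next
    case (2 u i a b v)
    have "F (word_star w) = F (word_star (u @ (i, a * b) # v))"
      using F_merge[of "word_star v" i "star b" "star a" "word_star u"] 2 by (simp add: star_mult del: G.simps)
    also have "\<dots> = star (F (u @ (i, a * b) # v))" using 2 by (intro less) simp
    also have "\<dots> = star (F w)" using 2 F_merge by simp
    finally show ?thesis .
  next
    case (3 u i a k b)
    have "star (F w) = star (\<theta> k b) * star (F (u @ [(i, a)]))" using 3 by (simp add: F_ascent star_mult del: G.simps)
    also have "star (F (u @ [(i, a)])) = F (word_star (u @ [(i, a)]))" using 3 by (intro less[symmetric]) simp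
    finally show ?thesis using 3 F_descent[of i k "star b" "star a" "word_star u"] by (simp add: \<theta>_star del: G.simps)
  next
    case (4 u i a k b j c v)
    have l: "F (word_star (u @ (i, a * \<iota> i (\<psi> k b)) # (j, c) # v)) = star (F (u @ (i, a * \<iota> i (\<psi> k b)) # (j, c) # v))"
      "F (word_star (u @ [(i, a)])) = star (F (u @ [(i, a)]))" "F (word_star ((j, c) # v)) = star (F ((j, c) # v))"
      using 4 by (intro less; simp)+
    have "F (word_star w) = F (word_star v @ (j, star c) # (k, star b) # (i, star a) # word_star u)"
      using 4 by simp
    also have "\<dots> = F (word_star v @ (j, star c * \<iota> j (\<psi> k (star b))) # (i, star a) # word_star u)
       + F (word_star v @ [(j, star c)]) * (\<theta> k (star b) - \<kappa> (\<psi> k (star b))) * F ((i, star a) # word_star u)"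
      by (rule F_peak) (use 4 in simp_all)
    also have "F (word_star v @ (j, star c * \<iota> j (\<psi> k (star b))) # (i, star a) # word_star u)
      = F (word_star (u @ (i, a * \<iota> i (\<psi> k b)) # (j, c) # v))"
      unfolding F_balanced by (simp add: star_mult \<psi>_star \<iota>_star[symmetric] del: G.simps)
    also have "F (word_star v @ [(j, star c)]) = F (word_star ((j, c) # v))" by simp
    also have "F ((i, star a) # word_star u) = F (word_star (u @ [(i, a)]))" by simp
    finally show ?thesis unfolding l
      using 4 F_peak[of i k j u a b c v]
      by (simp add: star_add star_mult star_diff \<theta>_star \<psi>_star \<kappa>_star[symmetric] mult.assoc del: G.simps)
  qed
qed

text \<open>The coefficients stand on the right and are the same for every u, so the combination can
  replace w in the right slot of every kernel entry.\<close>

lemma reduce_to_descending: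
  "\<exists>L. (\<forall>(w', d)\<in>set L. descending w') \<and> (\<forall>u. F (u @ w) = (\<Sum>(w', d)\<leftarrow>L. F (u @ w') * d))"
proof (induction "length w" arbitrary: w rule: less_induct)
  case less
  show ?case
  proof (cases w rule: word_cases)
    case 1
    then show ?thesis by (intro exI[of _ "[(w, 1)]"]) simp
  next
    case (2 u i a b v)
    have "length (u @ (i, a * b) # v) < length w" using 2 by simp
    from less[OF this] show ?thesis using 2 F_merge[of "_ @ u" i a b v] by simp
  next
    case (3 u i a k b)
    have "length (u @ [(i, a)]) < length w" using 3 by simp
    from less[OF this] obtain L where L: "\<forall>(w', d)\<in>set L. descending w'"
      "\<And>x. F (x @ u @ [(i, a)]) = (\<Sum>(w', d)\<leftarrow>L. F (x @ w') * d)" by blast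
    let ?M = "map (\<lambda>(w', d). (w', d * \<theta> k b)) L"
    have "F (x @ w) = (\<Sum>(w', d)\<leftarrow>?M. F (x @ w') * d)" for x
      using F_ascent[of i k "x @ u" a b] 3 L(2)[of x]
      by (simp add: split_def comp_def mult.assoc[symmetric] sum_list_mult_const del: G.simps)
    moreover have "\<forall>(w', d)\<in>set ?M. descending w'" using L(1) by auto
    ultimately show ?thesis by blast
  next
    case (4 u i a k b j c v)
    have "length (u @ (i, a * \<iota> i (\<psi> k b)) # (j, c) # v) < length w" "length (u @ [(i, a)]) < length w" using 4 by simp_all
    from less[OF this(1)] less[OF this(2)] obtain L M where L: "\<forall>(w', d)\<in>set L. descending w'"
      "\<And>x. F (x @ u @ (i, a * \<iota> i (\<psi> k b)) # (j, c) # v) = (\<Sum>(w', d)\<leftarrow>L. F (x @ w') * d)"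
      and M: "\<forall>(w', d)\<in>set M. descending w'"
      "\<And>x. F (x @ u @ [(i, a)]) = (\<Sum>(w', d)\<leftarrow>M. F (x @ w') * d)" by blast
    define e where "e = (\<theta> k b - \<kappa> (\<psi> k b)) * F ((j, c) # v)"
    let ?M = "L @ map (\<lambda>(w', d). (w', d * e)) M"
    have "F (x @ w) = (\<Sum>(w', d)\<leftarrow>?M. F (x @ w') * d)" for x
    proof -
      have "F (x @ w) = F (x @ u @ (i, a * \<iota> i (\<psi> k b)) # (j, c) # v) + F (x @ u @ [(i, a)]) * e"
        using F_peak[of i k j "x @ u" a b c v] 4 by (simp add: e_def mult.assoc del: G.simps)
      then show ?thesis unfolding L M
        by (simp add: split_def comp_def mult.assoc[symmetric] sum_list_mult_const del: G.simps)
    qed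
    moreover have "\<forall>(w', d)\<in>set ?M. descending w'" using L(1) M(1) by auto
    ultimately show ?thesis by blast
  qed
qed

section \<open>Positivity of the kernel on words\<close>

definition low :: "'i \<Rightarrow> ('i \<times> 'a) list \<Rightarrow> bool" where
  "low p w \<longleftrightarrow> (\<forall>x\<in>set w. fst x < p)"

text \<open>The letter \<iota>(\<psi>(c)) stays in the algebra of index p instead of being
  multiplied into a neighbour. In this form rule (3) remains true when u or v is empty, by rules (1)
  and (2) and the values of single letters.\<close>

lemma F_low_peak:
  assumes "low p u" "low p v"
  shows "F (u @ (p, c) # v) = F (u @ (p, \<iota> p (\<psi> p c)) # v) + F u * (\<theta> p c - \<kappa> (\<psi> p c)) * F v"
proof (cases u rule: rev_cases)
  case Nil
  show ?thesis
  proof (cases v)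
    case Nil
    then show ?thesis using \<open>u = []\<close> by (simp add: \<theta>_\<iota>)
  next
    case (Cons y v')
    then show ?thesis using \<open>u = []\<close> assms
      by (cases y) (simp add: low_def F_descent \<theta>_\<iota> algebra_simps del: G.simps(3-))
  qed
next
  case u: (snoc u' x)
  obtain i a where x: "x = (i, a)" by fastforce
  show ?thesis
  proof (cases v)
    case Nil
    then show ?thesis using u x assms
      by (simp add: low_def F_ascent \<theta>_\<iota> algebra_simps del: G.simps(3-))
  next
    case (Cons y v')
    obtain j c' where y: "y = (j, c')" by fastforce
    have "i < p" "j < p" using assms u x Cons y by (auto simp: low_def)
    then show ?thesis
      using F_peak[of i p j u' a c c' v'] F_peak[of i p j u' a "\<iota> p (\<psi> p c)" c' v'] u x Cons y
      by (simp add: \<iota>_\<psi>_\<iota> \<kappa>_\<psi>_\<iota> \<theta>_\<iota> del: G.simps)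
  qed
qed

text \<open>The unit of one algebra is not a unit of the free product, but \<open>F\<close> does not
  see it between words of lower indices: \<theta> and \<psi> both send it to 1, so the correction
  term of rule (3) vanishes.\<close>

lemma F_low_unit:
  assumes "low p u" "low p v"
  shows "F (u @ (p, 1) # v) = F (u @ v)"
proof (cases u rule: rev_cases)
  case Nil
  show ?thesis
  proof (cases v)
    case Nil
    then show ?thesis using \<open>u = []\<close> by (simp add: \<theta>_one)
  next
    case (Cons y v')
    then show ?thesis using \<open>u = []\<close> assms
      by (cases y) (simp add: low_def F_descent \<theta>_one del: G.simps(3-))
  qed
next
  case u: (snoc u' x)
  obtain i a where x: "x = (i, a)" by fastforce
  show ?thesis
  proof (cases v)
    case Nil
    then show ?thesis using u x assms
      by (simp add: low_def F_ascent \<theta>_one del: G.simps(3-))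
  next
    case (Cons y v')
    obtain j c' where y: "y = (j, c')" by fastforce
    have "i < p" "j < p" using assms u x Cons y by (auto simp: low_def)
    then show ?thesis
      using F_peak[of i p j u' a 1 c' v'] u x Cons y
      by (simp add: \<psi>_one \<theta>_one \<kappa>_one \<iota>_one del: G.simps)
  qed
qed

lemma F_sum_letter:
  "F (u @ (i, \<Sum>k<(N::nat). f k) # v) = (\<Sum>k<N. F (u @ (i, f k) # v))"
proof (induction N)
  case 0
  show ?case using F_scal[of u i 0 1 v] by simp
next
  case (Suc N)
  then show ?case by (simp add: F_add del: G.simps)
qed

text \<open>The left action of B on the right module of the kernel, where the pair (w, d) stands for
  w d. On the empty word b can act only through \<kappa>, on the coefficient.\<close>

definition lact :: "'b \<Rightarrow> ('i \<times> 'a) list \<times> 'd \<Rightarrow> ('i \<times> 'a) list \<times> 'd" where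
  "lact b = (\<lambda>(w, d). case w of [] \<Rightarrow> ([], \<kappa> b * d) | (i, a) # v \<Rightarrow> ((i, \<iota> i b * a) # v, d))"

lemma F_lact_right:
  "F (u @ (p, c * \<iota> p b) # w) * d = F (u @ (p, c) # fst (lact b (w, d))) * snd (lact b (w, d))"
  by (cases w) (auto simp: lact_def F_right F_balanced mult.assoc split: prod.split simp del: G.simps)

lemma F_lact: "F (fst (lact b (w, d))) * snd (lact b (w, d)) = \<kappa> b * F w * d"
  by (cases w) (auto simp: lact_def F_left mult.assoc split: prod.split simp del: G.simps(3-))

lemma F_lact_left:
  "star d * F (word_star w @ (p, star (\<iota> p b) * c) # v)
     = star (snd (lact b (w, d))) * F (word_star (fst (lact b (w, d))) @ (p, c) # v)"
proof -
  have "star d * F (word_star w @ (p, star (\<iota> p b) * c) # v)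
     = star (F (word_star v @ (p, star c * \<iota> p b) # w) * d)"
    using F_star[of "word_star w @ (p, star (\<iota> p b) * c) # v"] by (simp add: star_mult del: G.simps)
  also have "\<dots> = star (F (word_star v @ (p, star c) # fst (lact b (w, d))) * snd (lact b (w, d)))"
    by (simp only: F_lact_right)
  also have "\<dots> = star (snd (lact b (w, d))) * F (word_star (fst (lact b (w, d))) @ (p, c) # v)"
    using F_star[of "word_star v @ (p, star c) # fst (lact b (w, d))"] by (simp add: star_mult del: G.simps)
  finally show ?thesis .
qed

text \<open>The form of the kernel F(w^* w') at the module element \<Sum> w_m d_m.\<close>

definition Q :: "nat \<Rightarrow> (nat \<Rightarrow> ('i \<times> 'a) list) \<Rightarrow> (nat \<Rightarrow> 'd) \<Rightarrow> 'd" where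
  "Q N w d = (\<Sum>m<N. \<Sum>n<N. star (d m) * F (word_star (w m) @ w n) * d n)"

text \<open>Schur complement of the entry of the empty word.\<close>

lemma Q_schur:
  fixes w d N
  defines "f \<equiv> (\<Sum>n<N. F (w n) * d n)"
  shows "Q (Suc N) (w(N := [])) (d(N := - f)) = Q N w d - star f * f"
proof -
  have *: "(\<Sum>n<N. F (w n) * d n) = f" "(\<Sum>m<N. star (d m) * star (F (w m))) = star f"
    by (simp_all add: f_def star_sum star_mult)
  have "Q (Suc N) (w(N := [])) (d(N := - f))
     = (\<Sum>m<N. \<Sum>n<N. star (d m) * F (word_star (w m) @ w n) * d n)
       + (\<Sum>m<N. star (d m) * star (F (w m))) * (- f)
       + (star (- f) * (\<Sum>n<N. F (w n) * d n) + star (- f) * (- f))"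
    by (simp add: Q_def sum.distrib F_star sum_distrib_left sum_distrib_right mult.assoc sum_negf sum_subtractf star_minus del: G.simps(2-))
  then show ?thesis unfolding * by (simp add: Q_def star_minus)
qed

text \<open>N, w and d are quantified inside the induction because the step applies the hypothesis
  to other families, with one more entry for the empty word.\<close>

lemma Q_descending:
  assumes "finite J"
  shows "\<forall>(N::nat) w d. (\<forall>m<N. descending (w m) \<and> fst ` set (w m) \<subseteq> J) \<longrightarrow> nonneg (Q N w d)"
  using assms
proof (induction J rule: finite_linorder_max_induct)
  case empty
  show ?case
  proof (intro allI impI)
    fix N :: nat and w :: "nat \<Rightarrow> ('i \<times> 'a) list" and d :: "nat \<Rightarrow> 'd" assume "\<forall>m<N. descending (w m) \<and> fst ` set (w m) \<subseteq> ({} :: 'i set)"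
    then have "Q N w d = (\<Sum>m<N. \<Sum>n<N. star (d m) * d n)" by (simp add: Q_def)
    also have "\<dots> = star (\<Sum>m<N. d m) * (\<Sum>m<N. d m)" by (simp add: star_sum sum_product)
    finally show "nonneg (Q N w d)" by (simp add: nonneg_star_mult)
  qed
next
  case (insert p J)
  show ?case
  proof (intro allI impI)
    fix N :: nat and w :: "nat \<Rightarrow> ('i \<times> 'a) list" and d :: "nat \<Rightarrow> 'd" assume w: "\<forall>m<N. descending (w m) \<and> fst ` set (w m) \<subseteq> insert p J"
    define st where "st m \<longleftrightarrow> w m \<noteq> [] \<and> fst (hd (w m)) = p" for m
    define a where "a m = (if st m then snd (hd (w m)) else 1)" for m
    define x where "x m = (if st m then tl (w m) else w m)" for m
    have x: "descending (x m)" "fst ` set (x m) \<subseteq> J" if "m < N" for m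
    proof -
      have *: "descending (w m)" "fst ` set (w m) \<subseteq> insert p J" using w that by auto
      show "descending (x m)" using * by (cases "w m") (auto simp: x_def descending_def)
      show "fst ` set (x m) \<subseteq> J"
      proof (cases "w m")
        case Nil
        then show ?thesis by (simp add: x_def)
      next
        case (Cons y v)
        show ?thesis
        proof (cases "fst y = p")
          case True
          then have "p \<notin> fst ` set v" using * Cons by (auto simp: descending_def)
          moreover have "x m = v" "fst ` set v \<subseteq> insert p J" using * Cons True by (simp_all add: x_def st_def)
          ultimately show ?thesis by blast
        next
          case False
          then have "fst y \<in> J" using * Cons by auto
          then have "fst y < p" using insert by auto
          then have "p \<notin> fst ` set (w m)" using * Cons by (auto simp: descending_def)
          moreover have "x m = w m" using Cons False by (simp add: x_def st_def)
          ultimately show ?thesis using *(2) by auto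
        qed
      qed
    qed
    have low: "low p (x m)" "low p (word_star (x m))" if "m < N" for m
      using x(2)[OF that] insert by (auto simp: low_def word_star_def)
    have wst: "w m = (p, a m) # x m" if "st m" for m
      using that by (cases "w m") (auto simp: st_def a_def x_def)
    \<comment> \<open>Where both words begin with index p the two letters merge; where neither does,
      a unit of index p is inserted between them.\<close>
    have key: "F (word_star (w m) @ w n) = F (word_star (x m) @ (p, star (a m) * a n) # x n)"
      if "m < N" "n < N" for m n
    proof -
      consider "st m" "st n" | "st m" "\<not> st n" | "\<not> st m" "st n" | "\<not> st m" "\<not> st n" by blast
      then show ?thesis
      proof cases
        case 1
        then show ?thesis by (simp add: wst F_merge del: G.simps)
      next
        case 2
        then have "a n = 1" "x n = w n" by (simp_all add: a_def x_def)
        then show ?thesis by (simp add: wst[OF 2(1)] del: G.simps)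
      next
        case 3
        then have "a m = 1" "x m = w m" by (simp_all add: a_def x_def)
        then show ?thesis by (simp add: wst[OF 3(2)] del: G.simps)
      next
        case 4
        then have "star (a m) * a n = 1" by (simp add: a_def)
        then show ?thesis using 4 F_low_unit[OF low(2)[OF that(1)] low(1)[OF that(2)]]
          by (simp add: x_def del: G.simps)
      qed
    qed
    have "star (\<psi> p (star (a m) * a n)) = \<psi> p (star (a n) * a m)" for m n
      by (simp add: \<psi>_star star_mult)
    moreover have "nonneg (\<Sum>m<N. \<Sum>n<N. star (\<xi> m) * \<psi> p (star (a m) * a n) * \<xi> n)" for \<xi>
      by (rule \<psi>_pos)
    ultimately obtain Y where Y: "\<And>m n. m < N \<Longrightarrow> n < N \<Longrightarrow>
        \<psi> p (star (a m) * a n) = (\<Sum>k<N. star (Y k m) * Y k n)"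
      using weakly_positive_factorization[of N "\<lambda>m n. \<psi> p (star (a m) * a n)"] by blast
    \<comment> \<open>\<open>V k m\<close> stands for Y_km x_m d_m, \<open>e m\<close> is the value
      F(x_m) d_m, and \<open>f k\<close> is the value of \<Sum> Y_kn x_n d_n, whose hermitian square
      is subtracted in the Schur complement.\<close>
    define V where "V k m = lact (Y k m) (x m, d m)" for k m
    define e where "e m = F (x m) * d m" for m
    define f where "f k = (\<Sum>n<N. F (fst (V k n)) * snd (V k n))" for k
    have f: "f k = (\<Sum>n<N. \<kappa> (Y k n) * e n)" for k
      by (simp add: f_def V_def F_lact e_def mult.assoc)
    have lowV: "low p (fst (V k m))" "low p (word_star (fst (V k m)))" if "m < N" for k m
      using low[OF that] by (cases "x m"; auto simp: V_def lact_def low_def word_star_def)+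
    have summand: "star (d m) * F (word_star (w m) @ w n) * d n
       = (\<Sum>k<N. star (snd (V k m)) * F (word_star (fst (V k m)) @ fst (V k n)) * snd (V k n))
         + (star (e m) * \<theta> p (star (a m) * a n) * e n
            - (\<Sum>k<N. star (\<kappa> (Y k m) * e m) * (\<kappa> (Y k n) * e n)))"
      if mn: "m < N" "n < N" for m n
    proof -
      let ?c = "star (a m) * a n"
      have "F (word_star (x m) @ (p, \<iota> p (\<psi> p ?c)) # x n)
        = (\<Sum>k<N. F (word_star (x m) @ (p, star (\<iota> p (Y k m)) * \<iota> p (Y k n)) # x n))"
        unfolding Y[OF mn] by (simp add: \<iota>_sum \<iota>_mult \<iota>_star F_sum_letter del: G.simps)
      also have "star (d m) * \<dots> * d n
        = (\<Sum>k<N. star (d m) * F (word_star (x m) @ (p, star (\<iota> p (Y k m)) * \<iota> p (Y k n)) # x n) * d n)"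
        by (simp only: sum_distrib_left sum_distrib_right)
      also have "\<dots> = (\<Sum>k<N. star (snd (V k m)) * F (word_star (fst (V k m)) @ fst (V k n)) * snd (V k n))"
      proof (rule sum.cong[OF refl])
        fix k
        \<comment> \<open>The left factor of Y^* Y is absorbed by the left word and the right factor
          by the right word. The unit of index p that remains between them is deleted, because the
          action of B keeps all indices below p.\<close>
        have "star (d m) * F (word_star (x m) @ (p, star (\<iota> p (Y k m)) * \<iota> p (Y k n)) # x n) * d n
          = star (snd (V k m)) * F (word_star (fst (V k m)) @ (p, 1 * \<iota> p (Y k n)) # x n) * d n"
          unfolding F_lact_left V_def by simp
        also have "\<dots> = star (snd (V k m)) * (F (word_star (fst (V k m)) @ (p, 1) # fst (V k n)) * snd (V k n))"
          unfolding mult.assoc F_lact_right unfolding V_def by simp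
        finally show "star (d m) * F (word_star (x m) @ (p, star (\<iota> p (Y k m)) * \<iota> p (Y k n)) # x n) * d n
          = star (snd (V k m)) * F (word_star (fst (V k m)) @ fst (V k n)) * snd (V k n)"
          using F_low_unit[OF lowV(2)[OF mn(1)] lowV(1)[OF mn(2)]] by (simp add: mult.assoc del: G.simps)
      qed
      finally have 1: "star (d m) * F (word_star (x m) @ (p, \<iota> p (\<psi> p ?c)) # x n) * d n
        = (\<Sum>k<N. star (snd (V k m)) * F (word_star (fst (V k m)) @ fst (V k n)) * snd (V k n))" .
      have 2: "star (e m) * \<kappa> (\<psi> p ?c) * e n = (\<Sum>k<N. star (\<kappa> (Y k m) * e m) * (\<kappa> (Y k n) * e n))"
        unfolding Y[OF mn]
        by (simp add: \<kappa>_sum \<kappa>_mult \<kappa>_star star_mult sum_distrib_left sum_distrib_right mult.assoc)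
      have "star (d m) * F (word_star (w m) @ w n) * d n
        = star (d m) * F (word_star (x m) @ (p, \<iota> p (\<psi> p ?c)) # x n) * d n
          + star (e m) * (\<theta> p ?c - \<kappa> (\<psi> p ?c)) * e n"
        unfolding key[OF mn] F_low_peak[OF low(2)[OF mn(1)] low(1)[OF mn(2)], of ?c]
        by (simp add: F_star e_def star_mult distrib_left distrib_right mult.assoc del: G.simps)
      then show ?thesis unfolding 1 2[symmetric] by (simp add: algebra_simps)
    qed
    have swap: "(\<Sum>m<N. \<Sum>n<N. \<Sum>k<N. h m n k) = (\<Sum>k<N. \<Sum>m<N. \<Sum>n<N. h m n k)" for h :: "nat \<Rightarrow> nat \<Rightarrow> nat \<Rightarrow> 'd"
    proof -
      have "(\<Sum>m<N. \<Sum>n<N. \<Sum>k<N. h m n k) = (\<Sum>m<N. \<Sum>k<N. \<Sum>n<N. h m n k)"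
        by (rule sum.cong[OF refl]) (rule sum.swap)
      also have "\<dots> = (\<Sum>k<N. \<Sum>m<N. \<Sum>n<N. h m n k)" by (rule sum.swap)
      finally show ?thesis .
    qed
    let ?A = "\<lambda>m n k. star (snd (V k m)) * F (word_star (fst (V k m)) @ fst (V k n)) * snd (V k n)"
    let ?C = "\<lambda>m n k. star (\<kappa> (Y k m) * e m) * (\<kappa> (Y k n) * e n)"
    have "Q N w d = (\<Sum>m<N. \<Sum>n<N. (\<Sum>k<N. ?A m n k)
        + (star (e m) * \<theta> p (star (a m) * a n) * e n - (\<Sum>k<N. ?C m n k)))"
      unfolding Q_def by (intro sum.cong refl) (simp only: summand lessThan_iff)
    also have "\<dots> = (\<Sum>m<N. \<Sum>n<N. \<Sum>k<N. ?A m n k)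
        + ((\<Sum>m<N. \<Sum>n<N. star (e m) * \<theta> p (star (a m) * a n) * e n) - (\<Sum>m<N. \<Sum>n<N. \<Sum>k<N. ?C m n k))"
      by (simp only: sum.distrib sum_subtractf)
    also have "\<dots> = (\<Sum>k<N. Q N (\<lambda>m. fst (V k m)) (\<lambda>m. snd (V k m)))
        + ((\<Sum>m<N. \<Sum>n<N. star (e m) * \<theta> p (star (a m) * a n) * e n)
        - (\<Sum>k<N. \<Sum>m<N. \<Sum>n<N. star (\<kappa> (Y k m) * e m) * (\<kappa> (Y k n) * e n)))"
      unfolding swap[of ?A] swap[of ?C] Q_def by (rule refl)
    also have "(\<Sum>k<N. \<Sum>m<N. \<Sum>n<N. star (\<kappa> (Y k m) * e m) * (\<kappa> (Y k n) * e n)) = (\<Sum>k<N. star (f k) * f k)"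
      by (simp add: f star_sum sum_product)
    finally have eq: "Q N w d = (\<Sum>k<N. Q N (\<lambda>m. fst (V k m)) (\<lambda>m. snd (V k m)) - star (f k) * f k)
        + (\<Sum>m<N. \<Sum>n<N. star (e m) * \<theta> p (star (a m) * a n) * e n)"
      by (simp add: sum_subtractf)
    have "nonneg (Q N (\<lambda>m. fst (V k m)) (\<lambda>m. snd (V k m)) - star (f k) * f k)" for k
    proof -
      have Vd: "descending (fst (V k m)) \<and> fst ` set (fst (V k m)) \<subseteq> J" if "m < N" for m
        using x[OF that] by (cases "x m") (auto simp: V_def lact_def descending_def image_subset_iff)
      \<comment> \<open>Entry N is the empty word with coefficient - \<open>f k\<close>, which
        completes the square.\<close>
      have "nonneg (Q (Suc N) ((\<lambda>m. fst (V k m))(N := [])) ((\<lambda>m. snd (V k m))(N := - f k)))"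
      proof (rule insert.IH[rule_format])
        fix m assume "m < Suc N"
        then show "descending (((\<lambda>m. fst (V k m))(N := [])) m) \<and> fst ` set (((\<lambda>m. fst (V k m))(N := [])) m) \<subseteq> J"
          using Vd[of m] by (cases "m = N") (simp_all add: descending_def less_Suc_eq)
      qed
      then show ?thesis unfolding f_def by (simp only: Q_schur)
    qed
    then show "nonneg (Q N w d)" unfolding eq by (intro nonneg_add nonneg_sum \<theta>_pos)
  qed
qed

text \<open>Words in the right slot are rewritten directly. The kernel is hermitian, so taking
  adjoints moves the remaining words to the right slot, where the same rewriting applies.\<close>

theorem Q_nonneg: "nonneg (Q N w d)"
proof -
  obtain R where R: "\<And>w. \<forall>(w', d)\<in>set (R w). descending w'"
    "\<And>u w. F (u @ w) = (\<Sum>(w', d)\<leftarrow>R w. F (u @ w') * d)"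
    using reduce_to_descending by metis
  define L where "L = concat (map (\<lambda>m. map (\<lambda>(w', e). (w', e * d m)) (R (w m))) [0..<N])"
  define T where "T u = (\<Sum>(w', e)\<leftarrow>L. F (u @ w') * e)" for u
  have T: "(\<Sum>m<N. F (u @ w m) * d m) = T u" for u
  proof -
    have "T u = (\<Sum>m\<leftarrow>[0..<N]. \<Sum>(w', e)\<leftarrow>R (w m). F (u @ w') * e * d m)"
      by (simp add: T_def L_def sum_list_map_concat comp_def split_def mult.assoc)
    also have "\<dots> = (\<Sum>m\<leftarrow>[0..<N]. F (u @ w m) * d m)"
      by (subst R(2)) (simp add: sum_list_mult_const[symmetric] split_def)
    finally show ?thesis by (simp add: interv_sum_list_conv_sum_set_nat atLeast0LessThan)
  qed
  define M where "M = length L"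
  define v where "v m = fst (L ! m)" for m
  define e where "e m = snd (L ! m)" for m
  have T': "T u = (\<Sum>m<M. F (u @ v m) * e m)" for u
    by (simp add: T_def sum_list_sum_nth M_def v_def e_def split_def atLeast0LessThan)
  have "Q N w d = (\<Sum>m<N. star (d m) * T (word_star (w m)))"
    by (simp add: Q_def T[symmetric] sum_distrib_left mult.assoc)
  also have "\<dots> = (\<Sum>m<N. \<Sum>n<M. star (d m) * F (word_star (w m) @ v n) * e n)"
    by (simp add: T' sum_distrib_left mult.assoc)
  also have "\<dots> = (\<Sum>n<M. \<Sum>m<N. star (d m) * F (word_star (w m) @ v n) * e n)" by (rule sum.swap)
  also have "\<dots> = (\<Sum>n<M. star (\<Sum>m<N. F (word_star (v n) @ w m) * d m) * e n)"
    by (simp add: star_sum star_mult F_star[symmetric] sum_distrib_right del: G.simps)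
  also have "\<dots> = (\<Sum>n<M. \<Sum>m<M. star (e m) * F (word_star (v m) @ v n) * e n)"
    unfolding T T' by (simp add: star_sum star_mult F_star[symmetric] sum_distrib_right del: G.simps)
  also have "\<dots> = Q M v e" unfolding Q_def by (rule sum.swap)
  finally have "Q N w d = Q M v e" .
  have "descending (v m)" if "m < M" for m
    using nth_mem[of m L] that R(1) by (fastforce simp: L_def v_def M_def)
  then have "nonneg (Q M v e)"
    by (intro Q_descending[of "\<Union>m<M. fst ` set (v m)", rule_format]) auto
  with \<open>Q N w d = Q M v e\<close> show ?thesis by simp
qed

end

section \<open>Lifting the given maps\<close>

lemma char_scal [simp]: "char (scal c) = c"
  by (simp add: scal_def im_univ_def) (simp add: complex_eq_iff)

lemma coord_scal [simp]:
  assumes A: "cstar_algebra A"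
  shows "coord A (scal c) = c \<odot>\<^bsub>A\<^esub> \<one>\<^bsub>A\<^esub>"
proof -
  interpret A: ring A by (rule cstar_algebra.axioms(1)[OF A])
  interpret cstar_algebra A by (rule A)
  have "coord A (scal c) = (of_real (Re c) + of_real (Im c) * \<i>) \<odot>\<^bsub>A\<^esub> \<one>\<^bsub>A\<^esub>"
    using A by (simp add: scal_def im_univ_def scalar_add_left scalar_scalar)
  also have "of_real (Re c) + of_real (Im c) * \<i> = c" by (simp add: complex_eq_iff)
  finally show ?thesis .
qed

lemma coord_scal_times [simp]:
  assumes A: "cstar_algebra A"
  shows "coord A (scal c * u) = c \<odot>\<^bsub>A\<^esub> coord A u"
proof -
  interpret A: ring A by (rule cstar_algebra.axioms(1)[OF A])
  interpret cstar_algebra A by (rule A)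
  show ?thesis using A by (simp add: smult_mult_left)
qed

lemma char_star_univ [simp]: "char (star u) = cnj (char u)"
  by (simp add: star_univ_def)

lemma coord_star_univ [simp]: "cstar_algebra A \<Longrightarrow> coord A (star u) = adj A (coord A u)"
  by (simp add: star_univ_def)

lemma coord_sum:
  assumes A: "cstar_algebra A" and "finite S"
  shows "coord A (sum f S) = finsum A (\<lambda>i. coord A (f i)) S"
proof -
  interpret A: ring A by (rule cstar_algebra.axioms(1)[OF A])
  interpret cstar_algebra A by (rule A)
  show ?thesis using assms(2) by (induction S) (simp_all add: A)
qed

lemma char_sum: "char (sum f S) = (\<Sum>i\<in>S. char (f i))"
  by (induction S rule: infinite_finite_induct) auto

text \<open>With c = 0 this embeds D as the elements supported at its own coordinate. Lifted maps
  take for c the character of their argument, which makes them unital at the other coordinates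
  too.\<close>

definition lift :: "'d cstar_algebra \<Rightarrow> 'd \<Rightarrow> complex \<Rightarrow> 'd univ" where
  "lift D h c = family (\<lambda>A. if A = D then h else c \<odot>\<^bsub>A\<^esub> \<one>\<^bsub>A\<^esub>) c"

lemma
  assumes D: "cstar_algebra D" and h: "h \<in> carrier D"
  shows coord_lift: "coord D (lift D h c) = h"
    and coord_lift_other: "cstar_algebra A \<Longrightarrow> A \<noteq> D \<Longrightarrow> coord A (lift D h c) = c \<odot>\<^bsub>A\<^esub> \<one>\<^bsub>A\<^esub>"
    and char_lift: "char (lift D h c) = c"
proof -
  have *: "(if A = D then h else c \<odot>\<^bsub>A\<^esub> \<one>\<^bsub>A\<^esub>) \<in> carrier A \<and>
      cnorm A (if A = D then h else c \<odot>\<^bsub>A\<^esub> \<one>\<^bsub>A\<^esub>) \<le> max (cnorm D h) (cmod c)"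
    if A: "cstar_algebra A" for A
  proof -
    interpret A: ring A by (rule cstar_algebra.axioms(1)[OF A])
    interpret cstar_algebra A by (rule A)
    have "cmod c * cnorm A \<one>\<^bsub>A\<^esub> \<le> cmod c" by (simp add: cnorm_one_le mult_left_le)
    then show ?thesis using h by (auto simp: cnorm_smult le_max_iff_disj)
  qed
  have f: "coord A (lift D h c) = (if A = D then h else c \<odot>\<^bsub>A\<^esub> \<one>\<^bsub>A\<^esub>)" if "cstar_algebra A" for A
    unfolding lift_def by (rule family(1)) (use * that in blast)+
  show "char (lift D h c) = c" unfolding lift_def by (rule family(2)) (use * in blast)+
  show "coord D (lift D h c) = h" using f[OF D] by simp
  assume "cstar_algebra A" "A \<noteq> D"
  then show "coord A (lift D h c) = c \<odot>\<^bsub>A\<^esub> \<one>\<^bsub>A\<^esub>" using f[of A] by simp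
qed

lemma lift_eqI:
  assumes D: "cstar_algebra D" and h: "h \<in> carrier D"
    and "coord D u = h" "char u = c"
    and "\<And>A. cstar_algebra A \<Longrightarrow> A \<noteq> D \<Longrightarrow> coord A u = c \<odot>\<^bsub>A\<^esub> \<one>\<^bsub>A\<^esub>"
  shows "u = lift D h c"
proof (rule univ_eqI)
  show "char u = char (lift D h c)" using assms by (simp add: char_lift)
  show "coord A u = coord A (lift D h c)" if "cstar_algebra A" for A
    using assms that by (cases "A = D") (simp_all add: coord_lift coord_lift_other)
qed

lemma
  assumes D: "cstar_algebra D" and h: "h \<in> carrier D" "h' \<in> carrier D"
  shows lift_add: "lift D h c + lift D h' c' = lift D (h \<oplus>\<^bsub>D\<^esub> h') (c + c')"
    and lift_mult: "lift D h c * lift D h' c' = lift D (h \<otimes>\<^bsub>D\<^esub> h') (c * c')"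
    and lift_diff: "lift D h c - lift D h' c' = lift D (h \<ominus>\<^bsub>D\<^esub> h') (c - c')"
proof -
  interpret D: ring D by (rule cstar_algebra.axioms(1)[OF D])
  have o: "c \<odot>\<^bsub>A\<^esub> \<one>\<^bsub>A\<^esub> \<oplus>\<^bsub>A\<^esub> c' \<odot>\<^bsub>A\<^esub> \<one>\<^bsub>A\<^esub> = (c + c') \<odot>\<^bsub>A\<^esub> \<one>\<^bsub>A\<^esub>"
    "c \<odot>\<^bsub>A\<^esub> \<one>\<^bsub>A\<^esub> \<otimes>\<^bsub>A\<^esub> (c' \<odot>\<^bsub>A\<^esub> \<one>\<^bsub>A\<^esub>) = (c * c') \<odot>\<^bsub>A\<^esub> \<one>\<^bsub>A\<^esub>"
    "c \<odot>\<^bsub>A\<^esub> \<one>\<^bsub>A\<^esub> \<ominus>\<^bsub>A\<^esub> c' \<odot>\<^bsub>A\<^esub> \<one>\<^bsub>A\<^esub> = (c - c') \<odot>\<^bsub>A\<^esub> \<one>\<^bsub>A\<^esub>"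
    if A: "cstar_algebra A" for A :: "'a cstar_algebra"
  proof -
    interpret A: ring A by (rule cstar_algebra.axioms(1)[OF A])
    interpret cstar_algebra A by (rule A)
    show "c \<odot>\<^bsub>A\<^esub> \<one>\<^bsub>A\<^esub> \<oplus>\<^bsub>A\<^esub> c' \<odot>\<^bsub>A\<^esub> \<one>\<^bsub>A\<^esub> = (c + c') \<odot>\<^bsub>A\<^esub> \<one>\<^bsub>A\<^esub>" by (simp add: scalar_add_left)
    show "c \<odot>\<^bsub>A\<^esub> \<one>\<^bsub>A\<^esub> \<otimes>\<^bsub>A\<^esub> (c' \<odot>\<^bsub>A\<^esub> \<one>\<^bsub>A\<^esub>) = (c * c') \<odot>\<^bsub>A\<^esub> \<one>\<^bsub>A\<^esub>"
      by (simp add: smult_mult_left scalar_scalar)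
    have "\<ominus>\<^bsub>A\<^esub> (c' \<odot>\<^bsub>A\<^esub> \<one>\<^bsub>A\<^esub>) = (- c') \<odot>\<^bsub>A\<^esub> \<one>\<^bsub>A\<^esub>" by (simp add: scalar_minus_1 scalar_scalar)
    then show "c \<odot>\<^bsub>A\<^esub> \<one>\<^bsub>A\<^esub> \<ominus>\<^bsub>A\<^esub> c' \<odot>\<^bsub>A\<^esub> \<one>\<^bsub>A\<^esub> = (c - c') \<odot>\<^bsub>A\<^esub> \<one>\<^bsub>A\<^esub>"
      by (simp add: a_minus_def scalar_add_left[symmetric])
  qed
  show "lift D h c + lift D h' c' = lift D (h \<oplus>\<^bsub>D\<^esub> h') (c + c')"
    by (rule lift_eqI) (use assms o in \<open>simp_all add: coord_lift coord_lift_other char_lift\<close>)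
  show "lift D h c * lift D h' c' = lift D (h \<otimes>\<^bsub>D\<^esub> h') (c * c')"
    by (rule lift_eqI) (use assms o in \<open>simp_all add: coord_lift coord_lift_other char_lift\<close>)
  show "lift D h c - lift D h' c' = lift D (h \<ominus>\<^bsub>D\<^esub> h') (c - c')"
    by (rule lift_eqI) (use assms o in \<open>simp_all add: coord_lift coord_lift_other char_lift\<close>)
qed

lemma
  assumes D: "cstar_algebra D" and h: "h \<in> carrier D"
  shows lift_star: "star (lift D h c) = lift D (adj D h) (cnj c)"
    and lift_scal: "scal d * lift D h c = lift D (d \<odot>\<^bsub>D\<^esub> h) (d * c)"
    and lift_one: "lift D \<one>\<^bsub>D\<^esub> 1 = 1"
proof -
  interpret D: ring D by (rule cstar_algebra.axioms(1)[OF D])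
  interpret D': cstar_algebra D by (rule D)
  have o: "adj A (c \<odot>\<^bsub>A\<^esub> \<one>\<^bsub>A\<^esub>) = cnj c \<odot>\<^bsub>A\<^esub> \<one>\<^bsub>A\<^esub>"
    "d \<odot>\<^bsub>A\<^esub> (c \<odot>\<^bsub>A\<^esub> \<one>\<^bsub>A\<^esub>) = (d * c) \<odot>\<^bsub>A\<^esub> \<one>\<^bsub>A\<^esub>" "1 \<odot>\<^bsub>A\<^esub> \<one>\<^bsub>A\<^esub> = \<one>\<^bsub>A\<^esub>"
    if A: "cstar_algebra A" for A :: "'a cstar_algebra"
  proof -
    interpret A: ring A by (rule cstar_algebra.axioms(1)[OF A])
    interpret cstar_algebra A by (rule A)
    show "adj A (c \<odot>\<^bsub>A\<^esub> \<one>\<^bsub>A\<^esub>) = cnj c \<odot>\<^bsub>A\<^esub> \<one>\<^bsub>A\<^esub>" by (simp add: adj_smult)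
    show "d \<odot>\<^bsub>A\<^esub> (c \<odot>\<^bsub>A\<^esub> \<one>\<^bsub>A\<^esub>) = (d * c) \<odot>\<^bsub>A\<^esub> \<one>\<^bsub>A\<^esub>" by (simp add: scalar_scalar)
    show "1 \<odot>\<^bsub>A\<^esub> \<one>\<^bsub>A\<^esub> = \<one>\<^bsub>A\<^esub>" by simp
  qed
  show "star (lift D h c) = lift D (adj D h) (cnj c)"
    by (rule lift_eqI) (use assms o in \<open>simp_all add: coord_lift coord_lift_other char_lift D'.adj_closed\<close>)
  show "scal d * lift D h c = lift D (d \<odot>\<^bsub>D\<^esub> h) (d * c)"
    by (rule lift_eqI) (use assms o in \<open>simp_all add: coord_lift coord_lift_other char_lift del: coord_times\<close>)
  show "lift D \<one>\<^bsub>D\<^esub> 1 = 1"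
    by (rule lift_eqI[symmetric]) (use assms o in simp_all)
qed

text \<open>The form is the sum over l of the hermitian squares of \<Sum> Y_lm d_m. The number L of
  rows is free because the lifted \<theta> takes one row more than n.\<close>

lemma nonneg_gram:
  fixes Y :: "nat \<Rightarrow> nat \<Rightarrow> 'a::cstar"
  assumes "\<And>m k. m < n \<Longrightarrow> k < n \<Longrightarrow> M m k = (\<Sum>l<L. star (Y l m) * Y l k)"
  shows "nonneg (\<Sum>m<n. \<Sum>k<n. star (d m) * M m k * d k)"
proof -
  have "(\<Sum>m<n. \<Sum>k<n. star (d m) * M m k * d k)
     = (\<Sum>m<n. \<Sum>k<n. \<Sum>l<L. star (Y l m * d m) * (Y l k * d k))"
    by (intro sum.cong refl) (simp add: assms sum_distrib_left sum_distrib_right star_mult mult.assoc)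
  also have "\<dots> = (\<Sum>l<L. \<Sum>m<n. \<Sum>k<n. star (Y l m * d m) * (Y l k * d k))"
  proof -
    have "(\<Sum>m<n. \<Sum>k<n. \<Sum>l<L. star (Y l m * d m) * (Y l k * d k))
       = (\<Sum>m<n. \<Sum>l<L. \<Sum>k<n. star (Y l m * d m) * (Y l k * d k))"
      by (rule sum.cong[OF refl]) (rule sum.swap)
    also have "\<dots> = (\<Sum>l<L. \<Sum>m<n. \<Sum>k<n. star (Y l m * d m) * (Y l k * d k))" by (rule sum.swap)
    finally show ?thesis .
  qed
  also have "\<dots> = (\<Sum>l<L. star (\<Sum>m<n. Y l m * d m) * (\<Sum>m<n. Y l m * d m))"
    by (simp add: star_sum sum_product)
  finally show ?thesis by (simp add: nonneg_sum nonneg_star_mult)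
qed

locale monotone_setup =
  fixes I :: "('i::linorder) set"
    and A :: "'i \<Rightarrow> 'a cstar_algebra"
    and B :: "'b cstar_algebra"
    and D :: "'d cstar_algebra"
    and \<iota> :: "'i \<Rightarrow> 'b \<Rightarrow> 'a"
    and \<kappa> :: "'b \<Rightarrow> 'd"
    and \<psi> :: "'i \<Rightarrow> 'a \<Rightarrow> 'b"
    and \<theta> :: "'i \<Rightarrow> 'a \<Rightarrow> 'd"
  assumes A: "\<And>i. i \<in> I \<Longrightarrow> cstar_algebra (A i)"
    and D: "cstar_algebra D"
    and B: "cstar_algebra B"
    and \<iota>: "\<And>i. i \<in> I \<Longrightarrow> cstar_inclusion B (A i) (\<iota> i)"
    and \<kappa>: "cstar_inclusion B D \<kappa>"
    and \<psi>: "\<And>i. i \<in> I \<Longrightarrow> positive_conditional_expectation (A i) B (\<iota> i) (\<psi> i)"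
    and \<theta>_one: "\<And>i. i \<in> I \<Longrightarrow> \<theta> i \<one>\<^bsub>A i\<^esub> = \<one>\<^bsub>D\<^esub>"
    and \<theta>_cp: "\<And>i. i \<in> I \<Longrightarrow> completely_positive (A i) D (\<theta> i)"
    and \<theta>_bimod: "\<And>i. i \<in> I \<Longrightarrow>
          bimodule_map B (A i) (left_via (A i) (\<iota> i)) (right_via (A i) (\<iota> i))
            D (left_via D \<kappa>) (right_via D \<kappa>) (\<theta> i)"
begin

lemma ringD: "ring D" and ringB: "ring B" and ringA: "i \<in> I \<Longrightarrow> ring (A i)"
  using A B D cstar_algebra.axioms(1) by blast+

lemma \<iota>_hom:
  assumes "i \<in> I"
  shows "b \<in> carrier B \<Longrightarrow> \<iota> i b \<in> carrier (A i)"
    "b \<in> carrier B \<Longrightarrow> b' \<in> carrier B \<Longrightarrow> \<iota> i (b \<oplus>\<^bsub>B\<^esub> b') = \<iota> i b \<oplus>\<^bsub>A i\<^esub> \<iota> i b'"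
    "b \<in> carrier B \<Longrightarrow> b' \<in> carrier B \<Longrightarrow> \<iota> i (b \<otimes>\<^bsub>B\<^esub> b') = \<iota> i b \<otimes>\<^bsub>A i\<^esub> \<iota> i b'"
    "\<iota> i \<one>\<^bsub>B\<^esub> = \<one>\<^bsub>A i\<^esub>" "b \<in> carrier B \<Longrightarrow> \<iota> i (adj B b) = adj (A i) (\<iota> i b)"
    "b \<in> carrier B \<Longrightarrow> \<iota> i (c \<odot>\<^bsub>B\<^esub> b) = c \<odot>\<^bsub>A i\<^esub> \<iota> i b"
  using \<iota>[OF assms] by (auto simp: cstar_inclusion_def ring_hom_def)

lemma \<kappa>_hom:
  shows "b \<in> carrier B \<Longrightarrow> \<kappa> b \<in> carrier D"
    "b \<in> carrier B \<Longrightarrow> b' \<in> carrier B \<Longrightarrow> \<kappa> (b \<oplus>\<^bsub>B\<^esub> b') = \<kappa> b \<oplus>\<^bsub>D\<^esub> \<kappa> b'"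
    "b \<in> carrier B \<Longrightarrow> b' \<in> carrier B \<Longrightarrow> \<kappa> (b \<otimes>\<^bsub>B\<^esub> b') = \<kappa> b \<otimes>\<^bsub>D\<^esub> \<kappa> b'"
    "\<kappa> \<one>\<^bsub>B\<^esub> = \<one>\<^bsub>D\<^esub>" "b \<in> carrier B \<Longrightarrow> \<kappa> (adj B b) = adj D (\<kappa> b)"
    "b \<in> carrier B \<Longrightarrow> \<kappa> (c \<odot>\<^bsub>B\<^esub> b) = c \<odot>\<^bsub>D\<^esub> \<kappa> b"
  using \<kappa> by (auto simp: cstar_inclusion_def ring_hom_def)

lemma \<theta>_map:
  assumes "i \<in> I"
  shows "a \<in> carrier (A i) \<Longrightarrow> \<theta> i a \<in> carrier D"
    "a \<in> carrier (A i) \<Longrightarrow> a' \<in> carrier (A i) \<Longrightarrow> \<theta> i (a \<oplus>\<^bsub>A i\<^esub> a') = \<theta> i a \<oplus>\<^bsub>D\<^esub> \<theta> i a'"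
    "a \<in> carrier (A i) \<Longrightarrow> \<theta> i (c \<odot>\<^bsub>A i\<^esub> a) = c \<odot>\<^bsub>D\<^esub> \<theta> i a"
    "a \<in> carrier (A i) \<Longrightarrow> b \<in> carrier B \<Longrightarrow> \<theta> i (\<iota> i b \<otimes>\<^bsub>A i\<^esub> a) = \<kappa> b \<otimes>\<^bsub>D\<^esub> \<theta> i a"
    "a \<in> carrier (A i) \<Longrightarrow> b \<in> carrier B \<Longrightarrow> \<theta> i (a \<otimes>\<^bsub>A i\<^esub> \<iota> i b) = \<theta> i a \<otimes>\<^bsub>D\<^esub> \<kappa> b"
  using \<theta>_bimod[OF assms] by (auto simp: bimodule_map_def linear_map_def left_via_def right_via_def)

lemma \<psi>_map:
  assumes "i \<in> I"
  shows "a \<in> carrier (A i) \<Longrightarrow> \<psi> i a \<in> carrier B"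
    "a \<in> carrier (A i) \<Longrightarrow> a' \<in> carrier (A i) \<Longrightarrow> \<psi> i (a \<oplus>\<^bsub>A i\<^esub> a') = \<psi> i a \<oplus>\<^bsub>B\<^esub> \<psi> i a'"
    "a \<in> carrier (A i) \<Longrightarrow> \<psi> i (c \<odot>\<^bsub>A i\<^esub> a) = c \<odot>\<^bsub>B\<^esub> \<psi> i a"
    "a \<in> carrier (A i) \<Longrightarrow> b \<in> carrier B \<Longrightarrow> \<psi> i (\<iota> i b \<otimes>\<^bsub>A i\<^esub> a) = b \<otimes>\<^bsub>B\<^esub> \<psi> i a"
    "a \<in> carrier (A i) \<Longrightarrow> b \<in> carrier B \<Longrightarrow> \<psi> i (a \<otimes>\<^bsub>A i\<^esub> \<iota> i b) = \<psi> i a \<otimes>\<^bsub>B\<^esub> b"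
    "\<psi> i \<one>\<^bsub>A i\<^esub> = \<one>\<^bsub>B\<^esub>"
  using \<psi>[OF assms] \<iota>_hom(4)[OF assms] ring.ring_simprules(6)[OF ringB]
  by (auto simp: positive_conditional_expectation_def bimodule_map_def linear_map_def left_via_def right_via_def)

lemma \<psi>_positive:
  assumes "i \<in> I" "a \<in> carrier (A i)"
  obtains b where "b \<in> carrier B" "\<psi> i (adj (A i) a \<otimes>\<^bsub>A i\<^esub> a) = adj B b \<otimes>\<^bsub>B\<^esub> b"
  using \<psi>[OF assms(1)] assms(2)
  by (force simp: positive_conditional_expectation_def cstar_positive_def)

text \<open>Complete positivity speaks of square matrices, so the a_m are put into row 0 of a matrix
  that is 0 elsewhere; its hermitian square has the entries a_m^* a_k. For n = 0 there is no such
  row.\<close>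

lemma \<theta>_gram:
  fixes n :: nat
  assumes i: "i \<in> I" and a: "\<And>m. m < n \<Longrightarrow> a m \<in> carrier (A i)"
  obtains Y where "\<And>l m. l < n \<Longrightarrow> m < n \<Longrightarrow> Y l m \<in> carrier D"
    "\<And>m k. m < n \<Longrightarrow> k < n \<Longrightarrow>
      \<theta> i (adj (A i) (a m) \<otimes>\<^bsub>A i\<^esub> a k) = finsum D (\<lambda>l. adj D (Y l m) \<otimes>\<^bsub>D\<^esub> Y l k) {..<n}"
proof (cases "n = 0")
  case True
  then show ?thesis using that[of "\<lambda>_ _. \<zero>\<^bsub>D\<^esub>"] by simp
next
  case False
  interpret Ai: ring "A i" by (rule ringA[OF i])
  interpret Ai': cstar_algebra "A i" by (rule A[OF i])
  define x where "x = (\<lambda>p\<in>mat_indices n. if fst p = 0 then a (snd p) else \<zero>\<^bsub>A i\<^esub>)"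
  let ?R = "mat_algebra n (A i)"
  have x: "x \<in> carrier ?R" using a by (auto simp: x_def mat_algebra_def mat_indices_def)
  have "adj ?R x \<otimes>\<^bsub>?R\<^esub> x \<in> star_positive ?R" by (rule star_positive.square[OF x])
  then have "(\<lambda>p\<in>mat_indices n. \<theta> i ((adj ?R x \<otimes>\<^bsub>?R\<^esub> x) p)) \<in> cstar_positive (mat_algebra n D)"
    using \<theta>_cp[OF i] False by (auto simp: completely_positive_def)
  then obtain y where y: "y \<in> carrier (mat_algebra n D)"
    "(\<lambda>p\<in>mat_indices n. \<theta> i ((adj ?R x \<otimes>\<^bsub>?R\<^esub> x) p)) = adj (mat_algebra n D) y \<otimes>\<^bsub>mat_algebra n D\<^esub> y"
    by (auto simp: cstar_positive_def)
  have xx: "(adj ?R x \<otimes>\<^bsub>?R\<^esub> x) (m, k) = adj (A i) (a m) \<otimes>\<^bsub>A i\<^esub> a k" if mk: "m < n" "k < n" for m k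
  proof -
    have "(adj ?R x \<otimes>\<^bsub>?R\<^esub> x) (m, k) = finsum (A i) (\<lambda>l. adj (A i) (x (l, m)) \<otimes>\<^bsub>A i\<^esub> x (l, k)) {..<n}"
      using mk by (auto simp: mat_algebra_def mat_indices_def intro!: Ai.finsum_cong'
          Ai.m_closed Ai'.adj_closed) (auto simp: x_def mat_indices_def a Ai'.adj_closed)
    also have "\<dots> = finsum (A i) (\<lambda>l. if 0 = l then adj (A i) (a m) \<otimes>\<^bsub>A i\<^esub> a k else \<zero>\<^bsub>A i\<^esub>) {..<n}"
      using mk a by (intro Ai.finsum_cong') (auto simp: x_def mat_indices_def Ai'.adj_closed)
    also have "\<dots> = adj (A i) (a m) \<otimes>\<^bsub>A i\<^esub> a k"
      by (rule Ai.finsum_singleton) (use mk a False in \<open>auto simp: Ai'.adj_closed\<close>)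
    finally show ?thesis .
  qed
  show ?thesis
  proof (rule that[of "\<lambda>l m. y (l, m)"])
    show "y (l, m) \<in> carrier D" if "l < n" "m < n" for l m
      using y(1) that by (auto simp: mat_algebra_def mat_indices_def)
    fix m k assume mk: "m < n" "k < n"
    have "\<theta> i (adj (A i) (a m) \<otimes>\<^bsub>A i\<^esub> a k) = (adj (mat_algebra n D) y \<otimes>\<^bsub>mat_algebra n D\<^esub> y) (m, k)"
      using mk unfolding y(2)[symmetric] by (simp add: xx mat_indices_def)
    also have "\<dots> = finsum D (\<lambda>l. adj D (y (l, m)) \<otimes>\<^bsub>D\<^esub> y (l, k)) {..<n}"
    proof -
      interpret D: ring D by (rule ringD)
      interpret D': cstar_algebra D by (rule D)
      have yc: "y (l, m) \<in> carrier D" if "l < n" "m < n" for l m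
        using y(1) that by (auto simp: mat_algebra_def mat_indices_def)
      show ?thesis using mk
        by (auto simp: mat_algebra_def mat_indices_def intro!: D.finsum_cong' D.m_closed D'.adj_closed yc)
    qed
    finally show "\<theta> i (adj (A i) (a m) \<otimes>\<^bsub>A i\<^esub> a k) = finsum D (\<lambda>l. adj D (y (l, m)) \<otimes>\<^bsub>D\<^esub> y (l, k)) {..<n}" .
  qed
qed

text \<open>Indices outside \<open>I\<close> are given the data of a fixed \<open>i0 \<in> I\<close>, so that all lifted maps are total.\<close>

definition sel :: "'i \<Rightarrow> 'i \<Rightarrow> 'i" where "sel i0 i = (if i \<in> I then i else i0)"

definition \<theta>U where "\<theta>U i0 i u = lift D (\<theta> (sel i0 i) (coord (A (sel i0 i)) u)) (char u)"
definition \<psi>U where "\<psi>U i0 i u = lift B (\<psi> (sel i0 i) (coord (A (sel i0 i)) u)) (char u)"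
definition \<iota>U where "\<iota>U i0 i b = lift (A (sel i0 i)) (\<iota> (sel i0 i) (coord B b)) (char b)"
definition \<kappa>U where "\<kappa>U b = lift D (\<kappa> (coord B b)) (char b)"

lemma lifted_data:
  assumes "i0 \<in> I"
  shows "monotone_data (\<theta>U i0) (\<psi>U i0) (\<iota>U i0) \<kappa>U"
proof -
  have s: "sel i0 i \<in> I" for i using assms by (simp add: sel_def)
  note As = A[OF s] and Rs = ringA[OF s]
  note cl = \<theta>_map(1)[OF s] \<psi>_map(1)[OF s] \<iota>_hom(1)[OF s] \<kappa>_hom(1)
    coord_closed[OF A[OF s]] coord_closed[OF B] coord_closed[OF D]
  note hom = \<theta>_map(2-)[OF s] \<psi>_map(2-)[OF s] \<iota>_hom(2-)[OF s] \<kappa>_hom(2-) \<theta>_one[OF s]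
  show ?thesis
  proof
    fix i j and x y :: "'a univ" and b b' :: "'b univ" and c
    show "\<theta>U i0 i (x + y) = \<theta>U i0 i x + \<theta>U i0 i y"
      by (simp add: \<theta>U_def lift_add D cl As hom)
    show "\<theta>U i0 i (scal c * x) = scal c * \<theta>U i0 i x"
      by (simp add: \<theta>U_def lift_scal D cl As hom del: coord_times)
    show "\<theta>U i0 i (\<iota>U i0 i b * x) = \<kappa>U b * \<theta>U i0 i x"
      by (simp add: \<theta>U_def \<iota>U_def \<kappa>U_def lift_mult D B cl As hom coord_lift char_lift)
    show "\<theta>U i0 i (x * \<iota>U i0 i b) = \<theta>U i0 i x * \<kappa>U b"
      by (simp add: \<theta>U_def \<iota>U_def \<kappa>U_def lift_mult D B cl As hom coord_lift char_lift)
    show "\<theta>U i0 i 1 = 1"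
      by (simp add: \<theta>U_def As hom lift_one[OF D ring.ring_simprules(6)[OF ringD]])
    show "\<psi>U i0 i (x + y) = \<psi>U i0 i x + \<psi>U i0 i y"
      by (simp add: \<psi>U_def lift_add B cl As hom)
    show "\<psi>U i0 i (scal c * x) = scal c * \<psi>U i0 i x"
      by (simp add: \<psi>U_def lift_scal B cl As hom del: coord_times)
    show "\<iota>U i0 j (\<psi>U i0 i (\<iota>U i0 i b * x)) = \<iota>U i0 j (b * \<psi>U i0 i x)"
      "\<kappa>U (\<psi>U i0 i (\<iota>U i0 i b * x)) = \<kappa>U (b * \<psi>U i0 i x)"
      "\<iota>U i0 j (\<psi>U i0 i (x * \<iota>U i0 i b)) = \<iota>U i0 j (\<psi>U i0 i x * b)"
      "\<kappa>U (\<psi>U i0 i (x * \<iota>U i0 i b)) = \<kappa>U (\<psi>U i0 i x * b)"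
      by (simp_all add: \<psi>U_def \<iota>U_def \<kappa>U_def B cl As hom coord_lift char_lift monoid.m_closed[OF ring.is_monoid[OF Rs]] monoid.m_closed[OF ring.is_monoid[OF ringB]])
    show "\<psi>U i0 i 1 = 1"
      by (simp add: \<psi>U_def As hom lift_one[OF B ring.ring_simprules(6)[OF ringB]])
    show "\<iota>U i0 i (b + b') = \<iota>U i0 i b + \<iota>U i0 i b'" by (simp add: \<iota>U_def lift_add B cl As hom)
    show "\<iota>U i0 i (b * b') = \<iota>U i0 i b * \<iota>U i0 i b'" by (simp add: \<iota>U_def lift_mult B cl As hom)
    show "\<iota>U i0 i (scal c * b) = scal c * \<iota>U i0 i b" by (simp add: \<iota>U_def lift_scal B cl As hom del: coord_times)
    show "\<iota>U i0 i 1 = 1" by (simp add: \<iota>U_def B hom lift_one[OF As ring.ring_simprules(6)[OF Rs]])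
    show "\<iota>U i0 i (star b) = star (\<iota>U i0 i b)" by (simp add: \<iota>U_def lift_star B cl As hom)
    show "\<kappa>U (b + b') = \<kappa>U b + \<kappa>U b'" by (simp add: \<kappa>U_def lift_add B D cl hom)
    show "\<kappa>U (b * b') = \<kappa>U b * \<kappa>U b'" by (simp add: \<kappa>U_def lift_mult B D cl hom)
    show "\<kappa>U (scal c * b) = scal c * \<kappa>U b" by (simp add: \<kappa>U_def lift_scal B D cl hom del: coord_times)
    show "\<kappa>U 1 = 1" by (simp add: \<kappa>U_def B hom lift_one[OF D ring.ring_simprules(6)[OF ringD]])
    show "\<kappa>U (star b) = star (\<kappa>U b)" by (simp add: \<kappa>U_def lift_star B D cl hom)
  next
    fix n :: nat and d :: "nat \<Rightarrow> 'd univ" and i and z :: "nat \<Rightarrow> 'a univ"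
    let ?i = "sel i0 i"
    have zc: "coord (A ?i) (z m) \<in> carrier (A ?i)" for m by (simp add: cl)
    obtain Y where Y: "\<And>l m. l < n \<Longrightarrow> m < n \<Longrightarrow> Y l m \<in> carrier D"
      "\<And>m k. m < n \<Longrightarrow> k < n \<Longrightarrow>
        \<theta> ?i (adj (A ?i) (coord (A ?i) (z m)) \<otimes>\<^bsub>A ?i\<^esub> coord (A ?i) (z k)) = finsum D (\<lambda>l. adj D (Y l m) \<otimes>\<^bsub>D\<^esub> Y l k) {..<n}"
      using \<theta>_gram[OF s, where n = n and a = "\<lambda>m. coord (A ?i) (z m)", OF zc] by blast
    \<comment> \<open>The rows below n carry the factorization of \<theta> at the coordinate D. The
      extra row n produces all other coordinates, where the lifted map is the character.\<close>
    define V where "V l m = (if l < n then lift D (Y l m) 0 else lift D \<zero>\<^bsub>D\<^esub> (char (z m)))" for l m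
    interpret D: ring D by (rule ringD)
    interpret D': cstar_algebra D by (rule D)
    show "nonneg (\<Sum>m<n. \<Sum>k<n. star (d m) * \<theta>U i0 i (star (z m) * z k) * d k)"
    proof (rule nonneg_gram[where L = "Suc n" and Y = V])
      fix m k assume mk: "m < n" "k < n"
      show "\<theta>U i0 i (star (z m) * z k) = (\<Sum>l<Suc n. star (V l m) * V l k)"
        unfolding \<theta>U_def
      proof (rule lift_eqI[OF D, symmetric])
        show "\<theta> ?i (coord (A ?i) (star (z m) * z k)) \<in> carrier D" by (simp add: cl)
        have "coord D (\<Sum>l<Suc n. star (V l m) * V l k) = finsum D (\<lambda>l. adj D (Y l m) \<otimes>\<^bsub>D\<^esub> Y l k) {..<n}"
        proof -
          have 1: "coord D (\<Sum>l<n. star (V l m) * V l k) = finsum D (\<lambda>l. adj D (Y l m) \<otimes>\<^bsub>D\<^esub> Y l k) {..<n}"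
            unfolding coord_sum[OF D finite_lessThan]
            by (rule D.finsum_cong') (use mk Y(1) D in \<open>simp_all add: V_def coord_lift D'.adj_closed\<close>)
          have "coord D (star (V n m) * V n k) = \<zero>\<^bsub>D\<^esub>" using D by (simp add: V_def coord_lift)
          then have "coord D (\<Sum>l<Suc n. star (V l m) * V l k) = coord D (\<Sum>l<n. star (V l m) * V l k) \<oplus>\<^bsub>D\<^esub> \<zero>\<^bsub>D\<^esub>"
            unfolding sum.lessThan_Suc coord_plus[OF D] by simp
          then show ?thesis unfolding 1 by (simp add: D 1[symmetric])
        qed
        then show "coord D (\<Sum>l<Suc n. star (V l m) * V l k) = \<theta> ?i (coord (A ?i) (star (z m) * z k))"
          using mk by (simp add: Y(2) As)
        show "char (\<Sum>l<Suc n. star (V l m) * V l k) = char (star (z m) * z k)"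
          using mk Y(1) D by (simp add: char_sum V_def char_lift)
        show "coord C (\<Sum>l<Suc n. star (V l m) * V l k) = char (star (z m) * z k) \<odot>\<^bsub>C\<^esub> \<one>\<^bsub>C\<^esub>"
          if C: "cstar_algebra C" "C \<noteq> D" for C
        proof -
          interpret C: ring C by (rule cstar_algebra.axioms(1)[OF C(1)])
          interpret C': cstar_algebra C by (rule C(1))
          have "coord C (\<Sum>l<n. star (V l m) * V l k) = finsum C (\<lambda>l. \<zero>\<^bsub>C\<^esub>) {..<n}"
            unfolding coord_sum[OF C(1) finite_lessThan]
            by (rule C.finsum_cong') (use mk Y(1) C D in \<open>simp_all add: V_def coord_lift_other C'.adj_smult\<close>)
          moreover have "coord C (star (V n m) * V n k) = char (star (z m) * z k) \<odot>\<^bsub>C\<^esub> \<one>\<^bsub>C\<^esub>"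
            using C D by (simp add: V_def coord_lift_other C'.adj_smult C'.smult_mult_left C'.smult_mult_right C'.scalar_scalar mult.commute)
          ultimately show ?thesis unfolding sum.lessThan_Suc coord_plus[OF C(1)] by simp
        qed
      qed
    qed
  next
    fix n :: nat and \<xi> :: "nat \<Rightarrow> 'b univ" and i and z :: "nat \<Rightarrow> 'a univ"
    let ?i = "sel i0 i"
    interpret B: ring B by (rule ringB)
    interpret B': cstar_algebra B by (rule B)
    \<comment> \<open>The central projection onto the coordinate B; the form is split into its parts
      under e and 1 - e.\<close>
    define e where "e = lift B \<one>\<^bsub>B\<^esub> 0"
    have el: "e * u = lift B (coord B u) 0" and er: "u * e = lift B (coord B u) 0" for u
    proof -
      have *: "coord C e \<otimes>\<^bsub>C\<^esub> coord C u = 0 \<odot>\<^bsub>C\<^esub> \<one>\<^bsub>C\<^esub> \<and> coord C u \<otimes>\<^bsub>C\<^esub> coord C e = 0 \<odot>\<^bsub>C\<^esub> \<one>\<^bsub>C\<^esub>"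
        if C: "cstar_algebra C" "C \<noteq> B" for C
      proof -
        interpret C: ring C by (rule cstar_algebra.axioms(1)[OF C(1)])
        interpret C': cstar_algebra C by (rule C(1))
        show ?thesis using C B by (simp add: e_def coord_lift_other)
      qed
      show "e * u = lift B (coord B u) 0"
        by (rule lift_eqI[OF B]) (use * in \<open>simp_all add: B, simp_all add: e_def B coord_lift char_lift\<close>)
      show "u * e = lift B (coord B u) 0"
        by (rule lift_eqI[OF B]) (use * in \<open>simp_all add: B, simp_all add: e_def B coord_lift char_lift\<close>)
    qed
    have ec: "u * e = e * u" for u by (simp add: el er)
    have se: "star e = e" by (simp add: e_def lift_star B)
    have ee: "e * e = e" unfolding el by (simp add: e_def coord_lift B)
    have \<psi>l: "e * (b * \<psi>U i0 i x) = e * \<psi>U i0 i (\<iota>U i0 i b * x)" for b x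
      by (simp add: el \<psi>U_def \<iota>U_def coord_lift B As cl hom)
    have \<psi>r: "e * (\<psi>U i0 i x * b) = e * \<psi>U i0 i (x * \<iota>U i0 i b)" for b x
      by (simp add: el \<psi>U_def \<iota>U_def coord_lift B As cl hom)
    have \<psi>add: "\<psi>U i0 i (x + y) = \<psi>U i0 i x + \<psi>U i0 i y" for x y
      by (simp add: \<psi>U_def lift_add B cl As hom)
    have \<psi>0: "\<psi>U i0 i 0 = 0" using \<psi>add[of 0 0] by simp
    have \<psi>sum: "\<psi>U i0 i (sum w S) = (\<Sum>m\<in>S. \<psi>U i0 i (w m))" for w :: "nat \<Rightarrow> 'a univ" and S
    proof (induction S rule: infinite_finite_induct)
      case (insert x S)
      then show ?case by (simp add: \<psi>add)
    qed (simp_all add: \<psi>0)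
    define h where "h = (\<Sum>m<n. \<Sum>k<n. star (\<xi> m) * \<psi>U i0 i (star (z m) * z k) * \<xi> k)"
    \<comment> \<open>Under e the bimodule laws collect the form into \<psi>(g^* g), so positivity
      of \<psi> suffices. Under 1 - e the lifted \<psi> is the character, and the form is the
      hermitian square of (1 - e) f.\<close>
    define f where "f = (\<Sum>m<n. scal (char (z m)) * \<xi> m)"
    define g where "g = (\<Sum>m<n. z m * \<iota>U i0 i (\<xi> m))"
    have "nonneg (e * h)"
    proof -
      have \<iota>s: "\<iota>U i0 i (star b) = star (\<iota>U i0 i b)" for b by (simp add: \<iota>U_def lift_star B cl As hom)
      have "e * h = (\<Sum>m<n. \<Sum>k<n. e * (star (\<xi> m) * (\<psi>U i0 i (star (z m) * z k) * \<xi> k)))"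
        by (simp add: h_def sum_distrib_left mult.assoc)
      also have "\<dots> = (\<Sum>m<n. \<Sum>k<n. e * \<psi>U i0 i (star (\<iota>U i0 i (\<xi> m)) * (star (z m) * z k * \<iota>U i0 i (\<xi> k))))"
      proof (intro sum.cong refl)
        fix m k
        have "e * (star (\<xi> m) * (\<psi>U i0 i (star (z m) * z k) * \<xi> k)) = star (\<xi> m) * (e * (\<psi>U i0 i (star (z m) * z k) * \<xi> k))"
          by (metis ec mult.assoc)
        also have "\<dots> = e * (star (\<xi> m) * \<psi>U i0 i (star (z m) * z k * \<iota>U i0 i (\<xi> k)))"
          unfolding \<psi>r by (metis ec mult.assoc)
        finally show "e * (star (\<xi> m) * (\<psi>U i0 i (star (z m) * z k) * \<xi> k))
          = e * \<psi>U i0 i (star (\<iota>U i0 i (\<xi> m)) * (star (z m) * z k * \<iota>U i0 i (\<xi> k)))"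
          unfolding \<psi>l \<iota>s .
      qed
      also have "\<dots> = e * \<psi>U i0 i (star g * g)"
      proof -
        have gg: "star g * g = (\<Sum>m<n. \<Sum>k<n. star (\<iota>U i0 i (\<xi> m)) * (star (z m) * z k * \<iota>U i0 i (\<xi> k)))"
          unfolding g_def star_sum sum_product by (simp only: star_mult mult.assoc)
        show ?thesis unfolding gg by (simp only: \<psi>sum sum_distrib_left)
      qed
      finally have eh: "e * h = e * \<psi>U i0 i (star g * g)" .
      have gc: "coord (A ?i) g \<in> carrier (A ?i)" by (simp add: cl)
      obtain b where b: "b \<in> carrier B"
        "\<psi> ?i (adj (A ?i) (coord (A ?i) g) \<otimes>\<^bsub>A ?i\<^esub> coord (A ?i) g) = adj B b \<otimes>\<^bsub>B\<^esub> b"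
        using \<psi>_positive[OF s gc] by blast
      have "coord B (\<psi>U i0 i (star g * g)) = adj B b \<otimes>\<^bsub>B\<^esub> b"
        by (simp add: \<psi>U_def coord_lift B cl As b B'.adj_closed)
      then have "e * h = star (lift B b 0) * lift B b 0"
        unfolding eh unfolding el by (simp add: lift_star lift_mult B b B'.adj_closed)
      then show ?thesis by (simp add: nonneg_star_mult)
    qed
    moreover have "nonneg (h - e * h)"
    proof -
      have c: "\<psi>U i0 i x - e * \<psi>U i0 i x = scal (char x) - e * scal (char x)" for x
      proof -
        have "scal (char x) = lift B (char x \<odot>\<^bsub>B\<^esub> \<one>\<^bsub>B\<^esub>) (char x)"
          by (rule lift_eqI) (simp_all add: B)
        then have 1: "scal (char x) - e * scal (char x) = lift B \<zero>\<^bsub>B\<^esub> (char x)"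
          unfolding el by (simp add: lift_diff B coord_lift B.r_neg a_minus_def)
        show ?thesis unfolding 1 unfolding el
          by (simp add: \<psi>U_def coord_lift lift_diff B cl B.r_neg a_minus_def)
      qed
      have q: "(1 - e) * \<psi>U i0 i x = (1 - e) * scal (char x)" for x
        using c[of x] by (simp add: left_diff_distrib)
      have qc: "(1 - e) * u = u * (1 - e)" for u by (simp add: left_diff_distrib right_diff_distrib ec)
      have qq: "(1 - e) * (1 - e) = 1 - e" by (simp add: left_diff_distrib right_diff_distrib ee)
      have sq: "star (1 - e) = 1 - e" by (simp add: star_diff se)
      have "h - e * h = (1 - e) * h" by (simp add: left_diff_distrib)
      also have "\<dots> = (\<Sum>m<n. \<Sum>k<n. star (\<xi> m) * ((1 - e) * \<psi>U i0 i (star (z m) * z k)) * \<xi> k)"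
        unfolding h_def sum_distrib_left by (intro sum.cong refl) (metis qc mult.assoc)
      also have "\<dots> = (\<Sum>m<n. \<Sum>k<n. (1 - e) * (star (scal (char (z m)) * \<xi> m) * (scal (char (z k)) * \<xi> k)))"
        unfolding q
      proof (intro sum.cong refl)
        fix m k
        have "star (\<xi> m) * ((1 - e) * scal (char (star (z m) * z k))) * \<xi> k
          = (1 - e) * (star (\<xi> m) * (scal (cnj (char (z m))) * scal (char (z k))) * \<xi> k)"
          by (metis qc mult.assoc char_star_univ char_times scal_mult)
        then show "star (\<xi> m) * ((1 - e) * scal (char (star (z m) * z k))) * \<xi> k
          = (1 - e) * (star (scal (char (z m)) * \<xi> m) * (scal (char (z k)) * \<xi> k))"
          by (simp add: star_mult star_scal mult.assoc)
      qed
      also have "\<dots> = (1 - e) * (star f * f)"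
        unfolding f_def star_sum sum_product by (simp only: sum_distrib_left)
      also have "\<dots> = star ((1 - e) * f) * ((1 - e) * f)"
        unfolding star_mult sq by (metis qc qq mult.assoc)
      finally show ?thesis by (simp add: nonneg_star_mult)
    qed
    ultimately have "nonneg (e * h + (h - e * h))" by (rule nonneg_add)
    then show "nonneg (\<Sum>m<n. \<Sum>k<n. star (\<xi> m) * \<psi>U i0 i (star (z m) * z k) * \<xi> k)"
      by (simp add: h_def[symmetric])
  qed
qed

lemma reduced_letter:
  "u @ (i, a) # v \<in> reduced_words I A \<Longrightarrow> i \<in> I \<and> a \<in> carrier (A i)"
  by (auto simp: reduced_words_def)

lemma reduced_letters: "w \<in> reduced_words I A \<Longrightarrow> (i, a) \<in> set w \<Longrightarrow> i \<in> I \<and> a \<in> carrier (A i)"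
  by (auto simp: reduced_words_def)

text \<open>All that the free product needs to know about values of words, stated over the given
  algebras. The values stay in the product algebra, where positivity of the kernel is available; the
  coordinate D is read off only at the end.\<close>

lemma word_functional:
  obtains Fw :: "('i \<times> 'a) list \<Rightarrow> 'd univ" where
    "\<And>u i a v a'. u @ (i, a) # v \<in> reduced_words I A \<Longrightarrow> a' \<in> carrier (A i) \<Longrightarrow>
      Fw (u @ (i, a \<oplus>\<^bsub>A i\<^esub> a') # v) = Fw (u @ (i, a) # v) + Fw (u @ (i, a') # v)"
    "\<And>u i a v c. u @ (i, a) # v \<in> reduced_words I A \<Longrightarrow>
      Fw (u @ (i, c \<odot>\<^bsub>A i\<^esub> a) # v) = scal c * Fw (u @ (i, a) # v)"
    "\<And>u i a j a' v b. u @ (i, a) # (j, a') # v \<in> reduced_words I A \<Longrightarrow> b \<in> carrier B \<Longrightarrow>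
      Fw (u @ (i, a \<otimes>\<^bsub>A i\<^esub> \<iota> i b) # (j, a') # v) = Fw (u @ (i, a) # (j, \<iota> j b \<otimes>\<^bsub>A j\<^esub> a') # v)"
    "\<And>N w d. (\<And>m. m < N \<Longrightarrow> w m \<in> reduced_words I A) \<Longrightarrow>
      nonneg (\<Sum>m<(N::nat). \<Sum>n<N. star (d m) * Fw (word_mult A (word_adj A (w m)) (w n)) * d n)"
    "\<And>u v. u \<in> reduced_words I A \<Longrightarrow> v \<in> reduced_words I A \<Longrightarrow>
      star (Fw (word_mult A (word_adj A u) v)) = Fw (word_mult A (word_adj A v) u)"
    "\<And>i a. i \<in> I \<Longrightarrow> a \<in> carrier (A i) \<Longrightarrow> Fw [(i, a)] = lift D (\<theta> i a) 0"
    "\<And>i a j a' w. (i, a) # (j, a') # w \<in> reduced_words I A \<Longrightarrow> j < i \<Longrightarrow>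
      Fw ((i, a) # (j, a') # w) = lift D (\<theta> i a) 0 * Fw ((j, a') # w)"
    "\<And>w j a' i a. w @ [(j, a'), (i, a)] \<in> reduced_words I A \<Longrightarrow> j < i \<Longrightarrow>
      Fw (w @ [(j, a'), (i, a)]) = Fw (w @ [(j, a')]) * lift D (\<theta> i a) 0"
    "\<And>u i a k a' j a'' v. u @ [(i, a), (k, a'), (j, a'')] @ v \<in> reduced_words I A \<Longrightarrow> i < k \<Longrightarrow> j < k \<Longrightarrow>
      Fw (u @ [(i, a), (k, a'), (j, a'')] @ v) =
        Fw (word_mult A (u @ [(i, a)]) (word_left A \<iota> (\<psi> k a') ((j, a'') # v)))
        + Fw (u @ [(i, a)]) * lift D (\<theta> k a' \<ominus>\<^bsub>D\<^esub> \<kappa> (\<psi> k a')) 0 * Fw ((j, a'') # v)"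
    "\<And>w b. w \<in> reduced_words I A \<Longrightarrow> b \<in> carrier B \<Longrightarrow> Fw (word_left A \<iota> b w) = lift D (\<kappa> b) 0 * Fw w"
    "\<And>w b. w \<in> reduced_words I A \<Longrightarrow> b \<in> carrier B \<Longrightarrow> Fw (word_right A \<iota> w b) = Fw w * lift D (\<kappa> b) 0"
\<comment> \<open>For empty I there are no words; otherwise an element of I makes the lifted data
  total.\<close>
proof (cases "I = {}")
  case True
  then have "reduced_words I A = {}" by (auto simp: reduced_words_def) (metis empty_iff list.set_intros(1) neq_Nil_conv prod.exhaust)
  then show ?thesis
    by (intro that[of "\<lambda>_. 0"]) (use True in \<open>simp_all add: nonneg_sum\<close>)
next
  case False
  then obtain i0 where i0: "i0 \<in> I" by blast
  interpret M: monotone_data "\<theta>U i0" "\<psi>U i0" "\<iota>U i0" \<kappa>U by (rule lifted_data[OF i0])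
  \<comment> \<open>Letters are lifted with character 0, so that lifting respects sums, products,
    scalars and adjoints.\<close>
  define lw where "lw = map (\<lambda>(i, a). (i, lift (A i) a 0))"
  define Fw where "Fw w = M.F (lw w)" for w
  have lw [simp]: "lw [] = []" "lw ((i, a) # w) = (i, lift (A i) a 0) # lw w" "lw (u @ v) = lw u @ lw v" for i a w u v
    by (simp_all add: lw_def)
  have sel: "sel i0 i = i" if "i \<in> I" for i using that by (simp add: sel_def)
  have \<iota>l: "\<iota>U i0 i (lift B b 0) = lift (A i) (\<iota> i b) 0" if "i \<in> I" "b \<in> carrier B" for i b
    using that by (simp add: \<iota>U_def sel coord_lift char_lift B)
  have \<theta>l: "\<theta>U i0 i (lift (A i) a 0) = lift D (\<theta> i a) 0" if "i \<in> I" "a \<in> carrier (A i)" for i a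
    using that by (simp add: \<theta>U_def sel coord_lift char_lift A)
  have \<psi>l: "\<psi>U i0 i (lift (A i) a 0) = lift B (\<psi> i a) 0" if "i \<in> I" "a \<in> carrier (A i)" for i a
    using that by (simp add: \<psi>U_def sel coord_lift char_lift A)
  have \<kappa>l: "\<kappa>U (lift B b 0) = lift D (\<kappa> b) 0" if "b \<in> carrier B" for b
    using that by (simp add: \<kappa>U_def coord_lift char_lift B)
  have lmul: "lift (A i) (a \<otimes>\<^bsub>A i\<^esub> a') 0 = lift (A i) a 0 * lift (A i) a' 0"
    if "i \<in> I" "a \<in> carrier (A i)" "a' \<in> carrier (A i)" for i a a'
    using that by (simp add: lift_mult A)
  have mult: "Fw (word_mult A u v) = M.F (lw u @ lw v)"
    if uv: "u \<in> reduced_words I A" "v \<in> reduced_words I A" for u v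
  proof -
    obtain u' i a where u: "u = u' @ [(i, a)]" using uv(1) by (auto simp: reduced_words_def) (metis rev_exhaust surj_pair)
    obtain v' j c where v: "v = (j, c) # v'" using uv(2) by (auto simp: reduced_words_def) (metis neq_Nil_conv surj_pair)
    have l: "i \<in> I" "a \<in> carrier (A i)" "j \<in> I" "c \<in> carrier (A j)"
      using reduced_letters[OF uv(1), of i a] reduced_letters[OF uv(2), of j c] u v by auto
    show ?thesis
    proof (cases "i = j")
      case True
      then show ?thesis using M.F_merge[of "lw u'" i "lift (A i) a 0" "lift (A i) c 0" "lw v'"] l
        by (simp add: Fw_def word_mult_def u v lmul del: M.G.simps)
    qed (simp add: Fw_def word_mult_def u v)
  qed
  have adjw: "lw (word_adj A u) = word_star (lw u)" if "\<forall>(i, a)\<in>set u. i \<in> I \<and> a \<in> carrier (A i)" for u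
    using that by (induction u) (auto simp: word_adj_def lift_star A)
  have adjr: "word_adj A u \<in> reduced_words I A" if "u \<in> reduced_words I A" for u
  proof -
    have "map fst (word_adj A u) = rev (map fst u)" by (simp add: word_adj_def rev_map case_prod_beta comp_def)
    then show ?thesis using that
      by (auto simp: reduced_words_def distinct_adj_rev word_adj_def cstar_algebra.adj_closed A)
  qed
  have kern: "Fw (word_mult A (word_adj A u) v) = M.F (word_star (lw u) @ lw v)"
    if "u \<in> reduced_words I A" "v \<in> reduced_words I A" for u v
    using mult[OF adjr[OF that(1)] that(2)] adjw[of u] that(1) by (simp add: reduced_words_def del: M.G.simps)
  show ?thesis
  proof (rule that[of Fw])
    fix u i a v a' assume "u @ (i, a) # v \<in> reduced_words I A" "a' \<in> carrier (A i)"
    then show "Fw (u @ (i, a \<oplus>\<^bsub>A i\<^esub> a') # v) = Fw (u @ (i, a) # v) + Fw (u @ (i, a') # v)"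
      using reduced_letter[of u i a v] A M.F_add[of "lw u" i "lift (A i) a 0" "lift (A i) a' 0" "lw v"]
      by (simp add: Fw_def lift_add del: M.G.simps)
  next
    fix u i a v c assume "u @ (i, a) # v \<in> reduced_words I A"
    then show "Fw (u @ (i, c \<odot>\<^bsub>A i\<^esub> a) # v) = scal c * Fw (u @ (i, a) # v)"
      using reduced_letter[of u i a v] A M.F_scal[of "lw u" i c "lift (A i) a 0" "lw v"]
      by (simp add: Fw_def lift_scal del: M.G.simps)
  next
    fix u i a j a' v b assume r: "u @ (i, a) # (j, a') # v \<in> reduced_words I A" and b: "b \<in> carrier B"
    have l: "i \<in> I" "a \<in> carrier (A i)" "j \<in> I" "a' \<in> carrier (A j)"
      using reduced_letters[OF r, of i a] reduced_letters[OF r, of j a'] by auto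
    then show "Fw (u @ (i, a \<otimes>\<^bsub>A i\<^esub> \<iota> i b) # (j, a') # v) = Fw (u @ (i, a) # (j, \<iota> j b \<otimes>\<^bsub>A j\<^esub> a') # v)"
      using M.F_balanced[of "lw u" i "lift (A i) a 0" "lift B b 0" j "lift (A j) a' 0" "lw v"] b
      by (simp add: Fw_def lmul \<iota>_hom(1) \<iota>l del: M.G.simps)
  next
    fix N :: nat and w :: "nat \<Rightarrow> ('i \<times> 'a) list" and d assume "\<And>m. m < N \<Longrightarrow> w m \<in> reduced_words I A"
    then have "(\<Sum>m<N. \<Sum>n<N. star (d m) * Fw (word_mult A (word_adj A (w m)) (w n)) * d n) = M.Q N (\<lambda>m. lw (w m)) d"
      unfolding M.Q_def by (intro sum.cong refl) (simp add: kern del: M.G.simps)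
    then show "nonneg (\<Sum>m<N. \<Sum>n<N. star (d m) * Fw (word_mult A (word_adj A (w m)) (w n)) * d n)"
      by (simp add: M.Q_nonneg)
  next
    fix u v assume "u \<in> reduced_words I A" "v \<in> reduced_words I A"
    then show "star (Fw (word_mult A (word_adj A u) v)) = Fw (word_mult A (word_adj A v) u)"
      using M.F_star[of "word_star (lw u) @ lw v"] by (simp add: kern del: M.G.simps)
  next
    fix i a assume "i \<in> I" "a \<in> carrier (A i)"
    then show "Fw [(i, a)] = lift D (\<theta> i a) 0" by (simp add: Fw_def \<theta>l)
  next
    fix i a j a' w assume r: "(i, a) # (j, a') # w \<in> reduced_words I A" and ji: "j < i"
    have "i \<in> I" "a \<in> carrier (A i)" using reduced_letters[OF r, of i a] by auto
    then show "Fw ((i, a) # (j, a') # w) = lift D (\<theta> i a) 0 * Fw ((j, a') # w)"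
      using ji by (simp add: Fw_def M.F_descent \<theta>l del: M.G.simps)
  next
    fix w j a' i a assume r: "w @ [(j, a'), (i, a)] \<in> reduced_words I A" and ji: "j < i"
    have "i \<in> I" "a \<in> carrier (A i)" using reduced_letters[OF r, of i a] by auto
    then show "Fw (w @ [(j, a'), (i, a)]) = Fw (w @ [(j, a')]) * lift D (\<theta> i a) 0"
      using ji by (simp add: Fw_def M.F_ascent \<theta>l del: M.G.simps)
  next
    fix u i a k a' j a'' v
    assume r: "u @ [(i, a), (k, a'), (j, a'')] @ v \<in> reduced_words I A" and ik: "i < k" and jk: "j < k"
    have l: "i \<in> I" "a \<in> carrier (A i)" "k \<in> I" "a' \<in> carrier (A k)" "j \<in> I" "a'' \<in> carrier (A j)"
      using reduced_letters[OF r, of i a] reduced_letters[OF r, of k a'] reduced_letters[OF r, of j a''] by auto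
    have c: "\<psi> k a' \<in> carrier B" "\<iota> j (\<psi> k a') \<in> carrier (A j)" "\<kappa> (\<psi> k a') \<in> carrier D" "\<theta> k a' \<in> carrier D"
      using l by (auto intro: \<psi>_map \<iota>_hom \<kappa>_hom \<theta>_map)
    let ?v = "word_left A \<iota> (\<psi> k a') ((j, a'') # v)"
    have rv: "u @ [(i, a)] \<in> reduced_words I A" "?v \<in> reduced_words I A"
      using r c(2) l ringA[OF l(5)]
      by (auto simp: reduced_words_def word_left_def distinct_adj_append_iff distinct_adj_Cons ring_def monoid.m_closed)
    have "Fw (word_mult A (u @ [(i, a)]) ?v) = M.F (lw u @ (i, lift (A i) a 0) # (j, \<iota>U i0 j (lift B (\<psi> k a') 0) * lift (A j) a'' 0) # lw v)"
      unfolding mult[OF rv] using l c by (simp add: word_left_def lmul \<iota>l del: M.G.simps)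
    then show "Fw (u @ [(i, a), (k, a'), (j, a'')] @ v) =
        Fw (word_mult A (u @ [(i, a)]) ?v) + Fw (u @ [(i, a)]) * lift D (\<theta> k a' \<ominus>\<^bsub>D\<^esub> \<kappa> (\<psi> k a')) 0 * Fw ((j, a'') # v)"
      using M.F_peak[OF ik jk, of "lw u" "lift (A i) a 0" "lift (A k) a' 0" "lift (A j) a'' 0" "lw v"] l c
        lift_diff[OF D c(4) c(3), of 0 0]
      by (simp add: Fw_def M.F_balanced \<psi>l \<kappa>l \<theta>l del: M.G.simps)
  next
    fix w b assume r: "w \<in> reduced_words I A" and b: "b \<in> carrier B"
    obtain i a v where w: "w = (i, a) # v" using r by (auto simp: reduced_words_def) (metis neq_Nil_conv surj_pair)
    have "i \<in> I" "a \<in> carrier (A i)" using reduced_letters[OF r, of i a] w by auto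
    then show "Fw (word_left A \<iota> b w) = lift D (\<kappa> b) 0 * Fw w"
      using M.F_left[of i "lift B b 0" "lift (A i) a 0" "lw v"] b
      by (simp add: w word_left_def Fw_def lmul \<iota>_hom(1) \<iota>l \<kappa>l del: M.G.simps)
  next
    fix w b assume r: "w \<in> reduced_words I A" and b: "b \<in> carrier B"
    obtain i a v where w: "w = v @ [(i, a)]" using r by (auto simp: reduced_words_def) (metis rev_exhaust surj_pair)
    have "i \<in> I" "a \<in> carrier (A i)" using reduced_letters[OF r, of i a] w by auto
    then show "Fw (word_right A \<iota> w b) = Fw w * lift D (\<kappa> b) 0"
      using M.F_right[of "lw v" i "lift (A i) a 0" "lift B b 0"] b
      by (simp add: w word_right_def Fw_def lmul \<iota>_hom(1) \<iota>l \<kappa>l del: M.G.simps)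
  qed
qed

end

section \<open>The free product\<close>

text \<open>\<open>h w c\<close> has to be additive in c rather than linear, so that linear
  extensions and conjugate linear ones, such as the adjoint, are treated alike.\<close>

definition lsum :: "('w \<Rightarrow> complex \<Rightarrow> 'e::comm_monoid_add) \<Rightarrow> ('w \<Rightarrow>\<^sub>0 complex) \<Rightarrow> 'e" where
  "lsum h x = (\<Sum>w\<in>Poly_Mapping.keys x. h w (Poly_Mapping.lookup x w))"

lemma lsum_superset:
  assumes "\<And>w. h w 0 = 0" "finite S" "Poly_Mapping.keys x \<subseteq> S"
  shows "lsum h x = (\<Sum>w\<in>S. h w (Poly_Mapping.lookup x w))"
  unfolding lsum_def
  by (rule sum.mono_neutral_left) (use assms in \<open>auto simp: in_keys_iff\<close>)

lemma lsum_add: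
  assumes "\<And>w. h w 0 = 0" "\<And>w a b. h w (a + b) = h w a + h w b"
  shows "lsum h (x + y) = lsum h x + lsum h y"
proof -
  let ?S = "Poly_Mapping.keys x \<union> Poly_Mapping.keys y"
  have "lsum h z = (\<Sum>w\<in>?S. h w (Poly_Mapping.lookup z w))" if "Poly_Mapping.keys z \<subseteq> ?S" for z
    by (rule lsum_superset) (use assms that in auto)
  then show ?thesis using Poly_Mapping.keys_add[of x y]
    by (simp add: lookup_add assms(2) sum.distrib)
qed

lemma lsum_0 [simp]: "lsum h 0 = 0"
  by (simp add: lsum_def)

lemma lsum_single: "h w 0 = 0 \<Longrightarrow> lsum h (Poly_Mapping.single w c) = h w c"
  by (simp add: lsum_def)

lemma lsum_sum:
  assumes "\<And>w. h w 0 = 0" "\<And>w a b. h w (a + b) = h w a + h w b"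
  shows "lsum h (sum f S) = (\<Sum>s\<in>S. lsum h (f s))"
  by (induction S rule: infinite_finite_induct) (simp_all add: lsum_add[OF assms])

lemma lsum_diff:
  fixes h :: "'w \<Rightarrow> complex \<Rightarrow> 'e::ab_group_add"
  assumes "\<And>w. h w 0 = 0" "\<And>w a b. h w (a + b) = h w a + h w b"
  shows "lsum h (x - y) = lsum h x - lsum h y"
  using lsum_add[of h "x - y" y, OF assms] by (simp add: algebra_simps)

definition scale :: "complex \<Rightarrow> ('w \<Rightarrow>\<^sub>0 complex) \<Rightarrow> ('w \<Rightarrow>\<^sub>0 complex)" where
  "scale c = Poly_Mapping.map ((*) c)"

lemma lookup_scale [simp]: "Poly_Mapping.lookup (scale c x) w = c * Poly_Mapping.lookup x w"
  by (simp add: scale_def Poly_Mapping.map.rep_eq when_def)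

lemma keys_scale: "Poly_Mapping.keys (scale c x) \<subseteq> Poly_Mapping.keys x"
  by (auto simp: in_keys_iff)

lemma scale_single [simp]: "scale c (Poly_Mapping.single w d) = Poly_Mapping.single w (c * d)"
  by (rule poly_mapping_eqI) (simp add: lookup_single when_def)

lemma scale_add: "scale c (x + y) = scale c x + scale c y"
  by (rule poly_mapping_eqI) (simp add: lookup_add distrib_left)

lemma scale_minus_1: "scale (- 1) x = - x"
  by (rule poly_mapping_eqI) simp

lemma scale_sum: "scale c (sum f S) = (\<Sum>s\<in>S. scale c (f s))"
  by (induction S rule: infinite_finite_induct) (simp_all add: scale_add, auto simp: poly_mapping_eq_iff fun_eq_iff)

lemma lsum_scale:
  assumes "\<And>w. h w 0 = 0"
  shows "lsum h (scale c x) = (\<Sum>w\<in>Poly_Mapping.keys x. h w (c * Poly_Mapping.lookup x w))"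
  using lsum_superset[of h "Poly_Mapping.keys x" "scale c x", OF assms _ keys_scale] by simp

lemma sum_single: "x = (\<Sum>w\<in>Poly_Mapping.keys x. Poly_Mapping.single w (Poly_Mapping.lookup x w))"
  by (rule poly_mapping_eqI) (simp add: lookup_sum lookup_single when_def in_keys_iff)

lemma linear_extension_lsum: "linear_extension g = lsum (\<lambda>w. Poly_Mapping.single (g w))"
  by (simp add: linear_extension_def lsum_def fun_eq_iff)

lemma linear_extension_simps:
  "linear_extension g (x + y) = linear_extension g x + linear_extension g y"
  "linear_extension g (x - y) = linear_extension g x - linear_extension g y"
  "linear_extension g 0 = 0"
  "linear_extension g (Poly_Mapping.single w c) = Poly_Mapping.single (g w) c"
  "linear_extension g (scale c x) = scale c (linear_extension g x)"
  unfolding linear_extension_lsum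
  by (simp_all add: lsum_add lsum_diff lsum_single single_add lsum_scale)
     (simp add: lsum_def scale_sum)

lemma keys_lsum_single:
  "Poly_Mapping.keys (\<Sum>w\<in>S. Poly_Mapping.single (g w) (c w)) \<subseteq> g ` S"
  by (rule order_trans[OF Poly_Mapping.keys_sum]) auto

context monotone_setup
begin

abbreviation RW where "RW \<equiv> reduced_words I A"
abbreviation W where "W \<equiv> word_algebra I A"
abbreviation TR where "TR \<equiv> tensor_relations I A B \<iota>"
abbreviation FP where "FP \<equiv> free_product I A B \<iota>"
abbreviation cl where "cl \<equiv> quotient_class I A B \<iota>"

definition wmult where
  "wmult x y = lsum (\<lambda>u c. lsum (\<lambda>v d. Poly_Mapping.single (word_mult A u v) (c * d)) y) x"

definition wadj where
  "wadj x = lsum (\<lambda>w c. Poly_Mapping.single (word_adj A w) (cnj c)) x"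

lemma W_simps [simp]:
  "carrier W = {x. Poly_Mapping.keys x \<subseteq> RW}" "x \<otimes>\<^bsub>W\<^esub> y = wmult x y" "\<zero>\<^bsub>W\<^esub> = 0"
  "x \<oplus>\<^bsub>W\<^esub> y = x + y" "c \<odot>\<^bsub>W\<^esub> x = scale c x" "adj W x = wadj x"
  by (simp_all add: word_algebra_def wmult_def wadj_def lsum_def scale_def)

lemma RW_replace: "u @ (i, a) # v \<in> RW \<Longrightarrow> a' \<in> carrier (A i) \<Longrightarrow> u @ (i, a') # v \<in> RW"
  by (auto simp: reduced_words_def)

lemma TR_scale: "x \<in> TR \<Longrightarrow> scale c x \<in> TR"
  unfolding scale_def by (rule tensor_relations.scale)

lemma TR_uminus: "x \<in> TR \<Longrightarrow> - x \<in> TR"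
  using TR_scale[of x "- 1"] by (simp add: scale_minus_1)

lemma TR_sum: "(\<And>s. s \<in> S \<Longrightarrow> f s \<in> TR) \<Longrightarrow> sum f S \<in> TR"
  by (induction S rule: infinite_finite_induct) (auto intro: tensor_relations.zero tensor_relations.add)

lemma TR_carrier: "x \<in> TR \<Longrightarrow> Poly_Mapping.keys x \<subseteq> RW"
proof (induction rule: tensor_relations.induct)
  case (add x y)
  then show ?case using Poly_Mapping.keys_add[of x y] by blast
next
  case (scale x c)
  then show ?case using keys_scale[of c x] unfolding scale_def by blast
next
  case (additive u i a v a')
  then have i: "i \<in> I" "a \<in> carrier (A i)" using reduced_letter by blast+
  interpret Ai: ring "A i" by (rule ringA[OF i(1)])
  have "u @ (i, a \<oplus>\<^bsub>A i\<^esub> a') # v \<in> RW" "u @ (i, a') # v \<in> RW"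
    using additive i by (auto intro: RW_replace)
  then show ?case using additive by (intro order_trans[OF keys_diff] Un_least) auto
next
  case (homogeneous u i a v c)
  then have i: "i \<in> I" "a \<in> carrier (A i)" using reduced_letter by blast+
  have "u @ (i, c \<odot>\<^bsub>A i\<^esub> a) # v \<in> RW"
    using homogeneous cstar_algebra.scalar_closed[OF A[OF i(1)] i(2)] by (auto intro: RW_replace)
  then show ?case using homogeneous by (intro order_trans[OF keys_diff] Un_least) auto
next
  case (balanced u i a j a' v b)
  then have i: "i \<in> I" "a \<in> carrier (A i)" and j: "j \<in> I" "a' \<in> carrier (A j)"
    using reduced_letters[OF balanced(1), of i a] reduced_letters[OF balanced(1), of j a'] by auto
  interpret Ai: ring "A i" by (rule ringA[OF i(1)])
  interpret Aj: ring "A j" by (rule ringA[OF j(1)])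
  have "u @ (i, a \<otimes>\<^bsub>A i\<^esub> \<iota> i b) # (j, a') # v \<in> RW"
    using balanced i \<iota>_hom(1)[OF i(1)] by (auto intro: RW_replace)
  moreover have "(u @ [(i, a)]) @ (j, \<iota> j b \<otimes>\<^bsub>A j\<^esub> a') # v \<in> RW"
    by (rule RW_replace[where a = a']) (use balanced j \<iota>_hom(1)[OF j(1)] in auto)
  ultimately show ?case by (intro order_trans[OF keys_diff] Un_least) auto
qed auto

section \<open>The relations form a two-sided ideal stable under the adjoint and the action of
  B\<close>

lemma cl_eq: "cl x = {r + x | r. r \<in> TR}"
  by (auto simp: quotient_class_def a_r_coset_def')

lemma cl_self: "x \<in> cl x"
  using tensor_relations.zero[of I A B \<iota>] by (force simp: cl_eq)

lemma cl_eqI: "x - y \<in> TR \<Longrightarrow> cl x = cl y"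
proof -
  have *: "cl x \<subseteq> cl y" if "x - y \<in> TR" for x y
  proof
    fix z assume "z \<in> cl x"
    then obtain r where r: "r \<in> TR" "z = r + x" by (auto simp: cl_eq)
    then have "z = (r + (x - y)) + y" "r + (x - y) \<in> TR" using that by (auto intro: tensor_relations.add)
    then show "z \<in> cl y" unfolding cl_eq by blast
  qed
  assume "x - y \<in> TR"
  then show ?thesis using *[of x y] *[of y x] TR_uminus[of "x - y"] by auto
qed

text \<open>Operations on classes are unions over all representatives; the union is a single class
  as soon as the operation respects the relations.\<close>

lemma cl_UN:
  assumes "\<And>r. r \<in> TR \<Longrightarrow> T (r + x) - T x \<in> TR"
  shows "(\<Union>z\<in>cl x. cl (T z)) = cl (T x)"
proof -
  have "cl (T z) = cl (T x)" if "z \<in> cl x" for z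
    using that assms by (auto simp: cl_eq intro!: cl_eqI[unfolded cl_eq])
  then show ?thesis using cl_self[of x] by blast
qed

text \<open>Common shape of left multiplication by a fixed word and of the left action of B, so that
  one argument shows that both respect the relations. Prefix and factor depend on the first index,
  which decides whether two letters meet in one algebra.\<close>

definition good_left where
  "good_left g p l \<longleftrightarrow> (\<forall>i a v. (i, a) # v \<in> RW \<longrightarrow>
     l i \<in> carrier (A i) \<and> g ((i, a) # v) = p i @ (i, l i \<otimes>\<^bsub>A i\<^esub> a) # v \<and> p i @ (i, l i \<otimes>\<^bsub>A i\<^esub> a) # v \<in> RW)"

definition good_right where
  "good_right g q r \<longleftrightarrow> (\<forall>i a u. u @ [(i, a)] \<in> RW \<longrightarrow>
     r i \<in> carrier (A i) \<and> g (u @ [(i, a)]) = u @ (i, a \<otimes>\<^bsub>A i\<^esub> r i) # q i \<and> u @ (i, a \<otimes>\<^bsub>A i\<^esub> r i) # q i \<in> RW)"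

definition letter_map where
  "letter_map i f \<longleftrightarrow> (\<forall>a\<in>carrier (A i). f a \<in> carrier (A i) \<and>
     (\<forall>a'\<in>carrier (A i). f (a \<oplus>\<^bsub>A i\<^esub> a') = f a \<oplus>\<^bsub>A i\<^esub> f a') \<and> (\<forall>c. f (c \<odot>\<^bsub>A i\<^esub> a) = c \<odot>\<^bsub>A i\<^esub> f a))"

lemma letter_map_left:
  assumes "i \<in> I" "l \<in> carrier (A i)"
  shows "letter_map i (\<lambda>a. l \<otimes>\<^bsub>A i\<^esub> a)"
proof -
  interpret Ai: ring "A i" by (rule ringA[OF assms(1)])
  show ?thesis using assms cstar_algebra.smult_mult_right[OF A[OF assms(1)] assms(2)]
    by (simp add: letter_map_def Ai.r_distr)
qed

lemma letter_map_right:
  assumes "i \<in> I" "r \<in> carrier (A i)"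
  shows "letter_map i (\<lambda>a. a \<otimes>\<^bsub>A i\<^esub> r)"
proof -
  interpret Ai: ring "A i" by (rule ringA[OF assms(1)])
  show ?thesis using assms cstar_algebra.smult_mult_left[OF A[OF assms(1)] _ assms(2)]
    by (simp add: letter_map_def Ai.l_distr)
qed

lemma letter_map_id: "i \<in> I \<Longrightarrow> letter_map i (\<lambda>a. a)"
  by (simp add: letter_map_def)

text \<open>Seen from a marked letter the map changes that letter by f and otherwise only what
  stands before it: f is a left multiplication if the letter is the first one, and the identity if
  not.\<close>

lemma good_left_shape:
  assumes g: "good_left g p l" and w: "u @ (i, a0) # v0 \<in> RW"
  obtains P f where "letter_map i f"
    "\<And>a b. a \<in> carrier (A i) \<Longrightarrow> b \<in> carrier (A i) \<Longrightarrow> f (a \<otimes>\<^bsub>A i\<^esub> b) = f a \<otimes>\<^bsub>A i\<^esub> b"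
    "\<And>a v. u @ (i, a) # v \<in> RW \<Longrightarrow> g (u @ (i, a) # v) = P @ (i, f a) # v \<and> P @ (i, f a) # v \<in> RW"
proof (cases u)
  case Nil
  have i: "i \<in> I" using reduced_letter[OF w] by simp
  interpret Ai: ring "A i" by (rule ringA[OF i])
  have l: "l i \<in> carrier (A i)" using g w Nil unfolding good_left_def by auto
  show ?thesis
    by (rule that[of "\<lambda>a. l i \<otimes>\<^bsub>A i\<^esub> a" "p i"])
      (use g l Nil i in \<open>auto simp: good_left_def Ai.m_assoc letter_map_left\<close>)
next
  case (Cons x u')
  obtain k c where x: "x = (k, c)" by fastforce
  have i: "i \<in> I" using reduced_letter[OF w] by simp
  show ?thesis
    by (rule that[of "\<lambda>a. a" "p k @ (k, l k \<otimes>\<^bsub>A k\<^esub> c) # u'"])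
      (use g Cons x i in \<open>auto simp: good_left_def letter_map_id\<close>)
qed

lemma good_right_shape:
  assumes g: "good_right g q r" and w: "u0 @ (i, a0) # v \<in> RW"
  obtains Q f where "letter_map i f"
    "\<And>a b. a \<in> carrier (A i) \<Longrightarrow> b \<in> carrier (A i) \<Longrightarrow> f (b \<otimes>\<^bsub>A i\<^esub> a) = b \<otimes>\<^bsub>A i\<^esub> f a"
    "\<And>a u. u @ (i, a) # v \<in> RW \<Longrightarrow> g (u @ (i, a) # v) = u @ (i, f a) # Q \<and> u @ (i, f a) # Q \<in> RW"
proof (cases v rule: rev_cases)
  case Nil
  have i: "i \<in> I" using reduced_letter[OF w] by simp
  interpret Ai: ring "A i" by (rule ringA[OF i])
  have l: "r i \<in> carrier (A i)" using g w Nil unfolding good_right_def by auto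
  show ?thesis
    by (rule that[of "\<lambda>a. a \<otimes>\<^bsub>A i\<^esub> r i" "q i"])
      (use g l Nil i in \<open>auto simp: good_right_def Ai.m_assoc letter_map_right\<close>)
next
  case (snoc v' x)
  obtain k c where x: "x = (k, c)" by fastforce
  have i: "i \<in> I" using reduced_letter[OF w] by simp
  have *: "u @ (i, a) # v = (u @ (i, a) # v') @ [(k, c)]" for u a by (simp add: snoc x)
  show ?thesis
  proof (rule that[of "\<lambda>a. a" "v' @ (k, c \<otimes>\<^bsub>A k\<^esub> r k) # q k"])
    fix a u assume "u @ (i, a) # v \<in> RW"
    then have "(u @ (i, a) # v') @ [(k, c)] \<in> RW" unfolding * .
    then show "g (u @ (i, a) # v) = u @ (i, a) # v' @ (k, c \<otimes>\<^bsub>A k\<^esub> r k) # q k \<and>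
        u @ (i, a) # v' @ (k, c \<otimes>\<^bsub>A k\<^esub> r k) # q k \<in> RW"
      using g unfolding * good_right_def by fastforce
  qed (use i in \<open>auto simp: letter_map_id\<close>)
qed

text \<open>By the shape lemma each generating relation goes to one of the same kind with f(a) in
  place of a. Balancing survives because f commutes with right multiplication.\<close>

lemma TR_left:
  assumes g: "good_left g p l" and x: "x \<in> TR"
  shows "linear_extension g x \<in> TR"
  using x
proof (induction rule: tensor_relations.induct)
  case (scale x c)
  then show ?case by (simp add: linear_extension_simps TR_scale flip: scale_def)
next
  case (additive u i a v a')
  then have i: "i \<in> I" "a \<in> carrier (A i)" using reduced_letter by blast+
  interpret Ai: ring "A i" by (rule ringA[OF i(1)])
  obtain P f where f: "letter_map i f"
    "\<And>a v. u @ (i, a) # v \<in> RW \<Longrightarrow> g (u @ (i, a) # v) = P @ (i, f a) # v \<and> P @ (i, f a) # v \<in> RW"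
    using good_left_shape[OF g additive(1)] by metis
  have "u @ (i, a \<oplus>\<^bsub>A i\<^esub> a') # v \<in> RW" "u @ (i, a') # v \<in> RW"
    using additive i by (auto intro: RW_replace)
  then show ?case
    using tensor_relations.additive[of P i "f a" v I A "f a'" B \<iota>] f additive i
    by (simp add: linear_extension_simps letter_map_def)
next
  case (homogeneous u i a v c)
  then have i: "i \<in> I" "a \<in> carrier (A i)" using reduced_letter by blast+
  obtain P f where f: "letter_map i f"
    "\<And>a v. u @ (i, a) # v \<in> RW \<Longrightarrow> g (u @ (i, a) # v) = P @ (i, f a) # v \<and> P @ (i, f a) # v \<in> RW"
    using good_left_shape[OF g homogeneous] by metis
  have "u @ (i, c \<odot>\<^bsub>A i\<^esub> a) # v \<in> RW"
    using homogeneous cstar_algebra.scalar_closed[OF A[OF i(1)] i(2)] by (auto intro: RW_replace)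
  then show ?case
    using tensor_relations.homogeneous[of P i "f a" v I A c B \<iota>] f homogeneous i
    by (simp add: linear_extension_simps letter_map_def)
next
  case (balanced u i a j a' v b)
  then have i: "i \<in> I" "a \<in> carrier (A i)" and j: "j \<in> I" "a' \<in> carrier (A j)"
    using reduced_letters[OF balanced(1), of i a] reduced_letters[OF balanced(1), of j a'] by auto
  interpret Ai: ring "A i" by (rule ringA[OF i(1)])
  interpret Aj: ring "A j" by (rule ringA[OF j(1)])
  obtain P f where f: "letter_map i f"
    "\<And>a b. a \<in> carrier (A i) \<Longrightarrow> b \<in> carrier (A i) \<Longrightarrow> f (a \<otimes>\<^bsub>A i\<^esub> b) = f a \<otimes>\<^bsub>A i\<^esub> b"
    "\<And>a v. u @ (i, a) # v \<in> RW \<Longrightarrow> g (u @ (i, a) # v) = P @ (i, f a) # v \<and> P @ (i, f a) # v \<in> RW"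
    using good_left_shape[OF g balanced(1)] by metis
  have "u @ (i, a \<otimes>\<^bsub>A i\<^esub> \<iota> i b) # (j, a') # v \<in> RW"
    using balanced i \<iota>_hom(1)[OF i(1)] by (auto intro: RW_replace)
  moreover have "(u @ [(i, a)]) @ (j, \<iota> j b \<otimes>\<^bsub>A j\<^esub> a') # v \<in> RW"
    by (rule RW_replace[where a = a']) (use balanced j \<iota>_hom(1)[OF j(1)] in auto)
  ultimately show ?case
    using tensor_relations.balanced[of P i "f a" j a' v I A b B \<iota>] f balanced i \<iota>_hom(1)[OF i(1)]
    by (simp add: linear_extension_simps)
qed (auto simp: linear_extension_simps intro: tensor_relations.zero tensor_relations.add)

lemma TR_right:
  assumes g: "good_right g q r" and x: "x \<in> TR"
  shows "linear_extension g x \<in> TR"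
  using x
proof (induction rule: tensor_relations.induct)
  case (scale x c)
  then show ?case by (simp add: linear_extension_simps TR_scale flip: scale_def)
next
  case (additive u i a v a')
  then have i: "i \<in> I" "a \<in> carrier (A i)" using reduced_letter by blast+
  interpret Ai: ring "A i" by (rule ringA[OF i(1)])
  obtain Q f where f: "letter_map i f"
    "\<And>a u. u @ (i, a) # v \<in> RW \<Longrightarrow> g (u @ (i, a) # v) = u @ (i, f a) # Q \<and> u @ (i, f a) # Q \<in> RW"
    using good_right_shape[OF g additive(1)] by metis
  have "u @ (i, a \<oplus>\<^bsub>A i\<^esub> a') # v \<in> RW" "u @ (i, a') # v \<in> RW"
    using additive i by (auto intro: RW_replace)
  then show ?case
    using tensor_relations.additive[of u i "f a" Q I A "f a'" B \<iota>] f additive i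
    by (simp add: linear_extension_simps letter_map_def)
next
  case (homogeneous u i a v c)
  then have i: "i \<in> I" "a \<in> carrier (A i)" using reduced_letter by blast+
  obtain Q f where f: "letter_map i f"
    "\<And>a u. u @ (i, a) # v \<in> RW \<Longrightarrow> g (u @ (i, a) # v) = u @ (i, f a) # Q \<and> u @ (i, f a) # Q \<in> RW"
    using good_right_shape[OF g homogeneous] by metis
  have "u @ (i, c \<odot>\<^bsub>A i\<^esub> a) # v \<in> RW"
    using homogeneous cstar_algebra.scalar_closed[OF A[OF i(1)] i(2)] by (auto intro: RW_replace)
  then show ?case
    using tensor_relations.homogeneous[of u i "f a" Q I A c B \<iota>] f homogeneous i
    by (simp add: linear_extension_simps letter_map_def)
next
  case (balanced u i a j a' v b)
  then have i: "i \<in> I" "a \<in> carrier (A i)" and j: "j \<in> I" "a' \<in> carrier (A j)"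
    using reduced_letters[OF balanced(1), of i a] reduced_letters[OF balanced(1), of j a'] by auto
  interpret Ai: ring "A i" by (rule ringA[OF i(1)])
  interpret Aj: ring "A j" by (rule ringA[OF j(1)])
  \<comment> \<open>Here the balanced relation is viewed from its right letter, the only one of the
    two that a map acting from the right can change.\<close>
  have r: "(u @ [(i, a)]) @ (j, a') # v \<in> RW" using balanced by simp
  obtain Q f where f: "letter_map j f"
    "\<And>a b. a \<in> carrier (A j) \<Longrightarrow> b \<in> carrier (A j) \<Longrightarrow> f (b \<otimes>\<^bsub>A j\<^esub> a) = b \<otimes>\<^bsub>A j\<^esub> f a"
    "\<And>a u. u @ (j, a) # v \<in> RW \<Longrightarrow> g (u @ (j, a) # v) = u @ (j, f a) # Q \<and> u @ (j, f a) # Q \<in> RW"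
    using good_right_shape[OF g r] by metis
  have "(u @ [(i, a \<otimes>\<^bsub>A i\<^esub> \<iota> i b)]) @ (j, a') # v \<in> RW"
    using balanced i \<iota>_hom(1)[OF i(1)] by (auto intro: RW_replace)
  moreover have "(u @ [(i, a)]) @ (j, \<iota> j b \<otimes>\<^bsub>A j\<^esub> a') # v \<in> RW"
    by (rule RW_replace[where a = a']) (use balanced j \<iota>_hom(1)[OF j(1)] in auto)
  ultimately show ?case
    using tensor_relations.balanced[of u i a j "f a'" Q I A b B \<iota>] balanced j \<iota>_hom(1)[OF j(1)]
      f(2)[of a' "\<iota> j b"] f(3)[OF r] f(3)[of "u @ [(i, a \<otimes>\<^bsub>A i\<^esub> \<iota> i b)]" a'] f(3)[of "u @ [(i, a)]" "\<iota> j b \<otimes>\<^bsub>A j\<^esub> a'"]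
    by (simp add: linear_extension_simps)
qed (auto simp: linear_extension_simps intro: tensor_relations.zero tensor_relations.add)

lemma RW_last:
  assumes "w \<in> RW"
  obtains u i a where "w = u @ [(i, a)]" "i \<in> I" "a \<in> carrier (A i)"
  using assms by (cases w rule: rev_cases) (auto simp: reduced_words_def)

lemma RW_head:
  assumes "w \<in> RW"
  obtains u i a where "w = (i, a) # u" "i \<in> I" "a \<in> carrier (A i)"
  using assms by (cases w) (auto simp: reduced_words_def)

lemma good_left_mult:
  assumes "w \<in> RW"
  shows "\<exists>p l. good_left (word_mult A w) p l"
proof -
  obtain u k c where w: "w = u @ [(k, c)]" "k \<in> I" "c \<in> carrier (A k)" using RW_last[OF assms] .
  \<comment> \<open>If the first index equals k, the letters meet: the prefix is w without its last
    letter, and the factor is that letter. Otherwise the prefix is w and the factor is 1.\<close>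
  have "good_left (word_mult A w) (\<lambda>i. if i = k then u else w) (\<lambda>i. if i = k then c else \<one>\<^bsub>A i\<^esub>)"
    unfolding good_left_def
  proof (intro allI impI)
    fix i a v assume r: "(i, a) # v \<in> RW"
    then have i: "i \<in> I" "a \<in> carrier (A i)" using reduced_letter[of "[]"] by auto
    interpret Ai: ring "A i" by (rule ringA[OF i(1)])
    show "(if i = k then c else \<one>\<^bsub>A i\<^esub>) \<in> carrier (A i) \<and>
        word_mult A w ((i, a) # v) = (if i = k then u else w) @ (i, (if i = k then c else \<one>\<^bsub>A i\<^esub>) \<otimes>\<^bsub>A i\<^esub> a) # v \<and>
        (if i = k then u else w) @ (i, (if i = k then c else \<one>\<^bsub>A i\<^esub>) \<otimes>\<^bsub>A i\<^esub> a) # v \<in> RW"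
      using i w assms r
      by (auto simp: word_mult_def reduced_words_def distinct_adj_append_iff distinct_adj_Cons)
  qed
  then show ?thesis by blast
qed

lemma good_right_mult:
  assumes "w \<in> RW"
  shows "\<exists>q r. good_right (\<lambda>u. word_mult A u w) q r"
proof -
  obtain v k c where w: "w = (k, c) # v" "k \<in> I" "c \<in> carrier (A k)" using RW_head[OF assms] .
  have "good_right (\<lambda>u. word_mult A u w) (\<lambda>i. if i = k then v else w) (\<lambda>i. if i = k then c else \<one>\<^bsub>A i\<^esub>)"
    unfolding good_right_def
  proof (intro allI impI)
    fix i a u assume r: "u @ [(i, a)] \<in> RW"
    then have i: "i \<in> I" "a \<in> carrier (A i)" using reduced_letter[of u] by auto
    interpret Ai: ring "A i" by (rule ringA[OF i(1)])
    show "(if i = k then c else \<one>\<^bsub>A i\<^esub>) \<in> carrier (A i) \<and>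
        word_mult A (u @ [(i, a)]) w = u @ (i, a \<otimes>\<^bsub>A i\<^esub> (if i = k then c else \<one>\<^bsub>A i\<^esub>)) # (if i = k then v else w) \<and>
        u @ (i, a \<otimes>\<^bsub>A i\<^esub> (if i = k then c else \<one>\<^bsub>A i\<^esub>)) # (if i = k then v else w) \<in> RW"
      using i w assms r
      by (auto simp: word_mult_def reduced_words_def distinct_adj_append_iff distinct_adj_Cons)
  qed
  then show ?thesis by blast
qed

lemma good_left_word_left:
  assumes b: "b \<in> carrier B"
  shows "good_left (word_left A \<iota> b) (\<lambda>_. []) (\<lambda>i. \<iota> i b)"
  unfolding good_left_def
proof (intro allI impI)
  fix i a v assume r: "(i, a) # v \<in> RW"
  then have i: "i \<in> I" "a \<in> carrier (A i)" using reduced_letter[of "[]"] by auto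
  interpret Ai: ring "A i" by (rule ringA[OF i(1)])
  show "\<iota> i b \<in> carrier (A i) \<and> word_left A \<iota> b ((i, a) # v) = [] @ (i, \<iota> i b \<otimes>\<^bsub>A i\<^esub> a) # v \<and>
      [] @ (i, \<iota> i b \<otimes>\<^bsub>A i\<^esub> a) # v \<in> RW"
    using i r \<iota>_hom(1)[OF i(1) b] by (auto simp: word_left_def reduced_words_def)
qed

lemma good_right_word_right:
  assumes b: "b \<in> carrier B"
  shows "good_right (\<lambda>w. word_right A \<iota> w b) (\<lambda>_. []) (\<lambda>i. \<iota> i b)"
  unfolding good_right_def
proof (intro allI impI)
  fix i a u assume r: "u @ [(i, a)] \<in> RW"
  then have i: "i \<in> I" "a \<in> carrier (A i)" using reduced_letter[of u] by auto
  interpret Ai: ring "A i" by (rule ringA[OF i(1)])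
  show "\<iota> i b \<in> carrier (A i) \<and> word_right A \<iota> (u @ [(i, a)]) b = u @ [(i, a \<otimes>\<^bsub>A i\<^esub> \<iota> i b)] \<and>
      u @ [(i, a \<otimes>\<^bsub>A i\<^esub> \<iota> i b)] \<in> RW"
    using i r \<iota>_hom(1)[OF i(1) b] by (auto simp: word_right_def reduced_words_def)
qed

lemma RW_mult: "u \<in> RW \<Longrightarrow> v \<in> RW \<Longrightarrow> word_mult A u v \<in> RW"
  using good_left_mult[of u] by (metis RW_head good_left_def)

lemma RW_left: "w \<in> RW \<Longrightarrow> b \<in> carrier B \<Longrightarrow> word_left A \<iota> b w \<in> RW"
  using good_left_word_left by (metis RW_head good_left_def)

lemma RW_right: "w \<in> RW \<Longrightarrow> b \<in> carrier B \<Longrightarrow> word_right A \<iota> w b \<in> RW"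
  using good_right_word_right by (metis RW_last good_right_def)

lemma RW_adj: "u \<in> RW \<Longrightarrow> word_adj A u \<in> RW"
proof -
  have "map fst (word_adj A u) = rev (map fst u)" by (simp add: word_adj_def rev_map case_prod_beta comp_def)
  moreover assume "u \<in> RW"
  ultimately show ?thesis
    by (auto simp: reduced_words_def distinct_adj_rev word_adj_def cstar_algebra.adj_closed A)
qed

lemma wadj_simps:
  "wadj (x + y) = wadj x + wadj y" "wadj (x - y) = wadj x - wadj y" "wadj 0 = 0"
  "wadj (Poly_Mapping.single w c) = Poly_Mapping.single (word_adj A w) (cnj c)"
  "wadj (scale c x) = scale (cnj c) (wadj x)"
  unfolding wadj_def
  by (simp_all add: lsum_add lsum_diff lsum_single single_add lsum_scale)
     (simp add: lsum_def scale_sum)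

lemma word_adj_split [simp]:
  "word_adj A (u @ v) = word_adj A v @ word_adj A u" "word_adj A ((i, a) # v) = word_adj A v @ [(i, adj (A i) a)]"
  "word_adj A [] = []"
  by (simp_all add: word_adj_def)

lemma TR_adj: "x \<in> TR \<Longrightarrow> wadj x \<in> TR"
proof (induction rule: tensor_relations.induct)
  case (scale x c)
  then show ?case by (simp add: wadj_simps TR_scale flip: scale_def)
next
  case (additive u i a v a')
  then have i: "i \<in> I" "a \<in> carrier (A i)" using reduced_letter by blast+
  interpret Ai': cstar_algebra "A i" by (rule A[OF i(1)])
  have "word_adj A v @ (i, adj (A i) a) # word_adj A u \<in> RW" using RW_adj[OF additive(1)] by simp
  then show ?case
    using tensor_relations.additive[of "word_adj A v" i "adj (A i) a" "word_adj A u" I A "adj (A i) a'" B \<iota>] additive i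
    by (simp add: wadj_simps Ai'.adj_closed Ai'.adj_add)
next
  case (homogeneous u i a v c)
  then have i: "i \<in> I" "a \<in> carrier (A i)" using reduced_letter by blast+
  interpret Ai': cstar_algebra "A i" by (rule A[OF i(1)])
  have "word_adj A v @ (i, adj (A i) a) # word_adj A u \<in> RW" using RW_adj[OF homogeneous(1)] by simp
  then show ?case
    using tensor_relations.homogeneous[of "word_adj A v" i "adj (A i) a" "word_adj A u" I A "cnj c" B \<iota>] i
    by (simp add: wadj_simps Ai'.adj_smult)
next
  case (balanced u i a j a' v b)
  then have i: "i \<in> I" "a \<in> carrier (A i)" and j: "j \<in> I" "a' \<in> carrier (A j)"
    using reduced_letters[OF balanced(1), of i a] reduced_letters[OF balanced(1), of j a'] by auto
  interpret Ai': cstar_algebra "A i" by (rule A[OF i(1)])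
  interpret Aj': cstar_algebra "A j" by (rule A[OF j(1)])
  interpret B': cstar_algebra B by (rule B)
  have "word_adj A v @ (j, adj (A j) a') # (i, adj (A i) a) # word_adj A u \<in> RW" using RW_adj[OF balanced(1)] by simp
  \<comment> \<open>The adjoint reverses the two letters, so a balanced relation becomes the
    negative of one for \<open>adj B b\<close>.\<close>
  from TR_uminus[OF tensor_relations.balanced[OF this, of "adj B b" B \<iota>]] show ?case
    using balanced i j by (simp add: wadj_simps Ai'.adj_mult Aj'.adj_mult \<iota>_hom B'.adj_closed)
qed (auto simp: wadj_simps intro: tensor_relations.zero tensor_relations.add)

lemma wmult_add_left: "wmult (x + x') y = wmult x y + wmult x' y"
  unfolding wmult_def by (rule lsum_add) (simp_all add: lsum_def distrib_right single_add sum.distrib)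

lemma wmult_add_right: "wmult x (y + y') = wmult x y + wmult x y'"
proof -
  have "lsum (\<lambda>v d. Poly_Mapping.single (word_mult A u v) (c * d)) (y + y')
     = lsum (\<lambda>v d. Poly_Mapping.single (word_mult A u v) (c * d)) y + lsum (\<lambda>v d. Poly_Mapping.single (word_mult A u v) (c * d)) y'" for u c
    by (rule lsum_add) (simp_all add: distrib_left single_add)
  then show ?thesis by (simp add: wmult_def) (simp add: lsum_def sum.distrib)
qed

text \<open>Together with its right-hand counterpart this reduces the ideal property of the
  relations to multiplication by a single word from one side.\<close>

lemma wmult_eq_left: "wmult x y = (\<Sum>u\<in>Poly_Mapping.keys x. scale (Poly_Mapping.lookup x u) (linear_extension (word_mult A u) y))"
  by (simp add: wmult_def lsum_def linear_extension_lsum scale_sum)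

lemma wmult_eq_right:
  "wmult x y = (\<Sum>v\<in>Poly_Mapping.keys y. scale (Poly_Mapping.lookup y v) (linear_extension (\<lambda>u. word_mult A u v) x))"
  unfolding wmult_def lsum_def linear_extension_lsum scale_sum scale_single
  by (subst sum.swap) (simp add: mult.commute)

lemma TR_mult_right: "Poly_Mapping.keys x \<subseteq> RW \<Longrightarrow> y \<in> TR \<Longrightarrow> wmult x y \<in> TR"
  unfolding wmult_eq_left by (intro TR_sum TR_scale) (metis TR_left good_left_mult subsetD)

lemma TR_mult_left: "x \<in> TR \<Longrightarrow> Poly_Mapping.keys y \<subseteq> RW \<Longrightarrow> wmult x y \<in> TR"
  unfolding wmult_eq_right by (intro TR_sum TR_scale) (metis TR_right good_right_mult subsetD)

section \<open>The operations of the free product on classes\<close>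

lemma FP_simps:
  "carrier FP = cl ` {x. Poly_Mapping.keys x \<subseteq> RW}" "\<zero>\<^bsub>FP\<^esub> = cl 0"
  by (auto simp: free_product_def A_RCOSETS_def' quotient_class_def a_r_coset_def')

lemma cl_closed: "Poly_Mapping.keys x \<subseteq> RW \<Longrightarrow> cl x \<in> carrier FP"
  unfolding FP_simps by blast

lemma FP_add: "cl x \<oplus>\<^bsub>FP\<^esub> cl y = cl (x + y)"
proof -
  have "cl x \<oplus>\<^bsub>FP\<^esub> cl y = {r + x + (r' + y) | r r'. r \<in> TR \<and> r' \<in> TR}"
    by (force simp: free_product_def set_add_def' cl_eq)
  also have "\<dots> = cl (x + y)"
  proof (intro equalityI subsetI)
    fix z assume "z \<in> {r + x + (r' + y) | r r'. r \<in> TR \<and> r' \<in> TR}"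
    then obtain r r' where r: "z = (r + r') + (x + y)" "r \<in> TR" "r' \<in> TR" by (auto simp: algebra_simps)
    then have "r + r' \<in> TR" by (auto intro: tensor_relations.add)
    then show "z \<in> cl (x + y)" using r by (auto simp: cl_eq)
  next
    fix z assume "z \<in> cl (x + y)"
    then obtain r where r: "z = r + (x + y)" "r \<in> TR" by (auto simp: cl_eq)
    have "z = r + x + (0 + y)" using r by (simp add: algebra_simps)
    then show "z \<in> {r + x + (r' + y) | r r'. r \<in> TR \<and> r' \<in> TR}"
      using r tensor_relations.zero by blast
  qed
  finally show ?thesis .
qed

lemma FP_mult:
  assumes "Poly_Mapping.keys x \<subseteq> RW" "Poly_Mapping.keys y \<subseteq> RW"
  shows "cl x \<otimes>\<^bsub>FP\<^esub> cl y = cl (wmult x y)"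
proof -
  have "cl x \<otimes>\<^bsub>FP\<^esub> cl y = (\<Union>z\<in>cl x. \<Union>z'\<in>cl y. cl (wmult z z'))"
    by (simp add: free_product_def rcoset_mult_def quotient_class_def)
  also have "\<dots> = cl (wmult x y)"
  proof -
    have "cl (wmult z z') = cl (wmult x y)" if zz: "z \<in> cl x" "z' \<in> cl y" for z z'
    proof (rule cl_eqI)
      obtain r r' where r: "z = r + x" "r \<in> TR" "z' = r' + y" "r' \<in> TR" using zz by (auto simp: cl_eq)
      have "Poly_Mapping.keys z' \<subseteq> RW" using r TR_carrier[of r'] assms Poly_Mapping.keys_add[of r' y] by blast
      \<comment> \<open>With z = r + x and z' = r' + y one has z z' - x y = r z' + x r'.\<close>
      then have "wmult r z' + wmult x r' \<in> TR"
        using r assms by (intro tensor_relations.add TR_mult_left TR_mult_right)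
      then show "wmult z z' - wmult x y \<in> TR" using r by (simp add: wmult_add_left wmult_add_right add_ac)
    qed
    then show ?thesis using cl_self[of x] cl_self[of y] by blast
  qed
  finally show ?thesis .
qed

lemma FP_smult: "c \<odot>\<^bsub>FP\<^esub> cl x = cl (scale c x)"
proof -
  have "c \<odot>\<^bsub>FP\<^esub> cl x = (\<Union>z\<in>cl x. cl (scale c z))" by (simp add: free_product_def)
  also have "\<dots> = cl (scale c x)" by (rule cl_UN) (simp add: scale_add TR_scale)
  finally show ?thesis .
qed

lemma FP_adj: "adj FP (cl x) = cl (wadj x)"
proof -
  have "adj FP (cl x) = (\<Union>z\<in>cl x. cl (wadj z))" by (simp add: free_product_def)
  also have "\<dots> = cl (wadj x)" by (rule cl_UN) (simp add: wadj_simps TR_adj)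
  finally show ?thesis .
qed

lemma free_left_cl: "b \<in> carrier B \<Longrightarrow> free_left I A B \<iota> b (cl x) = cl (linear_extension (word_left A \<iota> b) x)"
  unfolding free_left_def by (rule cl_UN) (simp add: linear_extension_simps TR_left[OF good_left_word_left])

lemma free_right_cl: "b \<in> carrier B \<Longrightarrow> free_right I A B \<iota> (cl x) b = cl (linear_extension (\<lambda>w. word_right A \<iota> w b) x)"
  unfolding free_right_def by (rule cl_UN) (simp add: linear_extension_simps TR_right[OF good_right_word_right])

lemma carrier_wmult:
  assumes "Poly_Mapping.keys x \<subseteq> RW" "Poly_Mapping.keys y \<subseteq> RW"
  shows "Poly_Mapping.keys (wmult x y) \<subseteq> RW"
proof -
  have "Poly_Mapping.keys (wmult x y) \<subseteq> (\<Union>u\<in>Poly_Mapping.keys x. \<Union>v\<in>Poly_Mapping.keys y. {word_mult A u v})"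
    unfolding wmult_def lsum_def
    by (rule order_trans[OF Poly_Mapping.keys_sum UN_mono[OF order_refl]], rule order_trans[OF Poly_Mapping.keys_sum UN_mono[OF order_refl]]) auto
  then show ?thesis using assms RW_mult by blast
qed

lemma carrier_wadj: "Poly_Mapping.keys x \<subseteq> RW \<Longrightarrow> Poly_Mapping.keys (wadj x) \<subseteq> RW"
  unfolding wadj_def lsum_def using keys_lsum_single RW_adj by fastforce

lemma carrier_linear_extension:
  "Poly_Mapping.keys x \<subseteq> RW \<Longrightarrow> (\<And>w. w \<in> RW \<Longrightarrow> g w \<in> RW) \<Longrightarrow> Poly_Mapping.keys (linear_extension g x) \<subseteq> RW"
  unfolding linear_extension_def using keys_lsum_single by fastforce

lemma carrier_add: "Poly_Mapping.keys x \<subseteq> RW \<Longrightarrow> Poly_Mapping.keys y \<subseteq> RW \<Longrightarrow> Poly_Mapping.keys (x + y) \<subseteq> RW"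
  using Poly_Mapping.keys_add[of x y] by blast

text \<open>Enough structure for the sums \<open>finsum\<close> in products of matrices over the
  free product.\<close>

lemma FP_abelian_monoid: "abelian_monoid FP"
proof (rule abelian_monoidI)
  fix p q r assume "p \<in> carrier FP" "q \<in> carrier FP" "r \<in> carrier FP"
  then obtain x y z where *: "p = cl x" "q = cl y" "r = cl z" "Poly_Mapping.keys x \<subseteq> RW" "Poly_Mapping.keys y \<subseteq> RW"
    unfolding FP_simps by blast
  show "p \<oplus>\<^bsub>FP\<^esub> q \<in> carrier FP" using * by (simp add: FP_add cl_closed carrier_add)
  show "(p \<oplus>\<^bsub>FP\<^esub> q) \<oplus>\<^bsub>FP\<^esub> r = p \<oplus>\<^bsub>FP\<^esub> (q \<oplus>\<^bsub>FP\<^esub> r)" using * by (simp add: FP_add add.assoc)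
  show "\<zero>\<^bsub>FP\<^esub> \<oplus>\<^bsub>FP\<^esub> p = p" using * by (simp add: FP_add FP_simps)
  show "p \<oplus>\<^bsub>FP\<^esub> q = q \<oplus>\<^bsub>FP\<^esub> p" using * by (simp add: FP_add add.commute)
next
  show "\<zero>\<^bsub>FP\<^esub> \<in> carrier FP" by (force simp: FP_simps)
qed

lemma FP_finsum:
  assumes "finite S" "\<And>s. s \<in> S \<Longrightarrow> Poly_Mapping.keys (f s) \<subseteq> RW"
  shows "finsum FP (\<lambda>s. cl (f s)) S = cl (sum f S)"
proof -
  interpret FPm: abelian_monoid FP by (rule FP_abelian_monoid)
  show ?thesis using assms
  proof (induction S)
    case empty
    show ?case using FP_simps(2) by simp
  next
    case (insert s S)
    then show ?case by (subst FPm.finsum_insert) (auto simp: FP_simps(1) FP_add)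
  qed
qed

end

section \<open>Complete positivity of the monotone product\<close>

lemma reduced_words_appendD:
  "u @ v \<in> reduced_words I A \<Longrightarrow> u \<noteq> [] \<Longrightarrow> u \<in> reduced_words I A"
  "u @ v \<in> reduced_words I A \<Longrightarrow> v \<noteq> [] \<Longrightarrow> v \<in> reduced_words I A"
  by (auto simp: reduced_words_def distinct_adj_append_iff)

context monotone_setup
begin

section \<open>Uniqueness of the map determined by the rules\<close>

lemma monotone_rules:
  assumes R: "satisfies_monotone_rules I A B \<iota> D \<kappa> \<psi> \<theta> \<Theta>"
  shows "i \<in> I \<Longrightarrow> a \<in> carrier (A i) \<Longrightarrow> \<Theta> (cl (Poly_Mapping.single [(i, a)] 1)) = \<theta> i a"
    and "(i, a) # (j, c) # w \<in> RW \<Longrightarrow> j < i \<Longrightarrow>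
      \<Theta> (cl (Poly_Mapping.single ((i, a) # (j, c) # w) 1)) = \<theta> i a \<otimes>\<^bsub>D\<^esub> \<Theta> (cl (Poly_Mapping.single ((j, c) # w) 1))"
    and "w @ [(j, c), (i, a)] \<in> RW \<Longrightarrow> j < i \<Longrightarrow>
      \<Theta> (cl (Poly_Mapping.single (w @ [(j, c), (i, a)]) 1)) = \<Theta> (cl (Poly_Mapping.single (w @ [(j, c)]) 1)) \<otimes>\<^bsub>D\<^esub> \<theta> i a"
    and "u @ [(i, a), (k, b), (j, c)] @ v \<in> RW \<Longrightarrow> i < k \<Longrightarrow> j < k \<Longrightarrow>
      \<Theta> (cl (Poly_Mapping.single (u @ [(i, a), (k, b), (j, c)] @ v) 1)) =
        \<Theta> (cl (Poly_Mapping.single (u @ [(i, a)]) 1) \<otimes>\<^bsub>FP\<^esub> free_left I A B \<iota> (\<psi> k b) (cl (Poly_Mapping.single ((j, c) # v) 1)))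
        \<oplus>\<^bsub>D\<^esub> \<Theta> (cl (Poly_Mapping.single (u @ [(i, a)]) 1)) \<otimes>\<^bsub>D\<^esub> (\<theta> k b \<ominus>\<^bsub>D\<^esub> \<kappa> (\<psi> k b)) \<otimes>\<^bsub>D\<^esub> \<Theta> (cl (Poly_Mapping.single ((j, c) # v) 1))"
proof -
  note rules = R[unfolded satisfies_monotone_rules_def Let_def free_word_def]
  show "i \<in> I \<Longrightarrow> a \<in> carrier (A i) \<Longrightarrow> \<Theta> (cl (Poly_Mapping.single [(i, a)] 1)) = \<theta> i a"
    using rules[THEN conjunct1] by blast
  show "(i, a) # (j, c) # w \<in> RW \<Longrightarrow> j < i \<Longrightarrow>
      \<Theta> (cl (Poly_Mapping.single ((i, a) # (j, c) # w) 1)) = \<theta> i a \<otimes>\<^bsub>D\<^esub> \<Theta> (cl (Poly_Mapping.single ((j, c) # w) 1))"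
    using rules[THEN conjunct2, THEN conjunct1] by blast
  show "w @ [(j, c), (i, a)] \<in> RW \<Longrightarrow> j < i \<Longrightarrow>
      \<Theta> (cl (Poly_Mapping.single (w @ [(j, c), (i, a)]) 1)) = \<Theta> (cl (Poly_Mapping.single (w @ [(j, c)]) 1)) \<otimes>\<^bsub>D\<^esub> \<theta> i a"
    using rules[THEN conjunct2, THEN conjunct2, THEN conjunct1] by blast
  show "u @ [(i, a), (k, b), (j, c)] @ v \<in> RW \<Longrightarrow> i < k \<Longrightarrow> j < k \<Longrightarrow>
      \<Theta> (cl (Poly_Mapping.single (u @ [(i, a), (k, b), (j, c)] @ v) 1)) =
        \<Theta> (cl (Poly_Mapping.single (u @ [(i, a)]) 1) \<otimes>\<^bsub>FP\<^esub> free_left I A B \<iota> (\<psi> k b) (cl (Poly_Mapping.single ((j, c) # v) 1)))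
        \<oplus>\<^bsub>D\<^esub> \<Theta> (cl (Poly_Mapping.single (u @ [(i, a)]) 1)) \<otimes>\<^bsub>D\<^esub> (\<theta> k b \<ominus>\<^bsub>D\<^esub> \<kappa> (\<psi> k b)) \<otimes>\<^bsub>D\<^esub> \<Theta> (cl (Poly_Mapping.single ((j, c) # v) 1))"
    using rules[THEN conjunct2, THEN conjunct2, THEN conjunct2] by blast
qed

text \<open>A reduced word has no repetition, so it is a single letter, begins with a descent, ends
  with an ascent or has a peak. In each of the last three cases a rule reduces its value to values
  of shorter words.\<close>

lemma reduced_word_unique:
  assumes R1: "satisfies_monotone_rules I A B \<iota> D \<kappa> \<psi> \<theta> \<Theta>1"
    and R2: "satisfies_monotone_rules I A B \<iota> D \<kappa> \<psi> \<theta> \<Theta>2"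
    and w: "w \<in> RW"
  shows "\<Theta>1 (cl (Poly_Mapping.single w 1)) = \<Theta>2 (cl (Poly_Mapping.single w 1))"
  using w
proof (induction "length w" arbitrary: w rule: less_induct)
  case less
  show ?case
  proof (cases w rule: word_cases)
    case 1
    obtain i a v where w: "w = (i, a) # v" "i \<in> I" "a \<in> carrier (A i)" using RW_head[OF less.prems] .
    show ?thesis
    proof (cases v)
      case Nil
      then show ?thesis using monotone_rules(1)[OF R1] monotone_rules(1)[OF R2] w by simp
    next
      case (Cons y v')
      obtain j c where y: "y = (j, c)" by fastforce
      have j: "j < i" using 1 w y Cons by (simp add: descending_Cons2)
      have r: "(i, a) # (j, c) # v' \<in> RW" using less.prems w y Cons by simp
      have "(j, c) # v' \<in> RW" using reduced_words_appendD(2)[of "[(i, a)]"] r by simp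
      then have "\<Theta>1 (cl (Poly_Mapping.single ((j, c) # v') 1)) = \<Theta>2 (cl (Poly_Mapping.single ((j, c) # v') 1))"
        by (intro less.hyps) (simp_all add: w Cons)
      moreover have "\<Theta>1 (cl (Poly_Mapping.single w 1)) = \<theta> i a \<otimes>\<^bsub>D\<^esub> \<Theta>1 (cl (Poly_Mapping.single ((j, c) # v') 1))"
        "\<Theta>2 (cl (Poly_Mapping.single w 1)) = \<theta> i a \<otimes>\<^bsub>D\<^esub> \<Theta>2 (cl (Poly_Mapping.single ((j, c) # v') 1))"
        using monotone_rules(2)[OF R1 r j] monotone_rules(2)[OF R2 r j] w y Cons by simp_all
      ultimately show ?thesis by simp
    qed
  next
    case (2 u i a b v)
    then show ?thesis using less.prems by (simp add: reduced_words_def distinct_adj_append_iff)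
  next
    case (3 u i a k b)
    have r: "u @ [(i, a), (k, b)] \<in> RW" using less.prems 3 by simp
    have "u @ [(i, a)] \<in> RW" using reduced_words_appendD(1)[of "u @ [(i, a)]" "[(k, b)]"] r by simp
    then have "\<Theta>1 (cl (Poly_Mapping.single (u @ [(i, a)]) 1)) = \<Theta>2 (cl (Poly_Mapping.single (u @ [(i, a)]) 1))"
      by (intro less.hyps) (simp_all add: 3)
    moreover have "\<Theta>1 (cl (Poly_Mapping.single w 1)) = \<Theta>1 (cl (Poly_Mapping.single (u @ [(i, a)]) 1)) \<otimes>\<^bsub>D\<^esub> \<theta> k b"
      "\<Theta>2 (cl (Poly_Mapping.single w 1)) = \<Theta>2 (cl (Poly_Mapping.single (u @ [(i, a)]) 1)) \<otimes>\<^bsub>D\<^esub> \<theta> k b"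
      using monotone_rules(3)[OF R1 r 3(2)] monotone_rules(3)[OF R2 r 3(2)] 3(1) by simp_all
    ultimately show ?thesis by simp
  next
    case (4 u i a k b j c v)
    have r: "u @ [(i, a), (k, b), (j, c)] @ v \<in> RW" using less.prems 4 by simp
    have r1: "u @ [(i, a)] \<in> RW" using reduced_words_appendD(1)[of "u @ [(i, a)]" "(k, b) # (j, c) # v"] r by simp
    have r2: "(j, c) # v \<in> RW" using reduced_words_appendD(2)[of "u @ [(i, a), (k, b)]" "(j, c) # v"] r by simp
    have kb: "k \<in> I" "b \<in> carrier (A k)" using reduced_letters[OF r, of k b] by auto
    have b: "\<psi> k b \<in> carrier B" by (rule \<psi>_map(1)[OF kb])
    let ?v = "word_left A \<iota> (\<psi> k b) ((j, c) # v)"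
    \<comment> \<open>The product of words in rule (3). It is shorter than w since the letter of
      index k is gone, and shorter by one more letter if i = j.\<close>
    let ?m = "word_mult A (u @ [(i, a)]) ?v"
    have rv: "?v \<in> RW" "?m \<in> RW" using RW_left[OF r2 b] RW_mult[OF r1] by auto
    have m: "cl (Poly_Mapping.single (u @ [(i, a)]) 1) \<otimes>\<^bsub>FP\<^esub> free_left I A B \<iota> (\<psi> k b) (cl (Poly_Mapping.single ((j, c) # v) 1))
      = cl (Poly_Mapping.single ?m 1)"
      using r1 r2 rv by (simp add: free_left_cl[OF b] linear_extension_simps FP_mult) (simp add: wmult_def lsum_single)
    have "length ?m < length w" using 4 by (auto simp: word_mult_def word_left_def)
    then have "\<Theta>1 (cl (Poly_Mapping.single ?m 1)) = \<Theta>2 (cl (Poly_Mapping.single ?m 1))"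
      using rv by (intro less.hyps)
    moreover have "\<Theta>1 (cl (Poly_Mapping.single (u @ [(i, a)]) 1)) = \<Theta>2 (cl (Poly_Mapping.single (u @ [(i, a)]) 1))"
      using r1 4 by (intro less.hyps) simp_all
    moreover have "\<Theta>1 (cl (Poly_Mapping.single ((j, c) # v) 1)) = \<Theta>2 (cl (Poly_Mapping.single ((j, c) # v) 1))"
      using r2 4 by (intro less.hyps) simp_all
    moreover have "\<Theta>1 (cl (Poly_Mapping.single w 1)) = \<Theta>1 (cl (Poly_Mapping.single ?m 1)) \<oplus>\<^bsub>D\<^esub>
        \<Theta>1 (cl (Poly_Mapping.single (u @ [(i, a)]) 1)) \<otimes>\<^bsub>D\<^esub> (\<theta> k b \<ominus>\<^bsub>D\<^esub> \<kappa> (\<psi> k b)) \<otimes>\<^bsub>D\<^esub> \<Theta>1 (cl (Poly_Mapping.single ((j, c) # v) 1))"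
      using monotone_rules(4)[OF R1 r 4(2,3)] 4(1) unfolding m by simp
    moreover have "\<Theta>2 (cl (Poly_Mapping.single w 1)) = \<Theta>2 (cl (Poly_Mapping.single ?m 1)) \<oplus>\<^bsub>D\<^esub>
        \<Theta>2 (cl (Poly_Mapping.single (u @ [(i, a)]) 1)) \<otimes>\<^bsub>D\<^esub> (\<theta> k b \<ominus>\<^bsub>D\<^esub> \<kappa> (\<psi> k b)) \<otimes>\<^bsub>D\<^esub> \<Theta>2 (cl (Poly_Mapping.single ((j, c) # v) 1))"
      using monotone_rules(4)[OF R2 r 4(2,3)] 4(1) unfolding m by simp
    ultimately show ?thesis by simp
  qed
qed

lemma monotone_map_unique:
  assumes L: "linear_map FP D \<Theta>1" "linear_map FP D \<Theta>2"
    and R: "satisfies_monotone_rules I A B \<iota> D \<kappa> \<psi> \<theta> \<Theta>1" "satisfies_monotone_rules I A B \<iota> D \<kappa> \<psi> \<theta> \<Theta>2"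
    and x: "Poly_Mapping.keys x \<subseteq> RW"
  shows "\<Theta>1 (cl x) = \<Theta>2 (cl x)"
proof -
  interpret D: ring D by (rule ringD)
  let ?s = "\<lambda>S. \<Sum>w\<in>S. Poly_Mapping.single w (Poly_Mapping.lookup x w)"
  have "\<Theta>1 (cl (?s S)) = \<Theta>2 (cl (?s S)) \<and> Poly_Mapping.keys (?s S) \<subseteq> RW" if "finite S" "S \<subseteq> RW" for S
    using that
  proof (induction S)
    case empty
    have c0: "cl 0 \<in> carrier FP" by (force simp: FP_simps)
    have "\<Theta> (cl 0) = \<zero>\<^bsub>D\<^esub>" if "linear_map FP D \<Theta>" for \<Theta>
    proof -
      have "\<Theta> (cl 0) \<oplus>\<^bsub>D\<^esub> \<Theta> (cl 0) = \<Theta> (cl 0)" "\<Theta> (cl 0) \<in> carrier D"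
        using that c0 FP_add[of 0 0] unfolding linear_map_def by (metis add_0, blast)
      then show ?thesis using D.add.l_cancel_one by blast
    qed
    from this[OF L(1)] this[OF L(2)] show ?case by simp
  next
    case (insert w S)
    have w: "w \<in> RW" using insert by simp
    have c: "cl (Poly_Mapping.single w 1) \<in> carrier FP" "cl (Poly_Mapping.single w (Poly_Mapping.lookup x w)) \<in> carrier FP" "cl (?s S) \<in> carrier FP"
      using w insert by (auto simp: FP_simps)
    have sc: "cl (Poly_Mapping.single w (Poly_Mapping.lookup x w)) = Poly_Mapping.lookup x w \<odot>\<^bsub>FP\<^esub> cl (Poly_Mapping.single w 1)"
      by (simp add: FP_smult)
    have "\<Theta> (cl (?s (insert w S))) = Poly_Mapping.lookup x w \<odot>\<^bsub>D\<^esub> \<Theta> (cl (Poly_Mapping.single w 1)) \<oplus>\<^bsub>D\<^esub> \<Theta> (cl (?s S))"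
      if "linear_map FP D \<Theta>" for \<Theta>
    proof -
      have "cl (?s (insert w S)) = cl (Poly_Mapping.single w (Poly_Mapping.lookup x w)) \<oplus>\<^bsub>FP\<^esub> cl (?s S)"
        using insert by (simp add: FP_add)
      then show ?thesis using that c unfolding linear_map_def by (simp add: sc)
    qed
    note E = this
    have "\<Theta>1 (cl (?s (insert w S))) = \<Theta>2 (cl (?s (insert w S)))"
      unfolding E[OF L(1)] E[OF L(2)] using insert reduced_word_unique[OF R w] by simp
    moreover have "Poly_Mapping.keys (?s (insert w S)) \<subseteq> RW"
      using insert w by (simp add: carrier_add)
    ultimately show ?case ..
  qed
  from this[of "Poly_Mapping.keys x"] show ?thesis using x sum_single[of x] by simp
qed

theorem monotone_product_cp:
  "completely_positive FP D (monotone_product I A B \<iota> D \<kappa> \<psi> \<theta>) \<and>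
   bimodule_map B FP (free_left I A B \<iota>) (free_right I A B \<iota>)
     D (left_via D \<kappa>) (right_via D \<kappa>) (monotone_product I A B \<iota> D \<kappa> \<psi> \<theta>)"
proof (rule word_functional)
  fix Fw :: "('i \<times> 'a) list \<Rightarrow> 'd univ"
  assume
    F_add: "\<And>u i a v a'. u @ (i, a) # v \<in> reduced_words I A \<Longrightarrow> a' \<in> carrier (A i) \<Longrightarrow>
      Fw (u @ (i, a \<oplus>\<^bsub>A i\<^esub> a') # v) = Fw (u @ (i, a) # v) + Fw (u @ (i, a') # v)" and
    F_scal: "\<And>u i a v c. u @ (i, a) # v \<in> reduced_words I A \<Longrightarrow>
      Fw (u @ (i, c \<odot>\<^bsub>A i\<^esub> a) # v) = scal c * Fw (u @ (i, a) # v)" and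
    F_bal: "\<And>u i a j a' v b. u @ (i, a) # (j, a') # v \<in> reduced_words I A \<Longrightarrow> b \<in> carrier B \<Longrightarrow>
      Fw (u @ (i, a \<otimes>\<^bsub>A i\<^esub> \<iota> i b) # (j, a') # v) = Fw (u @ (i, a) # (j, \<iota> j b \<otimes>\<^bsub>A j\<^esub> a') # v)" and
    F_pos: "\<And>N w d. (\<And>m. m < N \<Longrightarrow> w m \<in> reduced_words I A) \<Longrightarrow>
      nonneg (\<Sum>m<(N::nat). \<Sum>n<N. star (d m) * Fw (word_mult A (word_adj A (w m)) (w n)) * d n)" and
    F_star: "\<And>u v. u \<in> reduced_words I A \<Longrightarrow> v \<in> reduced_words I A \<Longrightarrow>
      star (Fw (word_mult A (word_adj A u) v)) = Fw (word_mult A (word_adj A v) u)" and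
    F_single: "\<And>i a. i \<in> I \<Longrightarrow> a \<in> carrier (A i) \<Longrightarrow> Fw [(i, a)] = lift D (\<theta> i a) 0" and
    F_desc: "\<And>i a j a' w. (i, a) # (j, a') # w \<in> reduced_words I A \<Longrightarrow> j < i \<Longrightarrow>
      Fw ((i, a) # (j, a') # w) = lift D (\<theta> i a) 0 * Fw ((j, a') # w)" and
    F_asc: "\<And>w j a' i a. w @ [(j, a'), (i, a)] \<in> reduced_words I A \<Longrightarrow> j < i \<Longrightarrow>
      Fw (w @ [(j, a'), (i, a)]) = Fw (w @ [(j, a')]) * lift D (\<theta> i a) 0" and
    F_peak: "\<And>u i a k a' j a'' v. u @ [(i, a), (k, a'), (j, a'')] @ v \<in> reduced_words I A \<Longrightarrow> i < k \<Longrightarrow> j < k \<Longrightarrow>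
      Fw (u @ [(i, a), (k, a'), (j, a'')] @ v) =
        Fw (word_mult A (u @ [(i, a)]) (word_left A \<iota> (\<psi> k a') ((j, a'') # v)))
        + Fw (u @ [(i, a)]) * lift D (\<theta> k a' \<ominus>\<^bsub>D\<^esub> \<kappa> (\<psi> k a')) 0 * Fw ((j, a'') # v)" and
    F_left: "\<And>w b. w \<in> reduced_words I A \<Longrightarrow> b \<in> carrier B \<Longrightarrow> Fw (word_left A \<iota> b w) = lift D (\<kappa> b) 0 * Fw w" and
    F_right: "\<And>w b. w \<in> reduced_words I A \<Longrightarrow> b \<in> carrier B \<Longrightarrow> Fw (word_right A \<iota> w b) = Fw w * lift D (\<kappa> b) 0"
  interpret D: ring D by (rule ringD)
  interpret D': cstar_algebra D by (rule D)
  define \<Phi> where "\<Phi> = lsum (\<lambda>w c. scal c * Fw w)"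
  have h: "scal 0 * Fw w = 0" "scal (a + b) * Fw w = scal a * Fw w + scal b * Fw w" for w a b
    by (simp_all add: scal_add distrib_right)
  have \<Phi>_add: "\<Phi> (x + y) = \<Phi> x + \<Phi> y" for x y unfolding \<Phi>_def by (rule lsum_add) (rule h)+
  have \<Phi>_diff: "\<Phi> (x - y) = \<Phi> x - \<Phi> y" for x y unfolding \<Phi>_def by (rule lsum_diff) (rule h)+
  have \<Phi>_sum: "\<Phi> (sum f S) = (\<Sum>s\<in>S. \<Phi> (f s))" for f :: "nat \<Rightarrow> _" and S unfolding \<Phi>_def by (rule lsum_sum) (rule h)+
  have \<Phi>_sum': "\<Phi> (sum f S) = (\<Sum>s\<in>S. \<Phi> (f s))" for f :: "('i \<times> 'a) list \<Rightarrow> _" and S unfolding \<Phi>_def by (rule lsum_sum) (rule h)+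
  have \<Phi>_single: "\<Phi> (Poly_Mapping.single w c) = scal c * Fw w" for w c
    unfolding \<Phi>_def by (rule lsum_single) (rule h)
  have \<Phi>_scale: "\<Phi> (scale c x) = scal c * \<Phi> x" for c x
    unfolding \<Phi>_def by (subst lsum_scale) (simp_all add: lsum_def sum_distrib_left scal_mult mult.assoc)
  have \<Phi>_0: "\<Phi> 0 = 0" by (simp add: \<Phi>_def)
  have \<Phi>_TR: "\<Phi> r = 0" if "r \<in> TR" for r
    using that
  proof (induction rule: tensor_relations.induct)
    case (scale x c)
    then show ?case using \<Phi>_scale[of c x] by (simp add: scale_def)
  qed (simp_all add: \<Phi>_add \<Phi>_diff \<Phi>_single \<Phi>_0 F_add F_scal F_bal)
  \<comment> \<open>The representative is arbitrary because \<open>\<Phi>\<close> vanishes on the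
    relations.\<close>
  define \<Theta> where "\<Theta> = (\<lambda>S\<in>carrier FP. coord D (\<Phi> (SOME x. x \<in> S)))"
  have \<Theta>: "\<Theta> (cl x) = coord D (\<Phi> x)" if "Poly_Mapping.keys x \<subseteq> RW" for x
  proof -
    have "(SOME z. z \<in> cl x) \<in> cl x" using cl_self by (rule someI)
    then obtain r where "r \<in> TR" "(SOME z. z \<in> cl x) = r + x" by (auto simp: cl_eq)
    moreover have "cl x \<in> carrier FP" using that by (auto simp: FP_simps)
    ultimately show ?thesis by (simp add: \<Theta>_def \<Phi>_add \<Phi>_TR)
  qed
  have single: "Poly_Mapping.keys (Poly_Mapping.single w (c :: complex)) \<subseteq> RW" if "w \<in> RW" for w c
    using that by auto
  have \<Theta>w: "\<Theta> (free_word I A B \<iota> w) = coord D (Fw w)" if "w \<in> RW" for w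
    unfolding free_word_def using \<Theta>[OF single[OF that]] by (simp add: \<Phi>_single)
  have lin: "linear_map FP D \<Theta>"
    unfolding linear_map_def
  proof (intro conjI ballI allI)
    show "\<Theta> \<in> carrier FP \<rightarrow> carrier D" by (auto simp: \<Theta>_def D)
    fix p assume "p \<in> carrier FP"
    then obtain x where x: "p = cl x" "Poly_Mapping.keys x \<subseteq> RW" by (auto simp: FP_simps)
    fix c
    have "Poly_Mapping.keys (scale c x) \<subseteq> RW" by (rule order_trans[OF keys_scale x(2)])
    then show "\<Theta> (c \<odot>\<^bsub>FP\<^esub> p) = c \<odot>\<^bsub>D\<^esub> \<Theta> p"
      using x by (simp add: FP_smult \<Theta> \<Phi>_scale D del: coord_times)
  next
    fix p q assume "p \<in> carrier FP" "q \<in> carrier FP"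
    then obtain x y where "p = cl x" "Poly_Mapping.keys x \<subseteq> RW" "q = cl y" "Poly_Mapping.keys y \<subseteq> RW" by (auto simp: FP_simps)
    then show "\<Theta> (p \<oplus>\<^bsub>FP\<^esub> q) = \<Theta> p \<oplus>\<^bsub>D\<^esub> \<Theta> q"
      by (simp add: FP_add \<Theta> \<Phi>_add D carrier_add)
  qed
  have lc: "coord D (lift D d 0) = d" if "d \<in> carrier D" for d using that D by (simp add: coord_lift)
  have rules: "satisfies_monotone_rules I A B \<iota> D \<kappa> \<psi> \<theta> \<Theta>"
    unfolding satisfies_monotone_rules_def Let_def
  proof (intro conjI ballI allI impI; (elim conjE)?)
    fix i a assume "i \<in> I" "a \<in> carrier (A i)"
    moreover from this have "[(i, a)] \<in> RW" by (simp add: reduced_words_def)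
    ultimately show "\<Theta> (free_word I A B \<iota> [(i, a)]) = \<theta> i a" by (simp add: \<Theta>w F_single lc \<theta>_map(1))
  next
    fix i a j a' w assume r: "(i, a) # (j, a') # w \<in> RW" and "j < i"
    moreover have "(j, a') # w \<in> RW" using reduced_words_appendD(2)[of "[(i, a)]"] r by simp
    moreover have "i \<in> I" "a \<in> carrier (A i)" using reduced_letters[OF r, of i a] by auto
    ultimately show "\<Theta> (free_word I A B \<iota> ((i, a) # (j, a') # w)) = \<theta> i a \<otimes>\<^bsub>D\<^esub> \<Theta> (free_word I A B \<iota> ((j, a') # w))"
      by (simp add: \<Theta>w F_desc D lc \<theta>_map(1))
  next
    fix w j a' i a assume r: "w @ [(j, a'), (i, a)] \<in> RW" and "j < i"
    moreover have "w @ [(j, a')] \<in> RW" using reduced_words_appendD(1)[of "w @ [(j, a')]" "[(i, a)]"] r by simp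
    moreover have "i \<in> I" "a \<in> carrier (A i)" using reduced_letters[OF r, of i a] by auto
    ultimately show "\<Theta> (free_word I A B \<iota> (w @ [(j, a'), (i, a)])) = \<Theta> (free_word I A B \<iota> (w @ [(j, a')])) \<otimes>\<^bsub>D\<^esub> \<theta> i a"
      by (simp add: \<Theta>w F_asc D lc \<theta>_map(1))
  next
    fix u i a k a' j a'' v
    assume r: "u @ [(i, a), (k, a'), (j, a'')] @ v \<in> RW" and ik: "i < k" and jk: "j < k"
    have r1: "u @ [(i, a)] \<in> RW" using reduced_words_appendD(1)[of "u @ [(i, a)]" "(k, a') # (j, a'') # v"] r by simp
    have r2: "(j, a'') # v \<in> RW" using reduced_words_appendD(2)[of "u @ [(i, a), (k, a')]" "(j, a'') # v"] r by simp
    have ka: "k \<in> I" "a' \<in> carrier (A k)" using reduced_letters[OF r, of k a'] by auto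
    have b: "\<psi> k a' \<in> carrier B" by (rule \<psi>_map(1)[OF ka])
    let ?v = "word_left A \<iota> (\<psi> k a') ((j, a'') # v)"
    let ?m = "word_mult A (u @ [(i, a)]) ?v"
    have rv: "?v \<in> RW" "?m \<in> RW" using RW_left[OF r2 b] RW_mult[OF r1] by auto
    have m: "free_word I A B \<iota> (u @ [(i, a)]) \<otimes>\<^bsub>FP\<^esub> free_left I A B \<iota> (\<psi> k a') (free_word I A B \<iota> ((j, a'') # v))
      = free_word I A B \<iota> ?m"
      unfolding free_word_def using r1 r2 rv
      by (simp add: free_left_cl[OF b] linear_extension_simps FP_mult) (simp add: wmult_def lsum_single)
    have c: "\<theta> k a' \<ominus>\<^bsub>D\<^esub> \<kappa> (\<psi> k a') \<in> carrier D"
      using \<theta>_map(1)[OF ka] \<kappa>_hom(1)[OF b] by simp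
    show "\<Theta> (free_word I A B \<iota> (u @ [(i, a), (k, a'), (j, a'')] @ v)) =
      \<Theta> (free_word I A B \<iota> (u @ [(i, a)]) \<otimes>\<^bsub>FP\<^esub> free_left I A B \<iota> (\<psi> k a') (free_word I A B \<iota> ((j, a'') # v)))
      \<oplus>\<^bsub>D\<^esub> \<Theta> (free_word I A B \<iota> (u @ [(i, a)])) \<otimes>\<^bsub>D\<^esub> (\<theta> k a' \<ominus>\<^bsub>D\<^esub> \<kappa> (\<psi> k a')) \<otimes>\<^bsub>D\<^esub> \<Theta> (free_word I A B \<iota> ((j, a'') # v))"
      unfolding m \<Theta>w[OF r] \<Theta>w[OF rv(2)] \<Theta>w[OF r1] \<Theta>w[OF r2] F_peak[OF r ik jk]
      by (simp add: D lc[OF c])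
  qed
  \<comment> \<open>The description operator in the definition is resolved by the existence just
    shown and by uniqueness on classes.\<close>
  have eq: "monotone_product I A B \<iota> D \<kappa> \<psi> \<theta> = \<Theta>"
    unfolding monotone_product_def
  proof (rule the_equality)
    show "\<Theta> \<in> extensional (carrier FP) \<and> linear_map FP D \<Theta> \<and> satisfies_monotone_rules I A B \<iota> D \<kappa> \<psi> \<theta> \<Theta>"
      using lin rules by (simp add: \<Theta>_def)
    fix \<Theta>' assume *: "\<Theta>' \<in> extensional (carrier FP) \<and> linear_map FP D \<Theta>' \<and> satisfies_monotone_rules I A B \<iota> D \<kappa> \<psi> \<theta> \<Theta>'"
    show "\<Theta>' = \<Theta>"
    proof (rule extensionalityI[of _ "carrier FP"])
      fix p assume "p \<in> carrier FP"
      then obtain x where "p = cl x" "Poly_Mapping.keys x \<subseteq> RW" by (auto simp: FP_simps)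
      then show "\<Theta>' p = \<Theta> p" using monotone_map_unique[of \<Theta>' \<Theta> x] * lin rules by blast
    qed (use * in \<open>auto simp: \<Theta>_def\<close>)
  qed
  have \<Phi>_le: "\<Phi> (linear_extension g x) = (\<Sum>w\<in>Poly_Mapping.keys x. scal (Poly_Mapping.lookup x w) * Fw (g w))" for g x
    by (simp add: linear_extension_def \<Phi>_sum' \<Phi>_single)
  have bimod: "bimodule_map B FP (free_left I A B \<iota>) (free_right I A B \<iota>) D (left_via D \<kappa>) (right_via D \<kappa>) \<Theta>"
    unfolding bimodule_map_def
  proof (intro conjI ballI lin)
    fix b p assume b: "b \<in> carrier B" and "p \<in> carrier FP"
    then obtain x where x: "p = cl x" "Poly_Mapping.keys x \<subseteq> RW" by (auto simp: FP_simps)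
    have "\<Phi> (linear_extension (word_left A \<iota> b) x) = lift D (\<kappa> b) 0 * \<Phi> x"
      unfolding \<Phi>_le unfolding \<Phi>_def lsum_def sum_distrib_left
      by (intro sum.cong refl) (use x(2) b in \<open>auto simp: F_left scal_left_comm\<close>)
    then show "\<Theta> (free_left I A B \<iota> b p) = left_via D \<kappa> b (\<Theta> p)"
      using x b by (simp add: free_left_cl \<Theta> carrier_linear_extension RW_left left_via_def D lc \<kappa>_hom(1))
    have "\<Phi> (linear_extension (\<lambda>w. word_right A \<iota> w b) x) = \<Phi> x * lift D (\<kappa> b) 0"
      unfolding \<Phi>_le unfolding \<Phi>_def lsum_def sum_distrib_right
      by (intro sum.cong refl) (use x(2) b in \<open>auto simp: F_right mult.assoc\<close>)
    then show "\<Theta> (free_right I A B \<iota> p b) = right_via D \<kappa> (\<Theta> p) b"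
      using x b by (simp add: free_right_cl \<Theta> carrier_linear_extension RW_right right_via_def D lc \<kappa>_hom(1))
  qed
  \<comment> \<open>Positivity over an arbitrary finite index set, to be applied to pairs of a
    column index and a word.\<close>
  have F_pos': "nonneg (\<Sum>s\<in>T. \<Sum>t\<in>T. star (d s) * Fw (word_mult A (word_adj A (w s)) (w t)) * d t)"
    if T: "finite T" and w: "\<And>s. s \<in> T \<Longrightarrow> w s \<in> RW" for T :: "(nat \<times> ('i \<times> 'a) list) set" and w d
  proof -
    obtain h where h: "bij_betw h {0..<card T} T" using ex_bij_betw_nat_finite[OF T] by blast
    have hT: "h m \<in> T" if "m < card T" for m using h that by (auto simp: bij_betw_def)
    have "nonneg (\<Sum>m<card T. \<Sum>n<card T. star (d (h m)) * Fw (word_mult A (word_adj A (w (h m))) (w (h n))) * d (h n))"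
      by (rule F_pos) (rule w[OF hT])
    then show ?thesis
      by (simp add: sum.reindex_bij_betw[OF h, symmetric] atLeast0LessThan)
  qed
  \<comment> \<open>The set S may exceed both supports, so that all entries of a matrix can be
    expanded over the same words.\<close>
  have \<Phi>_kernel: "\<Phi> (wmult (wadj x) y)
     = (\<Sum>u\<in>S. \<Sum>v\<in>S. star (scal (Poly_Mapping.lookup x u)) * (scal (Poly_Mapping.lookup y v) * Fw (word_mult A (word_adj A u) v)))"
    if S: "finite S" "Poly_Mapping.keys x \<subseteq> S" "Poly_Mapping.keys y \<subseteq> S" for x y S
  proof -
    have 1: "\<Phi> (wmult (Poly_Mapping.single u c) y) = (\<Sum>v\<in>S. scal (c * Poly_Mapping.lookup y v) * Fw (word_mult A u v))" for u c
    proof -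
      have "wmult (Poly_Mapping.single u c) y = (\<Sum>v\<in>S. Poly_Mapping.single (word_mult A u v) (c * Poly_Mapping.lookup y v))"
      proof -
        have "wmult (Poly_Mapping.single u c) y = lsum (\<lambda>v d. Poly_Mapping.single (word_mult A u v) (c * d)) y"
          unfolding wmult_def by (rule lsum_single) (simp add: lsum_def)
        also have "\<dots> = (\<Sum>v\<in>S. Poly_Mapping.single (word_mult A u v) (c * Poly_Mapping.lookup y v))"
          by (rule lsum_superset) (use S in simp_all)
        finally show ?thesis .
      qed
      then show ?thesis by (simp add: \<Phi>_sum' \<Phi>_single)
    qed
    have "wadj x = (\<Sum>u\<in>S. Poly_Mapping.single (word_adj A u) (cnj (Poly_Mapping.lookup x u)))"
      unfolding wadj_def by (rule lsum_superset) (use S in simp_all)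
    moreover have "wmult (sum f S) y = (\<Sum>u\<in>S. wmult (f u) y)" for f
      by (induction S rule: infinite_finite_induct) (simp_all add: wmult_add_left, simp_all add: wmult_def)
    ultimately show ?thesis
      by (simp add: \<Phi>_sum' 1 scal_mult star_scal mult.assoc)
  qed
  \<comment> \<open>H lives in the product algebra, where positivity is tested by columns, and
    \<Theta> sees only its coordinate D. For a sum of hermitian squares the forms are added; a
    single square arises only from the final factorization.\<close>
  have gram: "\<exists>H. (\<forall>i<n. \<forall>j<n. star (H i j) = H j i) \<and> (\<forall>d. nonneg (\<Sum>i<n. \<Sum>j<n. star (d i) * H i j * d j))
      \<and> (\<forall>i<n. \<forall>j<n. \<Theta> (M (i, j)) = coord D (H i j)) \<and> (\<forall>i<n. \<forall>j<n. M (i, j) \<in> carrier FP)"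
    if "M \<in> star_positive (mat_algebra n FP)" for n M
    using that
  proof (induction rule: star_positive.induct)
    case (square x)
    have "\<forall>k<n. \<forall>i<n. \<exists>y. x (k, i) = cl y \<and> Poly_Mapping.keys y \<subseteq> RW"
    proof (intro allI impI)
      fix k i assume "k < n" "i < n"
      then have "x (k, i) \<in> carrier FP"
        using square unfolding mat_algebra_def mat_indices_def by (simp add: PiE_iff)
      then show "\<exists>y. x (k, i) = cl y \<and> Poly_Mapping.keys y \<subseteq> RW" unfolding FP_simps by blast
    qed
    then obtain y where y: "\<And>k i. k < n \<Longrightarrow> i < n \<Longrightarrow> x (k, i) = cl (y k i)"
      "\<And>k i. k < n \<Longrightarrow> i < n \<Longrightarrow> Poly_Mapping.keys (y k i) \<subseteq> RW" by metis
    interpret FPm: abelian_monoid FP by (rule FP_abelian_monoid)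
    have xx: "(adj (mat_algebra n FP) x \<otimes>\<^bsub>mat_algebra n FP\<^esub> x) (i, j) = cl (\<Sum>k<n. wmult (wadj (y k i)) (y k j))"
      if ij: "i < n" "j < n" for i j
    proof -
      have "(adj (mat_algebra n FP) x \<otimes>\<^bsub>mat_algebra n FP\<^esub> x) (i, j)
          = finsum FP (\<lambda>k. cl (wmult (wadj (y k i)) (y k j))) {..<n}"
        using ij unfolding mat_algebra_def mat_indices_def
        by simp (intro FPm.finsum_cong'; auto simp: y FP_adj FP_mult carrier_wadj FP_simps carrier_wmult)
      also have "\<dots> = cl (\<Sum>k<n. wmult (wadj (y k i)) (y k j))"
        by (rule FP_finsum) (use ij y in \<open>simp_all add: carrier_wmult carrier_wadj\<close>)
      finally show ?thesis .
    qed
    have car: "Poly_Mapping.keys (\<Sum>k<n. wmult (wadj (y k i)) (y k j)) \<subseteq> RW" if "i < n" "j < n" for i j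
    proof (rule order_trans[OF Poly_Mapping.keys_sum UN_least])
      fix k assume "k \<in> {..<n}"
      then show "Poly_Mapping.keys (wmult (wadj (y k i)) (y k j)) \<subseteq> RW"
        using that y by (intro carrier_wmult carrier_wadj) auto
    qed
    define S where "S = (\<Union>k<n. \<Union>i<n. Poly_Mapping.keys (y k i))"
    have S: "finite S" "S \<subseteq> RW" "\<And>k i. k < n \<Longrightarrow> i < n \<Longrightarrow> Poly_Mapping.keys (y k i) \<subseteq> S"
      using y(2) unfolding S_def by (auto 4 3)
    define H where "H i j = (\<Sum>k<n. \<Phi> (wmult (wadj (y k i)) (y k j)))" for i j
    have K: "\<Phi> (wmult (wadj (y k i)) (y k j)) = (\<Sum>u\<in>S. \<Sum>v\<in>S. star (scal (Poly_Mapping.lookup (y k i) u)) *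
        (scal (Poly_Mapping.lookup (y k j) v) * Fw (word_mult A (word_adj A u) v)))"
      if "k < n" "i < n" "j < n" for k i j
      by (rule \<Phi>_kernel) (use S that in auto)
    have herm: "star (H i j) = H j i" if ij: "i < n" "j < n" for i j
      unfolding H_def star_sum
    proof (rule sum.cong[OF refl])
      fix k assume "k \<in> {..<n}"
      then have k: "k < n" by simp
      have "star (\<Phi> (wmult (wadj (y k i)) (y k j))) = (\<Sum>u\<in>S. \<Sum>v\<in>S. star (scal (Poly_Mapping.lookup (y k j) v)) *
        (scal (Poly_Mapping.lookup (y k i) u) * Fw (word_mult A (word_adj A v) u)))"
        unfolding K[OF k ij] star_sum
      proof (intro sum.cong refl)
        fix u v assume "u \<in> S" "v \<in> S"
        then have "star (Fw (word_mult A (word_adj A u) v)) = Fw (word_mult A (word_adj A v) u)" using S by (intro F_star) auto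
        then show "star (star (scal (Poly_Mapping.lookup (y k i) u)) * (scal (Poly_Mapping.lookup (y k j) v) * Fw (word_mult A (word_adj A u) v)))
          = star (scal (Poly_Mapping.lookup (y k j) v)) * (scal (Poly_Mapping.lookup (y k i) u) * Fw (word_mult A (word_adj A v) u))"
          by (simp add: star_mult star_scal) (metis mult.assoc scal_comm)
      qed
      also have "\<dots> = \<Phi> (wmult (wadj (y k j)) (y k i))"
        unfolding K[OF k ij(2,1)] by (rule sum.swap)
      finally show "star (\<Phi> (wmult (wadj (y k i)) (y k j))) = \<Phi> (wmult (wadj (y k j)) (y k i))" .
    qed
    have pos: "nonneg (\<Sum>i<n. \<Sum>j<n. star (d i) * H i j * d j)" for d
    proof -
      \<comment> \<open>For fixed k the form at d is the kernel form over pairs (i, u), with the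
        coefficient of the word u in the entry y k i, times d i.\<close>
      define e where "e k = (\<lambda>(i, u). scal (Poly_Mapping.lookup (y k i) u) * d i)" for k
      have "nonneg (\<Sum>s\<in>{..<n} \<times> S. \<Sum>t\<in>{..<n} \<times> S. star (e k s) * Fw (word_mult A (word_adj A (snd s)) (snd t)) * e k t)" for k
        by (rule F_pos') (use S in auto)
      then have "nonneg (\<Sum>k<n. \<Sum>s\<in>{..<n} \<times> S. \<Sum>t\<in>{..<n} \<times> S. star (e k s) * Fw (word_mult A (word_adj A (snd s)) (snd t)) * e k t)"
        by (rule nonneg_sum)
      also have "(\<Sum>k<n. \<Sum>s\<in>{..<n} \<times> S. \<Sum>t\<in>{..<n} \<times> S. star (e k s) * Fw (word_mult A (word_adj A (snd s)) (snd t)) * e k t)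
        = (\<Sum>k<n. \<Sum>i<n. \<Sum>j<n. star (d i) * \<Phi> (wmult (wadj (y k i)) (y k j)) * d j)"
      proof (rule sum.cong[OF refl])
        fix k assume "k \<in> {..<n}"
        then have k: "k < n" by simp
        have pr: "(\<Sum>s\<in>{..<n} \<times> S. g s) = (\<Sum>i<n. \<Sum>u\<in>S. g (i, u))" for g :: "_ \<Rightarrow> 'd univ"
          by (simp add: sum.cartesian_product)
        have t: "star (e k (i, u)) * Fw (word_mult A (word_adj A u) v) * e k (j, v)
          = star (d i) * (star (scal (Poly_Mapping.lookup (y k i) u)) * (scal (Poly_Mapping.lookup (y k j) v) * Fw (word_mult A (word_adj A u) v))) * d j" for i u j v
          by (simp add: e_def star_mult star_scal mult.assoc scal_left_comm[of "Fw (word_mult A (word_adj A u) v)"])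
        have "(\<Sum>s\<in>{..<n} \<times> S. \<Sum>t\<in>{..<n} \<times> S. star (e k s) * Fw (word_mult A (word_adj A (snd s)) (snd t)) * e k t)
          = (\<Sum>i<n. \<Sum>u\<in>S. \<Sum>j<n. \<Sum>v\<in>S. star (e k (i, u)) * Fw (word_mult A (word_adj A u) v) * e k (j, v))"
          unfolding pr by simp
        also have "\<dots> = (\<Sum>i<n. \<Sum>j<n. \<Sum>u\<in>S. \<Sum>v\<in>S. star (e k (i, u)) * Fw (word_mult A (word_adj A u) v) * e k (j, v))"
          by (rule sum.cong[OF refl]) (rule sum.swap)
        also have "\<dots> = (\<Sum>i<n. \<Sum>j<n. star (d i) * \<Phi> (wmult (wadj (y k i)) (y k j)) * d j)"
          unfolding t by (intro sum.cong refl) (simp add: K k sum_distrib_left sum_distrib_right)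
        finally show "(\<Sum>s\<in>{..<n} \<times> S. \<Sum>t\<in>{..<n} \<times> S. star (e k s) * Fw (word_mult A (word_adj A (snd s)) (snd t)) * e k t)
          = (\<Sum>i<n. \<Sum>j<n. star (d i) * \<Phi> (wmult (wadj (y k i)) (y k j)) * d j)" .
      qed
      also have "\<dots> = (\<Sum>i<n. \<Sum>k<n. \<Sum>j<n. star (d i) * \<Phi> (wmult (wadj (y k i)) (y k j)) * d j)" by (rule sum.swap)
      also have "\<dots> = (\<Sum>i<n. \<Sum>j<n. \<Sum>k<n. star (d i) * \<Phi> (wmult (wadj (y k i)) (y k j)) * d j)"
        by (rule sum.cong[OF refl]) (rule sum.swap)
      also have "\<dots> = (\<Sum>i<n. \<Sum>j<n. star (d i) * H i j * d j)"
        by (simp add: H_def sum_distrib_left sum_distrib_right)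
      finally show ?thesis .
    qed
    have val: "\<Theta> ((adj (mat_algebra n FP) x \<otimes>\<^bsub>mat_algebra n FP\<^esub> x) (i, j)) = coord D (H i j)" if "i < n" "j < n" for i j
      unfolding xx[OF that] \<Theta>[OF car[OF that]] \<Phi>_sum H_def ..
    have cl: "(adj (mat_algebra n FP) x \<otimes>\<^bsub>mat_algebra n FP\<^esub> x) (i, j) \<in> carrier FP" if "i < n" "j < n" for i j
      unfolding xx[OF that] FP_simps using car[OF that] by blast
    show ?case using herm pos val cl by blast
  next
    case (sum M M')
    then obtain H H' where H: "\<forall>i<n. \<forall>j<n. star (H i j) = H j i" "\<forall>d. nonneg (\<Sum>i<n. \<Sum>j<n. star (d i) * H i j * d j)"
      "\<forall>i<n. \<forall>j<n. \<Theta> (M (i, j)) = coord D (H i j)" "\<forall>i<n. \<forall>j<n. M (i, j) \<in> carrier FP"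
      and H': "\<forall>i<n. \<forall>j<n. star (H' i j) = H' j i" "\<forall>d. nonneg (\<Sum>i<n. \<Sum>j<n. star (d i) * H' i j * d j)"
      "\<forall>i<n. \<forall>j<n. \<Theta> (M' (i, j)) = coord D (H' i j)" "\<forall>i<n. \<forall>j<n. M' (i, j) \<in> carrier FP" by blast
    have a: "(M \<oplus>\<^bsub>mat_algebra n FP\<^esub> M') (i, j) = M (i, j) \<oplus>\<^bsub>FP\<^esub> M' (i, j)" if "i < n" "j < n" for i j
      using that by (simp add: mat_algebra_def mat_indices_def)
    interpret FPm: abelian_monoid FP by (rule FP_abelian_monoid)
    show ?case
    proof (intro exI[of _ "\<lambda>i j. H i j + H' i j"] conjI allI impI)
      fix d
      have "nonneg ((\<Sum>i<n. \<Sum>j<n. star (d i) * H i j * d j) + (\<Sum>i<n. \<Sum>j<n. star (d i) * H' i j * d j))"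
        using H H' by (intro nonneg_add) auto
      then show "nonneg (\<Sum>i<n. \<Sum>j<n. star (d i) * (H i j + H' i j) * d j)"
        by (simp add: distrib_left distrib_right sum.distrib)
    qed (use H H' lin in \<open>auto simp: star_add a D linear_map_def\<close>)
  qed
  have "completely_positive FP D \<Theta>"
    unfolding completely_positive_def
  proof (intro conjI lin allI impI ballI)
    fix n :: nat and M assume "M \<in> star_positive (mat_algebra n FP)"
    from gram[OF this] obtain H where H': "(\<forall>i<n. \<forall>j<n. star (H i j) = H j i) \<and>
      (\<forall>d. nonneg (\<Sum>i<n. \<Sum>j<n. star (d i) * H i j * d j)) \<and>
      (\<forall>i<n. \<forall>j<n. \<Theta> (M (i, j)) = coord D (H i j)) \<and> (\<forall>i<n. \<forall>j<n. M (i, j) \<in> carrier FP)" ..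
    have H: "star (H i j) = H j i" "\<Theta> (M (i, j)) = coord D (H i j)"
      if "i < n" "j < n" for i j
      using H' that by simp_all
    have pos: "nonneg (\<Sum>i<n. \<Sum>j<n. star (d i) * H i j * d j)" for d using H' by simp
    \<comment> \<open>The factorization takes place in the product algebra; the coordinates of Y at
      D then form the required matrix over D.\<close>
    have "\<exists>Y. \<forall>i<n. \<forall>j<n. H i j = (\<Sum>k<n. star (Y k i) * Y k j)"
      by (rule weakly_positive_factorization[of n H, OF H(1) pos]) blast+
    then obtain Y where Y: "\<And>i j. i < n \<Longrightarrow> j < n \<Longrightarrow> H i j = (\<Sum>k<n. star (Y k i) * Y k j)" by blast
    define y where "y = (\<lambda>p\<in>mat_indices n. coord D (Y (fst p) (snd p)))"
    have y: "y \<in> carrier (mat_algebra n D)" by (auto simp: y_def mat_algebra_def D)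
    have "(\<lambda>p\<in>mat_indices n. \<Theta> (M p)) = adj (mat_algebra n D) y \<otimes>\<^bsub>mat_algebra n D\<^esub> y"
    proof (rule extensionalityI[of _ "mat_indices n"])
      show "adj (mat_algebra n D) y \<otimes>\<^bsub>mat_algebra n D\<^esub> y \<in> extensional (mat_indices n)"
        by (auto simp: mat_algebra_def)
      fix p assume "p \<in> mat_indices n"
      then obtain i j where p: "p = (i, j)" "i < n" "j < n" by (auto simp: mat_indices_def)
      have "\<Theta> (M (i, j)) = finsum D (\<lambda>k. adj D (coord D (Y k i)) \<otimes>\<^bsub>D\<^esub> coord D (Y k j)) {..<n}"
        using p by (simp add: H(2) Y coord_sum D)
      also have "\<dots> = (adj (mat_algebra n D) y \<otimes>\<^bsub>mat_algebra n D\<^esub> y) (i, j)"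
        using p unfolding mat_algebra_def
        by (simp add: mat_indices_def) (intro D.finsum_cong'; auto simp: y_def mat_indices_def D D'.adj_closed)
      finally show "(\<lambda>p\<in>mat_indices n. \<Theta> (M p)) p = (adj (mat_algebra n D) y \<otimes>\<^bsub>mat_algebra n D\<^esub> y) p"
        using p by (simp add: mat_indices_def)
    qed simp
    then show "(\<lambda>p\<in>mat_indices n. \<Theta> (M p)) \<in> cstar_positive (mat_algebra n D)"
      using y by (auto simp: cstar_positive_def)
  qed
  then show ?thesis using bimod eq by simp
qed

end

theorem theorem3p6:
  fixes I :: "('i::linorder) set"
    and A :: "'i \<Rightarrow> 'a cstar_algebra"
    and B :: "'b cstar_algebra"
    and D :: "'d cstar_algebra"
    and \<iota> :: "'i \<Rightarrow> 'b \<Rightarrow> 'a"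
    and \<kappa> :: "'b \<Rightarrow> 'd"
    and \<psi> :: "'i \<Rightarrow> 'a \<Rightarrow> 'b"
    and \<theta> :: "'i \<Rightarrow> 'a \<Rightarrow> 'd"
  assumes "\<And>i. i \<in> I \<Longrightarrow> cstar_algebra (A i)"
    and "cstar_algebra D"
    and "cstar_algebra B"
    and "\<And>i. i \<in> I \<Longrightarrow> cstar_inclusion B (A i) (\<iota> i)"
    and "cstar_inclusion B D \<kappa>"
    and "\<And>i. i \<in> I \<Longrightarrow> positive_conditional_expectation (A i) B (\<iota> i) (\<psi> i)"
    and "\<And>i. i \<in> I \<Longrightarrow> \<theta> i \<one>\<^bsub>A i\<^esub> = \<one>\<^bsub>D\<^esub>"
    and "\<And>i. i \<in> I \<Longrightarrow> completely_positive (A i) D (\<theta> i)"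
    and "\<And>i. i \<in> I \<Longrightarrow>
          bimodule_map B (A i) (left_via (A i) (\<iota> i)) (right_via (A i) (\<iota> i))
            D (left_via D \<kappa>) (right_via D \<kappa>) (\<theta> i)"
  shows "completely_positive (free_product I A B \<iota>) D (monotone_product I A B \<iota> D \<kappa> \<psi> \<theta>) \<and>
         bimodule_map B (free_product I A B \<iota>) (free_left I A B \<iota>) (free_right I A B \<iota>)
           D (left_via D \<kappa>) (right_via D \<kappa>) (monotone_product I A B \<iota> D \<kappa> \<psi> \<theta>)"
  by (rule monotone_setup.monotone_product_cp, rule monotone_setup.intro) (fact assms)+

end
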